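(* Let $\mathfrak g$ be a differential graded Lie algebra over $\mathbb C$ and $h$ a differential graded $\mathfrak g$-module such that the $\mathfrak g$-module structure on $h$ is lifted to a structure of module over the differential graded Lie algebra $\mathfrak g\otimes\mathbb C[\xi]$. Let $H$ be the sheaf over $\mathcal M_{\mathfrak g}$ associated with $h$, i.e. the one which associates to $\gamma\in MC_{\mathfrak g}(R)$ the cohomology of $(h\otimes R,\mathcal D_\gamma)$. Then there is a natural flat connection $\nabla$ on the sheaf $H$: for $v\in \mathrm{Der}(R)$, the covariant derivative along $v$ acting on the cohomology of $\mathcal D_\gamma$, $\gamma\in MC_{\mathfrak g}(R)$, is given by $$\nabla_v=\frac{\partial}{\partial v}+i_{\frac{\partial\gamma}{\partial v}},$$ where $i_\alpha$ denotes the action on $h$ of the element $\xi\alpha\in\xi\mathfrak g\subset\mathfrak g\otimes\mathbb C[\xi]$.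
   Context: $\mathbb C[\xi]$ is the differential graded commutative algebra with generator $\xi$, $\xi^2=0$, $\deg\xi=-1$, and differential $d=\partial/\partial\xi$; $\mathfrak g\otimes\mathbb C[\xi]$ is the tensor product differential graded Lie algebra, containing $\mathfrak g=\mathfrak g\otimes1$. A graded $\mathbb C$-Artin algebra $R$ is a $\mathbb Z$-graded (graded-commutative) algebra isomorphic to $\mathbb C[t_s]_{s\in S}/I$ with $S$ finite and $I$ an ideal containing a sufficiently large power of the maximal ideal generated by the $t_s$; $\mathfrak M_R$ is its maximal ideal; $\mathrm{Der}(R)$ denotes its (graded) derivations, and $\partial/\partial v$ denotes the action of $v\in\mathrm{Der}(R)$ on the factor $R$ in $h\otimes R$ and $\mathfrak g\otimes R$ (Koszul signs are used throughout). $MC_{\mathfrak g}(R)=\{\gamma\in(\mathfrak g\otimes\mathfrak M_R)^1 : d\gamma+\tfrac12[\gamma,\gamma]=0\}$. For a $\mathfrak g$-module with differential $d_h$ and action $m:\mathfrak g\otimes h\to h$, and $\gamma\in MC_{\mathfrak g}(R)$, $\mathcal D_\gamma:=d_h+m(\gamma\otimes\,\cdot\,)$ is a differential on $h\otimes R$. The group $\exp\bigl((\mathfrak g\otimes\mathfrak M_R)^0\bigr)$ acts on $MC_{\mathfrak g}(R)$ by gauge transformations $\gamma^{\exp\alpha}=\sum_{n\ge0}\frac{(\mathrm{ad}\,\alpha)^n\gamma}{n!}-\sum_{n\ge0}\frac{(\mathrm{ad}\,\alpha)^n d\alpha}{(n+1)!}$, and $\mathcal M_{\mathfrak g}$ is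 the moduli space described by the functor $R\mapsto MC_{\mathfrak g}(R)/\exp\bigl((\mathfrak g\otimes\mathfrak M_R)^0\bigr)$. A sheaf over $\mathcal M_{\mathfrak g}$ is a functor associating to $R$ a representation, in the category of $R$-modules, of the groupoid with objects $MC_{\mathfrak g}(R)$ and morphisms $\gamma_1\to\gamma_2$ the gauge group elements transforming $\gamma_1$ to $\gamma_2$. For the sheaf $H$, the morphism $\exp\alpha:\gamma\to\gamma^{\exp\alpha}$ is represented by the isomorphism on cohomology induced by $\exp(m(\alpha\otimes\cdot))$ on $h\otimes R$. A flat connection on $H$ is understood in the same functorial sense: operators $\nabla_v$ on the $R$-modules of the representation satisfying the Leibniz rule, with $[\nabla_v,\nabla_w]=\nabla_{[v,w]}$, compatible with the groupoid action. *)

theory Defs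
  imports Complex_Main "HOL-Library.Poly_Mapping" "HOL-Library.Product_Plus"
begin

section \<open>Complex vector spaces and tensor products\<close>

class cvector = ab_group_add +
  fixes scaleC :: "complex \<Rightarrow> 'a \<Rightarrow> 'a"  (infixr "*\<^sub>C" 75)
  assumes scaleC_add_right: "c *\<^sub>C (x + y) = c *\<^sub>C x + c *\<^sub>C y"
    and scaleC_add_left: "(b + c) *\<^sub>C x = b *\<^sub>C x + c *\<^sub>C x"
    and scaleC_scaleC: "b *\<^sub>C c *\<^sub>C x = (b * c) *\<^sub>C x"
    and scaleC_one: "1 *\<^sub>C x = x"

global_interpretation cvector: vector_space "scaleC :: complex \<Rightarrow> 'a \<Rightarrow> 'a::cvector"
  by unfold_locales (simp_all add: scaleC_add_right scaleC_add_left scaleC_scaleC scaleC_one)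

abbreviation clinear :: "('a::cvector \<Rightarrow> 'b::cvector) \<Rightarrow> bool"
  where "clinear \<equiv> Vector_Spaces.linear scaleC scaleC"

definition cbilinear :: "('a::cvector \<Rightarrow> 'b::cvector \<Rightarrow> 'c::cvector) \<Rightarrow> bool"
  where "cbilinear f \<longleftrightarrow> (\<forall>x. clinear (f x)) \<and> (\<forall>y. clinear (\<lambda>x. f x y))"

instantiation complex :: cvector
begin
definition "scaleC_complex (c::complex) (x::complex) = c * x"
instance by standard (simp_all add: scaleC_complex_def algebra_simps)
end

instantiation prod :: (cvector, cvector) cvector
begin
definition "scaleC_prod c (p::'a \<times> 'b) = (c *\<^sub>C fst p, c *\<^sub>C snd p)"
instance
  by standard (simp_all add: scaleC_prod_def prod_eq_iff scaleC_add_right scaleC_add_left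
      scaleC_scaleC scaleC_one)
end

instantiation poly_mapping :: (type, cvector) cvector
begin
definition "scaleC_poly_mapping c (p::'a \<Rightarrow>\<^sub>0 'b) = Poly_Mapping.map (scaleC c) p"

lemma lookup_scaleC:
  "Poly_Mapping.lookup (c *\<^sub>C (p::'a \<Rightarrow>\<^sub>0 'b)) k = c *\<^sub>C Poly_Mapping.lookup p k"
  proof -
  have "c *\<^sub>C (0::'b) = 0"
    by (rule cvector.scale_zero_right)
  then show ?thesis
    by (simp add: scaleC_poly_mapping_def Poly_Mapping.map.rep_eq when_def)
qed

instance
  by standard (rule poly_mapping_eqI,
      simp add: lookup_scaleC Poly_Mapping.lookup_add scaleC_add_right scaleC_add_left
        scaleC_scaleC scaleC_one)+
end

text \<open>The tensor product over the complex numbers: the free vector space on pairs, modulo the span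
  of the bilinearity relations.\<close>

definition bilinear_rels :: "('a::cvector \<times> 'b::cvector \<Rightarrow>\<^sub>0 complex) set"
  where "bilinear_rels = cvector.span
    ({Poly_Mapping.single (x + x', y) 1 - Poly_Mapping.single (x, y) 1
        - Poly_Mapping.single (x', y) 1 | x x' y. True}
     \<union> {Poly_Mapping.single (x, y + y') 1 - Poly_Mapping.single (x, y) 1
        - Poly_Mapping.single (x, y') 1 | x y y'. True}
     \<union> {Poly_Mapping.single (c *\<^sub>C x, y) 1 - c *\<^sub>C Poly_Mapping.single (x, y) 1 | c x y. True}
     \<union> {Poly_Mapping.single (x, c *\<^sub>C y) 1 - c *\<^sub>C Poly_Mapping.single (x, y) 1 | c x y. True})"

definition tensor_eq ::
    "('a::cvector \<times> 'b::cvector \<Rightarrow>\<^sub>0 complex) \<Rightarrow> ('a \<times> 'b \<Rightarrow>\<^sub>0 complex) \<Rightarrow> bool"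
  where "tensor_eq p q \<longleftrightarrow> p - q \<in> bilinear_rels"

lemma bilinear_rels_closed:
  "0 \<in> bilinear_rels"
  "p \<in> bilinear_rels \<Longrightarrow> q \<in> bilinear_rels \<Longrightarrow> p + q \<in> bilinear_rels"
  "p \<in> bilinear_rels \<Longrightarrow> q \<in> bilinear_rels \<Longrightarrow> p - q \<in> bilinear_rels"
  "p \<in> bilinear_rels \<Longrightarrow> - p \<in> bilinear_rels"
  "p \<in> bilinear_rels \<Longrightarrow> c *\<^sub>C p \<in> bilinear_rels"
  unfolding bilinear_rels_def
  by (simp_all add: cvector.span_zero cvector.span_add cvector.span_diff cvector.span_neg
      cvector.span_scale)

quotient_type (overloaded) ('a, 'b) tensor =
  "('a::cvector \<times> 'b::cvector) \<Rightarrow>\<^sub>0 complex" / tensor_eq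
proof (rule equivpI)
  show "reflp (tensor_eq :: ('a \<times> 'b \<Rightarrow>\<^sub>0 complex) \<Rightarrow> _)"
    by (simp add: reflp_def tensor_eq_def bilinear_rels_closed)
  show "symp (tensor_eq :: ('a \<times> 'b \<Rightarrow>\<^sub>0 complex) \<Rightarrow> _)"
    unfolding symp_def tensor_eq_def using bilinear_rels_closed(4) by fastforce
  show "transp (tensor_eq :: ('a \<times> 'b \<Rightarrow>\<^sub>0 complex) \<Rightarrow> _)"
    unfolding transp_def tensor_eq_def using bilinear_rels_closed(2) by fastforce
qed

lemma diff_diff_diff: "(a - b) - (c - d) = (a - c) - (b - (d :: 'a::ab_group_add))"
  by (simp add: algebra_simps)

instantiation tensor :: (cvector, cvector) cvector
begin

lift_definition zero_tensor :: "('a, 'b) tensor" is 0 .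

lift_definition plus_tensor :: "('a, 'b) tensor \<Rightarrow> ('a, 'b) tensor \<Rightarrow> ('a, 'b) tensor" is "(+)"
  unfolding tensor_eq_def by (simp only: add_diff_add bilinear_rels_closed)

lift_definition minus_tensor :: "('a, 'b) tensor \<Rightarrow> ('a, 'b) tensor \<Rightarrow> ('a, 'b) tensor" is "(-)"
  unfolding tensor_eq_def by (simp only: diff_diff_diff bilinear_rels_closed)

lift_definition uminus_tensor :: "('a, 'b) tensor \<Rightarrow> ('a, 'b) tensor" is uminus
  unfolding tensor_eq_def by (simp only: minus_diff_minus bilinear_rels_closed)

lift_definition scaleC_tensor :: "complex \<Rightarrow> ('a, 'b) tensor \<Rightarrow> ('a, 'b) tensor" is scaleC
  unfolding tensor_eq_def
  by (simp only: cvector.scale_right_diff_distrib[symmetric] bilinear_rels_closed)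

instance
proof
  fix a b c :: "('a, 'b) tensor" and x y :: complex
  note refl = tensor_eq_def bilinear_rels_closed
  show "a + b + c = a + (b + c)" by transfer (simp add: refl add.assoc)
  show "a + b = b + a" by transfer (simp add: refl add.commute)
  show "0 + a = a" by transfer (simp add: refl)
  show "- a + a = 0" by transfer (simp add: refl)
  show "a - b = a + - b" by transfer (simp add: refl)
  show "x *\<^sub>C (a + b) = x *\<^sub>C a + x *\<^sub>C b" by transfer (simp add: refl scaleC_add_right)
  show "(x + y) *\<^sub>C a = x *\<^sub>C a + y *\<^sub>C a" by transfer (simp add: refl scaleC_add_left)
  show "x *\<^sub>C y *\<^sub>C a = (x * y) *\<^sub>C a" by transfer (simp add: refl scaleC_scaleC)
  show "1 *\<^sub>C a = a" by transfer (simp add: refl scaleC_one)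
qed

end

lift_definition tens :: "'a::cvector \<Rightarrow> 'b::cvector \<Rightarrow> ('a, 'b) tensor"  (infixl "\<otimes>" 70)
  is "\<lambda>x y. Poly_Mapping.single (x, y) 1" .

text \<open>The linear map induced by a bilinear map; the choice of representative is immaterial for
  bilinear maps, see \<open>tensor_lift_tens\<close> and \<open>clinear_tensor_lift\<close> below.\<close>

definition free_lift :: "('a::cvector \<Rightarrow> 'b::cvector \<Rightarrow> 'c::cvector) \<Rightarrow> ('a \<times> 'b \<Rightarrow>\<^sub>0 complex) \<Rightarrow> 'c"
  where "free_lift f p = (\<Sum>k\<in>Poly_Mapping.keys p. Poly_Mapping.lookup p k *\<^sub>C f (fst k) (snd k))"

definition tensor_lift ::
    "('a::cvector \<Rightarrow> 'b::cvector \<Rightarrow> 'c::cvector) \<Rightarrow> ('a, 'b) tensor \<Rightarrow> 'c"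
  where "tensor_lift f t = free_lift f (rep_tensor t)"

lemma free_lift_superset:
  assumes "finite S" "Poly_Mapping.keys p \<subseteq> S"
  shows "free_lift f p = (\<Sum>k\<in>S. Poly_Mapping.lookup p k *\<^sub>C f (fst k) (snd k))"
  unfolding free_lift_def
  by (rule sum.mono_neutral_left) (use assms in \<open>auto simp: Poly_Mapping.in_keys_iff\<close>)

lemma clinear_free_lift: "clinear (free_lift f)"
unfolding Vector_Spaces.linear_iff
proof (intro conjI allI)
  fix p q :: "'a \<times> 'b \<Rightarrow>\<^sub>0 complex" and c
  let ?S = "Poly_Mapping.keys p \<union> Poly_Mapping.keys q"
  have "Poly_Mapping.keys (p + q) \<subseteq> ?S" by (rule Poly_Mapping.keys_add)
  then show "free_lift f (p + q) = free_lift f p + free_lift f q"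
    by (simp add: free_lift_superset[of ?S] Poly_Mapping.lookup_add scaleC_add_left sum.distrib)
  have "Poly_Mapping.keys (c *\<^sub>C p) \<subseteq> Poly_Mapping.keys p"
    by (auto simp: Poly_Mapping.in_keys_iff lookup_scaleC scaleC_complex_def)
  then show "free_lift f (c *\<^sub>C p) = c *\<^sub>C free_lift f p"
    by (simp add: free_lift_superset[of "Poly_Mapping.keys p"] lookup_scaleC scaleC_complex_def
        cvector.scale_sum_right scaleC_scaleC)
qed unfold_locales

lemma free_lift_single: "free_lift f (Poly_Mapping.single (x, y) 1) = f x y"
  by (simp add: free_lift_def scaleC_one)

lemma free_lift_rels:
  assumes f: "cbilinear f" and p: "p \<in> bilinear_rels"
  shows "free_lift f p = 0"
proof -
  interpret L: Vector_Spaces.linear scaleC scaleC "free_lift f" by (rule clinear_free_lift)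
  have "f (x + x') y = f x y + f x' y" "f (c *\<^sub>C x) y = c *\<^sub>C f x y"
    "f x (y + y') = f x y + f x y'" "f x (c *\<^sub>C y) = c *\<^sub>C f x y" for x x' y y' c
    using f by (auto simp: cbilinear_def Vector_Spaces.linear_iff)
  note * = this
  show ?thesis
    using p unfolding bilinear_rels_def
    by (rule L.eq_0_on_span[rotated])
      (auto simp: L.diff L.scale free_lift_single *)
qed

lemma tensor_lift_abs: "cbilinear f \<Longrightarrow> tensor_lift f (abs_tensor p) = free_lift f p"
proof -
  assume f: "cbilinear f"
  interpret L: Vector_Spaces.linear scaleC scaleC "free_lift f" by (rule clinear_free_lift)
  have "tensor_eq (rep_tensor (abs_tensor p)) p"
    by (rule Quotient3_rep_abs[OF Quotient3_tensor]) (simp add: tensor_eq_def bilinear_rels_closed)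
  then have "free_lift f (rep_tensor (abs_tensor p) - p) = 0"
    by (simp add: tensor_eq_def free_lift_rels[OF f])
  then show ?thesis by (simp add: L.diff tensor_lift_def)
qed

lemma tensor_lift_tens: "cbilinear f \<Longrightarrow> tensor_lift f (x \<otimes> y) = f x y"
  by (simp add: tens.abs_eq tensor_lift_abs free_lift_single)

lemma clinear_tensor_lift:
  assumes "cbilinear f"
  shows "clinear (tensor_lift f)"
unfolding Vector_Spaces.linear_iff
proof (intro conjI allI)
  interpret L: Vector_Spaces.linear scaleC scaleC "free_lift f" by (rule clinear_free_lift)
  fix s t :: "('a, 'b) tensor" and c
  obtain p q where "s = abs_tensor p" "t = abs_tensor q"
    using Quotient3_abs_rep[OF Quotient3_tensor] by metis
  then show "tensor_lift f (s + t) = tensor_lift f s + tensor_lift f t"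
    "tensor_lift f (c *\<^sub>C s) = c *\<^sub>C tensor_lift f s"
    by (simp_all add: plus_tensor.abs_eq scaleC_tensor.abs_eq tensor_lift_abs[OF assms]
        L.add L.scale)
qed unfold_locales


section \<open>Gradings and Koszul signs\<close>

definition is_decomp :: "(int \<Rightarrow> 'a::cvector set) \<Rightarrow> 'a \<Rightarrow> (int \<Rightarrow> 'a) \<Rightarrow> bool"
  where "is_decomp G x c \<longleftrightarrow>
    finite {i. c i \<noteq> 0} \<and> (\<forall>i. c i \<in> G i) \<and> x = (\<Sum>i | c i \<noteq> 0. c i)"

definition grading :: "(int \<Rightarrow> 'a::cvector set) \<Rightarrow> bool"
  where "grading G \<longleftrightarrow> (\<forall>i. cvector.subspace (G i)) \<and> (\<forall>x. \<exists>!c. is_decomp G x c)"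

definition hpart :: "(int \<Rightarrow> 'a::cvector set) \<Rightarrow> 'a \<Rightarrow> int \<Rightarrow> 'a"
  where "hpart G x = (THE c. is_decomp G x c)"

definition ksign :: "int \<Rightarrow> complex"
  where "ksign n = (if even n then 1 else - 1)"

text \<open>\<open>hsum G x f\<close> is the sum of \<open>f j x\<^sub>j\<close> over the nonzero homogeneous components of \<open>x\<close>.\<close>

definition hsum :: "(int \<Rightarrow> 'a::cvector set) \<Rightarrow> 'a \<Rightarrow> (int \<Rightarrow> 'a \<Rightarrow> 'b::cvector) \<Rightarrow> 'b"
  where "hsum G x f = (\<Sum>j | hpart G x j \<noteq> 0. f j (hpart G x j))"

text \<open>The parity involution: \<open>par G x = (-1)\<^bsup>|x|\<^esup> x\<close> for homogeneous \<open>x\<close>.\<close>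

definition par :: "(int \<Rightarrow> 'a::cvector set) \<Rightarrow> 'a \<Rightarrow> 'a"
  where "par G x = hsum G x (\<lambda>j y. ksign j *\<^sub>C y)"

text \<open>Koszul signs for moving past something of degree \<open>j\<close>: \<open>kos G j x = (-1)\<^bsup>j|x|\<^esup> x\<close> for a
  homogeneous element \<open>x\<close>, and \<open>kos_op G j v = (-1)\<^bsup>j|v|\<^esup> v\<close> for a homogeneous linear
  endomorphism \<open>v\<close>; both are extended linearly to inhomogeneous arguments.\<close>

definition kos :: "(int \<Rightarrow> 'a::cvector set) \<Rightarrow> int \<Rightarrow> 'a \<Rightarrow> 'a"
  where "kos G j x = (if even j then x else par G x)"

definition kos_op :: "(int \<Rightarrow> 'a::cvector set) \<Rightarrow> int \<Rightarrow> ('a \<Rightarrow> 'a) \<Rightarrow> 'a \<Rightarrow> 'a"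
  where "kos_op G j v = (if even j then v else (\<lambda>x. par G (v (par G x))))"

definition tensor_gr ::
    "(int \<Rightarrow> 'a::cvector set) \<Rightarrow> (int \<Rightarrow> 'b::cvector set) \<Rightarrow> int \<Rightarrow> ('a, 'b) tensor set"
  where "tensor_gr G K n = cvector.span {x \<otimes> y | x y i j. x \<in> G i \<and> y \<in> K j \<and> i + j = n}"


section \<open>Differential graded structures\<close>

record 'a dg =
  Gr :: "int \<Rightarrow> 'a set"
  Dif :: "'a \<Rightarrow> 'a"

record 'a dgl = "'a dg" +
  Br :: "'a \<Rightarrow> 'a \<Rightarrow> 'a"

record 'a dga = "'a dg" +
  Mul :: "'a \<Rightarrow> 'a \<Rightarrow> 'a"
  One :: "'a"

definition dg_space :: "('a::cvector, 'm) dg_scheme \<Rightarrow> bool"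
  where "dg_space V \<longleftrightarrow> grading (Gr V) \<and> clinear (Dif V)
    \<and> (\<forall>i. \<forall>x\<in>Gr V i. Dif V x \<in> Gr V (i + 1)) \<and> (\<forall>x. Dif V (Dif V x) = 0)"

definition dg_lie_algebra :: "'a::cvector dgl \<Rightarrow> bool"
  where "dg_lie_algebra L \<longleftrightarrow> dg_space L \<and> cbilinear (Br L)
    \<and> (\<forall>i j. \<forall>x\<in>Gr L i. \<forall>y\<in>Gr L j. Br L x y \<in> Gr L (i + j))
    \<and> (\<forall>i j. \<forall>x\<in>Gr L i. \<forall>y\<in>Gr L j. Br L x y = - (ksign (i * j) *\<^sub>C Br L y x))
    \<and> (\<forall>i j. \<forall>x\<in>Gr L i. \<forall>y\<in>Gr L j. \<forall>z.
          Br L x (Br L y z) = Br L (Br L x y) z + ksign (i * j) *\<^sub>C Br L y (Br L x z))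
    \<and> (\<forall>i. \<forall>x\<in>Gr L i. \<forall>y. Dif L (Br L x y) = Br L (Dif L x) y + ksign i *\<^sub>C Br L x (Dif L y))"

definition dg_comm_algebra :: "'a::cvector dga \<Rightarrow> bool"
  where "dg_comm_algebra A \<longleftrightarrow> dg_space A \<and> cbilinear (Mul A)
    \<and> (\<forall>i j. \<forall>x\<in>Gr A i. \<forall>y\<in>Gr A j. Mul A x y \<in> Gr A (i + j))
    \<and> (\<forall>x y z. Mul A (Mul A x y) z = Mul A x (Mul A y z))
    \<and> One A \<in> Gr A 0 \<and> (\<forall>x. Mul A (One A) x = x \<and> Mul A x (One A) = x)
    \<and> (\<forall>i j. \<forall>x\<in>Gr A i. \<forall>y\<in>Gr A j. Mul A x y = ksign (i * j) *\<^sub>C Mul A y x)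
    \<and> (\<forall>i. \<forall>x\<in>Gr A i. \<forall>y. Dif A (Mul A x y) = Mul A (Dif A x) y + ksign i *\<^sub>C Mul A x (Dif A y))"

definition dg_lie_module ::
    "'a::cvector dgl \<Rightarrow> 'h::cvector dg \<Rightarrow> ('a \<Rightarrow> 'h \<Rightarrow> 'h) \<Rightarrow> bool"
  where "dg_lie_module L h act \<longleftrightarrow> dg_space h \<and> cbilinear act
    \<and> (\<forall>i j. \<forall>a\<in>Gr L i. \<forall>x\<in>Gr h j. act a x \<in> Gr h (i + j))
    \<and> (\<forall>i j. \<forall>a\<in>Gr L i. \<forall>b\<in>Gr L j. \<forall>x.
          act (Br L a b) x = act a (act b x) - ksign (i * j) *\<^sub>C act b (act a x))
    \<and> (\<forall>i. \<forall>a\<in>Gr L i. \<forall>x. Dif h (act a x) = act (Dif L a) x + ksign i *\<^sub>C act a (Dif h x))"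

definition tensor_dif ::
    "('a::cvector, 'm) dg_scheme \<Rightarrow> ('b::cvector, 'n) dg_scheme \<Rightarrow> ('a, 'b) tensor \<Rightarrow> ('a, 'b) tensor"
  where "tensor_dif V W = tensor_lift (\<lambda>x y. Dif V x \<otimes> y + par (Gr V) x \<otimes> Dif W y)"

text \<open>\<open>[x \<otimes> p, y \<otimes> q] = (-1)\<^bsup>|p||y|\<^esup> [x, y] \<otimes> pq\<close>\<close>

definition tensor_br ::
    "'a::cvector dgl \<Rightarrow> 'b::cvector dga \<Rightarrow> ('a, 'b) tensor \<Rightarrow> ('a, 'b) tensor \<Rightarrow> ('a, 'b) tensor"
  where "tensor_br L A s t =
    tensor_lift (\<lambda>x p. tensor_lift (\<lambda>y q.
      hsum (Gr L) y (\<lambda>j y\<^sub>j. Br L x y\<^sub>j \<otimes> Mul A (kos (Gr A) j p) q)) t) s"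

definition tensor_dgl :: "'a::cvector dgl \<Rightarrow> 'b::cvector dga \<Rightarrow> ('a, 'b) tensor dgl"
  where "tensor_dgl L A =
    \<lparr>Gr = tensor_gr (Gr L) (Gr A), Dif = tensor_dif L A, Br = tensor_br L A\<rparr>"

text \<open>The algebra generated by \<open>\<xi>\<close>: the pair \<open>(a, b)\<close> stands for \<open>a + b \<xi>\<close>.\<close>

type_synonym cxi = "complex \<times> complex"

definition Cxi :: "cxi dga"
  where "Cxi =
    \<lparr>Gr = (\<lambda>i. if i = 0 then {(a, 0) | a. True} else if i = - 1 then {(0, b) | b. True} else {0}),
     Dif = (\<lambda>(a, b). (b, 0)),
     Mul = (\<lambda>(a, b) (a', b'). (a * a', a * b' + b * a')),
     One = (1, 0)\<rparr>"

definition xi :: cxi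
  where "xi = (0, 1)"

text \<open>\<open>\<xi>\<alpha> = (-1)\<^bsup>|\<alpha>|\<^esup> \<alpha> \<otimes> \<xi>\<close>\<close>

definition xi_times :: "'g::cvector dgl \<Rightarrow> 'g \<Rightarrow> ('g, cxi) tensor"
  where "xi_times g \<alpha> = par (Gr g) \<alpha> \<otimes> xi"


section \<open>Graded Artin algebras\<close>

text \<open>The free graded-commutative algebra on \<open>t\<^sub>0, \<dots>, t\<^sub>n\<^sub>-\<^sub>1\<close> of degrees \<open>deg s\<close>.  A monomial is an
  exponent vector standing for the product of the \<open>t\<^sub>s\<close> in increasing order of \<open>s\<close>; odd variables
  have square zero.  Reordering the product of two monomials produces the sign in \<open>mon_sign\<close>.\<close>

type_synonym gpoly = "(nat \<Rightarrow>\<^sub>0 nat) \<Rightarrow>\<^sub>0 complex"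

definition gmons :: "nat \<Rightarrow> (nat \<Rightarrow> int) \<Rightarrow> (nat \<Rightarrow>\<^sub>0 nat) set"
  where "gmons n deg =
    {a. Poly_Mapping.keys a \<subseteq> {..<n} \<and> (\<forall>s. odd (deg s) \<longrightarrow> Poly_Mapping.lookup a s \<le> 1)}"

definition gpolys :: "nat \<Rightarrow> (nat \<Rightarrow> int) \<Rightarrow> gpoly set"
  where "gpolys n deg = {p. Poly_Mapping.keys p \<subseteq> gmons n deg}"

definition mon_deg :: "(nat \<Rightarrow> int) \<Rightarrow> (nat \<Rightarrow>\<^sub>0 nat) \<Rightarrow> int"
  where "mon_deg deg a = (\<Sum>s\<in>Poly_Mapping.keys a. int (Poly_Mapping.lookup a s) * deg s)"

definition mon_length :: "(nat \<Rightarrow>\<^sub>0 nat) \<Rightarrow> nat"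
  where "mon_length a = (\<Sum>s\<in>Poly_Mapping.keys a. Poly_Mapping.lookup a s)"

definition mon_sign :: "(nat \<Rightarrow> int) \<Rightarrow> (nat \<Rightarrow>\<^sub>0 nat) \<Rightarrow> (nat \<Rightarrow>\<^sub>0 nat) \<Rightarrow> complex"
  where "mon_sign deg a b =
    (if \<exists>s. odd (deg s) \<and> Poly_Mapping.lookup a s + Poly_Mapping.lookup b s > 1 then 0
     else ksign (\<Sum>s\<in>Poly_Mapping.keys a. \<Sum>u\<in>{u \<in> Poly_Mapping.keys b. u < s}.
                   int (Poly_Mapping.lookup a s) * int (Poly_Mapping.lookup b u) * deg s * deg u))"

definition gmult :: "(nat \<Rightarrow> int) \<Rightarrow> gpoly \<Rightarrow> gpoly \<Rightarrow> gpoly"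
  where "gmult deg p q = (\<Sum>a\<in>Poly_Mapping.keys p. \<Sum>b\<in>Poly_Mapping.keys q.
    Poly_Mapping.single (a + b)
      (mon_sign deg a b * Poly_Mapping.lookup p a * Poly_Mapping.lookup q b))"

text \<open>A graded Artin algebra, regarded as a dg algebra with zero differential.  An isomorphism with
  \<open>\<complex>[t\<^sub>s]/I\<close> is the same as a surjective homomorphism \<open>\<phi>\<close> of graded algebras from \<open>\<complex>[t\<^sub>s]\<close> with
  kernel \<open>I\<close>; the \<open>N\<close>-th power of the ideal generated by the \<open>t\<^sub>s\<close> consists of the polynomials
  all of whose monomials have length at least \<open>N\<close>.  The condition \<open>One R \<noteq> 0\<close> says that \<open>I\<close> is
  proper, so that \<open>R\<close> has a maximal ideal.\<close>

definition graded_artin :: "'r::cvector dga \<Rightarrow> bool"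
  where "graded_artin R \<longleftrightarrow> dg_comm_algebra R \<and> Dif R = (\<lambda>_. 0) \<and> One R \<noteq> 0
    \<and> (\<exists>n deg (\<phi> :: gpoly \<Rightarrow> 'r) N. clinear \<phi>
        \<and> \<phi> (Poly_Mapping.single 0 1) = One R
        \<and> (\<forall>p\<in>gpolys n deg. \<forall>q\<in>gpolys n deg. \<phi> (gmult deg p q) = Mul R (\<phi> p) (\<phi> q))
        \<and> (\<forall>a\<in>gmons n deg. \<phi> (Poly_Mapping.single a 1) \<in> Gr R (mon_deg deg a))
        \<and> \<phi> ` gpolys n deg = UNIV
        \<and> (\<forall>p\<in>gpolys n deg. (\<forall>a\<in>Poly_Mapping.keys p. mon_length a \<ge> N) \<longrightarrow> \<phi> p = 0))"

definition alg_ideal :: "'r::cvector dga \<Rightarrow> 'r set \<Rightarrow> bool"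
  where "alg_ideal R J \<longleftrightarrow> cvector.subspace J \<and> (\<forall>r. \<forall>x\<in>J. Mul R r x \<in> J \<and> Mul R x r \<in> J)"

definition max_ideal :: "'r::cvector dga \<Rightarrow> 'r set"
  where "max_ideal R = (THE M. alg_ideal R M \<and> M \<noteq> UNIV
    \<and> (\<forall>J. alg_ideal R J \<and> M \<subseteq> J \<longrightarrow> J = M \<or> J = UNIV))"

definition artin_hom :: "'r::cvector dga \<Rightarrow> 's::cvector dga \<Rightarrow> ('r \<Rightarrow> 's) \<Rightarrow> bool"
  where "artin_hom R R' \<phi> \<longleftrightarrow> clinear \<phi> \<and> (\<forall>i. \<forall>r\<in>Gr R i. \<phi> r \<in> Gr R' i)
    \<and> (\<forall>r s. \<phi> (Mul R r s) = Mul R' (\<phi> r) (\<phi> s)) \<and> \<phi> (One R) = One R'"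

definition Der_hom :: "'r::cvector dga \<Rightarrow> int \<Rightarrow> ('r \<Rightarrow> 'r) set"
  where "Der_hom R k = {v. clinear v \<and> (\<forall>i. \<forall>r\<in>Gr R i. v r \<in> Gr R (i + k))
    \<and> (\<forall>i. \<forall>r\<in>Gr R i. \<forall>s. v (Mul R r s) = Mul R (v r) s + ksign (k * i) *\<^sub>C Mul R r (v s))}"

definition Der :: "'r::cvector dga \<Rightarrow> ('r \<Rightarrow> 'r) set"
  where "Der R = {(\<lambda>r. \<Sum>k\<in>K. w k r) | K w. finite K \<and> (\<forall>k\<in>K. w k \<in> Der_hom R k)}"

definition der_bracket :: "int \<Rightarrow> int \<Rightarrow> ('r::cvector \<Rightarrow> 'r) \<Rightarrow> ('r \<Rightarrow> 'r) \<Rightarrow> 'r \<Rightarrow> 'r"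
  where "der_bracket k l v w = (\<lambda>r. v (w r) - ksign (k * l) *\<^sub>C w (v r))"


section \<open>Operators on tensor products with \<open>R\<close>\<close>

text \<open>\<open>r \<cdot> (x \<otimes> s) = (-1)\<^bsup>|r||x|\<^esup> x \<otimes> rs\<close>\<close>

definition R_scale ::
    "('h::cvector, 'm) dg_scheme \<Rightarrow> 'r::cvector dga \<Rightarrow> 'r \<Rightarrow> ('h, 'r) tensor \<Rightarrow> ('h, 'r) tensor"
  where "R_scale h R r =
    tensor_lift (\<lambda>x s. hsum (Gr h) x (\<lambda>j x\<^sub>j. x\<^sub>j \<otimes> Mul R (kos (Gr R) j r) s))"

text \<open>\<open>(\<partial>/\<partial>v) (x \<otimes> r) = (-1)\<^bsup>|v||x|\<^esup> x \<otimes> v r\<close>\<close>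

definition dd ::
    "('h::cvector, 'm) dg_scheme \<Rightarrow> 'r::cvector dga \<Rightarrow> ('r \<Rightarrow> 'r) \<Rightarrow> ('h, 'r) tensor \<Rightarrow> ('h, 'r) tensor"
  where "dd h R v = tensor_lift (\<lambda>x r. hsum (Gr h) x (\<lambda>j x\<^sub>j. x\<^sub>j \<otimes> kos_op (Gr R) j v r))"

text \<open>\<open>(a \<otimes> r) \<cdot> (x \<otimes> s) = (-1)\<^bsup>|r||x|\<^esup> (a \<cdot> x) \<otimes> rs\<close>\<close>

definition ext_act ::
    "'h::cvector dg \<Rightarrow> 'r::cvector dga \<Rightarrow> ('a::cvector \<Rightarrow> 'h \<Rightarrow> 'h) \<Rightarrow>
      ('a, 'r) tensor \<Rightarrow> ('h, 'r) tensor \<Rightarrow> ('h, 'r) tensor"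
  where "ext_act h R act t y =
    tensor_lift (\<lambda>a r. tensor_lift (\<lambda>x s.
      hsum (Gr h) x (\<lambda>j x\<^sub>j. act a x\<^sub>j \<otimes> Mul R (kos (Gr R) j r) s)) y) t"

definition base_change :: "('r::cvector \<Rightarrow> 's::cvector) \<Rightarrow> ('a::cvector, 'r) tensor \<Rightarrow> ('a, 's) tensor"
  where "base_change \<phi> = tensor_lift (\<lambda>x r. x \<otimes> \<phi> r)"

text \<open>Sum of a sequence almost all of whose terms vanish.\<close>

definition fin_sum :: "(nat \<Rightarrow> 'a::cvector) \<Rightarrow> 'a"
  where "fin_sum t = (\<Sum>n | t n \<noteq> 0. t n)"

definition op_exp :: "('a::cvector \<Rightarrow> 'a) \<Rightarrow> 'a \<Rightarrow> 'a"
  where "op_exp T y = fin_sum (\<lambda>n. inverse (fact n) *\<^sub>C (T ^^ n) y)"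


section \<open>Maurer--Cartan elements and gauge transformations\<close>

definition gM :: "'g::cvector dgl \<Rightarrow> 'r::cvector dga \<Rightarrow> int \<Rightarrow> ('g, 'r) tensor set"
  where "gM g R n = tensor_gr (Gr g) (\<lambda>j. Gr R j \<inter> max_ideal R) n"

definition MC :: "'g::cvector dgl \<Rightarrow> 'r::cvector dga \<Rightarrow> ('g, 'r) tensor set"
  where "MC g R = {\<gamma> \<in> gM g R 1. Dif (tensor_dgl g R) \<gamma> + (1/2) *\<^sub>C Br (tensor_dgl g R) \<gamma> \<gamma> = 0}"

definition gauge ::
    "'g::cvector dgl \<Rightarrow> 'r::cvector dga \<Rightarrow> ('g, 'r) tensor \<Rightarrow> ('g, 'r) tensor \<Rightarrow> ('g, 'r) tensor"
  where "gauge g R \<alpha> \<gamma> = (let ad = Br (tensor_dgl g R) \<alpha> in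
      fin_sum (\<lambda>n. inverse (fact n) *\<^sub>C (ad ^^ n) \<gamma>)
    - fin_sum (\<lambda>n. inverse (fact (n + 1)) *\<^sub>C (ad ^^ n) (Dif (tensor_dgl g R) \<alpha>)))"

text \<open>\<open>\<alpha>\<close> represents the morphism \<open>exp \<alpha> : \<gamma>\<^sub>1 \<rightarrow> \<gamma>\<^sub>2\<close> of the gauge groupoid.\<close>

definition gauge_mor ::
    "'g::cvector dgl \<Rightarrow> 'r::cvector dga \<Rightarrow> ('g, 'r) tensor \<Rightarrow> ('g, 'r) tensor \<Rightarrow> ('g, 'r) tensor \<Rightarrow> bool"
  where "gauge_mor g R \<alpha> \<gamma>\<^sub>1 \<gamma>\<^sub>2 \<longleftrightarrow>
    \<alpha> \<in> gM g R 0 \<and> \<gamma>\<^sub>1 \<in> MC g R \<and> \<gamma>\<^sub>2 \<in> MC g R \<and> gauge g R \<alpha> \<gamma>\<^sub>1 = \<gamma>\<^sub>2"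


section \<open>Cohomology\<close>

text \<open>Cohomology is the set of cosets of the coboundaries in the cocycles; \<open>coh_map D' T\<close> is the map
  induced on cosets by a map \<open>T\<close> carrying cocycles to cocycles and coboundaries to coboundaries,
  \<open>D'\<close> being the differential of the target.\<close>

definition coh_class :: "('a::cvector \<Rightarrow> 'a) \<Rightarrow> 'a \<Rightarrow> 'a set"
  where "coh_class D z = {z + D y | y. True}"

definition cohomology :: "('a::cvector \<Rightarrow> 'a) \<Rightarrow> 'a set set"
  where "cohomology D = {coh_class D z | z. D z = 0}"

definition coh_map :: "('b::cvector \<Rightarrow> 'b) \<Rightarrow> ('a::cvector \<Rightarrow> 'b) \<Rightarrow> 'a set \<Rightarrow> 'b set"
  where "coh_map D' T C = (\<Union>z\<in>C. coh_class D' (T z))"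

record ('r, 'c) rmodule =
  Car :: "'c set"
  Add :: "'c \<Rightarrow> 'c \<Rightarrow> 'c"
  Scale :: "'r \<Rightarrow> 'c \<Rightarrow> 'c"

definition D_op ::
    "'h::cvector dg \<Rightarrow> ('g::cvector \<Rightarrow> 'h \<Rightarrow> 'h) \<Rightarrow> 'r::cvector dga \<Rightarrow> ('g, 'r) tensor \<Rightarrow>
      ('h, 'r) tensor \<Rightarrow> ('h, 'r) tensor"
  where "D_op h m R \<gamma> y = tensor_dif h R y + ext_act h R m \<gamma> y"

definition H_sheaf ::
    "'h::cvector dg \<Rightarrow> ('g::cvector \<Rightarrow> 'h \<Rightarrow> 'h) \<Rightarrow> 'r::cvector dga \<Rightarrow> ('g, 'r) tensor \<Rightarrow>
      ('r, ('h, 'r) tensor set) rmodule"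
  where "H_sheaf h m R \<gamma> =
    \<lparr>Car = cohomology (D_op h m R \<gamma>),
     Add = (\<lambda>A B. {a + b | a b. a \<in> A \<and> b \<in> B}),
     Scale = (\<lambda>r. coh_map (D_op h m R \<gamma>) (R_scale h R r))\<rparr>"

definition H_trans ::
    "'h::cvector dg \<Rightarrow> ('g::cvector \<Rightarrow> 'h \<Rightarrow> 'h) \<Rightarrow> 'r::cvector dga \<Rightarrow> ('g, 'r) tensor \<Rightarrow>
      ('g, 'r) tensor \<Rightarrow> ('g, 'r) tensor \<Rightarrow> ('h, 'r) tensor set \<Rightarrow> ('h, 'r) tensor set"
  where "H_trans h m R \<alpha> \<gamma>\<^sub>1 \<gamma>\<^sub>2 = coh_map (D_op h m R \<gamma>\<^sub>2) (op_exp (ext_act h R m \<alpha>))"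


section \<open>The connection\<close>

text \<open>A flat connection on a representation, by \<open>R\<close>-modules \<open>X \<gamma>\<close> and isomorphisms
  \<open>tr \<alpha> \<gamma>\<^sub>1 \<gamma>\<^sub>2\<close>, of the groupoid with objects \<open>Ob\<close> and morphisms \<open>Mor\<close>.\<close>

definition flat_connection ::
    "'r::cvector dga \<Rightarrow> 'o set \<Rightarrow> ('m \<Rightarrow> 'o \<Rightarrow> 'o \<Rightarrow> bool) \<Rightarrow> ('o \<Rightarrow> ('r, 'c) rmodule) \<Rightarrow>
      ('m \<Rightarrow> 'o \<Rightarrow> 'o \<Rightarrow> 'c \<Rightarrow> 'c) \<Rightarrow> ('o \<Rightarrow> ('r \<Rightarrow> 'r) \<Rightarrow> 'c \<Rightarrow> 'c) \<Rightarrow> bool"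
  where "flat_connection R Ob Mor X tr nab \<longleftrightarrow>
    \<comment> \<open>additive operators on each module\<close>
    (\<forall>\<gamma>\<in>Ob. \<forall>v\<in>Der R. \<forall>c\<in>Car (X \<gamma>). nab \<gamma> v c \<in> Car (X \<gamma>)) \<and>
    (\<forall>\<gamma>\<in>Ob. \<forall>v\<in>Der R. \<forall>c\<in>Car (X \<gamma>). \<forall>c'\<in>Car (X \<gamma>).
      nab \<gamma> v (Add (X \<gamma>) c c') = Add (X \<gamma>) (nab \<gamma> v c) (nab \<gamma> v c')) \<and>
    \<comment> \<open>\<open>R\<close>-linearity in the vector field\<close>
    (\<forall>\<gamma>\<in>Ob. \<forall>v\<in>Der R. \<forall>w\<in>Der R. \<forall>c\<in>Car (X \<gamma>).
      nab \<gamma> (\<lambda>r. v r + w r) c = Add (X \<gamma>) (nab \<gamma> v c) (nab \<gamma> w c)) \<and>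
    (\<forall>\<gamma>\<in>Ob. \<forall>v\<in>Der R. \<forall>r. \<forall>c\<in>Car (X \<gamma>).
      nab \<gamma> (\<lambda>s. Mul R r (v s)) c = Scale (X \<gamma>) r (nab \<gamma> v c)) \<and>
    \<comment> \<open>Leibniz rule\<close>
    (\<forall>\<gamma>\<in>Ob. \<forall>k i. \<forall>v\<in>Der_hom R k. \<forall>r\<in>Gr R i. \<forall>c\<in>Car (X \<gamma>).
      nab \<gamma> v (Scale (X \<gamma>) r c) =
        Add (X \<gamma>) (Scale (X \<gamma>) (v r) c) (Scale (X \<gamma>) (ksign (k * i) *\<^sub>C r) (nab \<gamma> v c))) \<and>
    \<comment> \<open>flatness, for the graded commutator\<close>
    (\<forall>\<gamma>\<in>Ob. \<forall>k l. \<forall>v\<in>Der_hom R k. \<forall>w\<in>Der_hom R l. \<forall>c\<in>Car (X \<gamma>).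
      Add (X \<gamma>) (nab \<gamma> v (nab \<gamma> w c))
        (Scale (X \<gamma>) (- (ksign (k * l) *\<^sub>C One R)) (nab \<gamma> w (nab \<gamma> v c)))
      = nab \<gamma> (der_bracket k l v w) c) \<and>
    \<comment> \<open>compatibility with the groupoid action\<close>
    (\<forall>\<alpha> \<gamma>\<^sub>1 \<gamma>\<^sub>2. \<gamma>\<^sub>1 \<in> Ob \<and> \<gamma>\<^sub>2 \<in> Ob \<and> Mor \<alpha> \<gamma>\<^sub>1 \<gamma>\<^sub>2 \<longrightarrow> (\<forall>v\<in>Der R. \<forall>c\<in>Car (X \<gamma>\<^sub>1).
      tr \<alpha> \<gamma>\<^sub>1 \<gamma>\<^sub>2 (nab \<gamma>\<^sub>1 v c) = nab \<gamma>\<^sub>2 v (tr \<alpha> \<gamma>\<^sub>1 \<gamma>\<^sub>2 c)))"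

text \<open>The action on \<open>h \<otimes> R\<close> of \<open>\<xi>\<alpha>\<close>, for \<open>\<alpha>\<close> in \<open>g \<otimes> R\<close>; \<open>mx\<close> is the action of \<open>g \<otimes> \<complex>[\<xi>]\<close>.\<close>

definition i_op ::
    "'g::cvector dgl \<Rightarrow> 'h::cvector dg \<Rightarrow> (('g, cxi) tensor \<Rightarrow> 'h \<Rightarrow> 'h) \<Rightarrow> 'r::cvector dga \<Rightarrow>
      ('g, 'r) tensor \<Rightarrow> ('h, 'r) tensor \<Rightarrow> ('h, 'r) tensor"
  where "i_op g h mx R = ext_act h R (\<lambda>a. mx (xi_times g a))"

text \<open>\<open>\<partial>/\<partial>v + i\<^bsub>\<partial>\<gamma>/\<partial>v\<^esub>\<close>.  The symbol \<open>i\<close> is odd because \<open>\<xi>\<close> is, so moving \<open>\<partial>/\<partial>v\<close> past it contributes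
  the Koszul sign \<open>(-1)\<^bsup>|v|\<^esup>\<close>: the second summand is the action of \<open>\<partial>(\<xi>\<gamma>)/\<partial>v\<close>.  For odd \<open>v\<close>
  the operator without this sign does not commute with the differential.\<close>

definition nabla ::
    "'g::cvector dgl \<Rightarrow> 'h::cvector dg \<Rightarrow> (('g, cxi) tensor \<Rightarrow> 'h \<Rightarrow> 'h) \<Rightarrow> 'r::cvector dga \<Rightarrow>
      ('g, 'r) tensor \<Rightarrow> ('r \<Rightarrow> 'r) \<Rightarrow> ('h, 'r) tensor \<Rightarrow> ('h, 'r) tensor"
  where "nabla g h mx R \<gamma> v y =
    dd h R v y + i_op g h mx R (dd g R (kos_op (Gr R) (- 1) v) \<gamma>) y"

definition H_nabla ::
    "'g::cvector dgl \<Rightarrow> 'h::cvector dg \<Rightarrow> ('g \<Rightarrow> 'h \<Rightarrow> 'h) \<Rightarrow> (('g, cxi) tensor \<Rightarrow> 'h \<Rightarrow> 'h) \<Rightarrow>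
      'r::cvector dga \<Rightarrow> ('g, 'r) tensor \<Rightarrow> ('r \<Rightarrow> 'r) \<Rightarrow> ('h, 'r) tensor set \<Rightarrow> ('h, 'r) tensor set"
  where "H_nabla g h m mx R \<gamma> v = coh_map (D_op h m R \<gamma>) (nabla g h mx R \<gamma> v)"

end

theory Submission
  imports Defs
begin

text \<open>Write \<open>L a\<close> for the action of \<open>a \<in> g \<otimes> R\<close> on \<open>h \<otimes> R\<close> and \<open>I a\<close> for that of \<open>\<xi>a\<close>.  The module structure
  over \<open>g \<otimes> \<complex>[\<xi>]\<close> gives, for graded commutators, \<open>[d, I a] = L a - I (da)\<close>, \<open>[L a, I b] = \<plusminus> I [a, b]\<close>
  and \<open>[I a, I b] = 0\<close>, while \<open>\<partial>/\<partial>v\<close> acts on \<open>L a\<close> and \<open>I a\<close> by differentiating \<open>a\<close>.  Hence \<open>\<nabla>\<^sub>v\<close> commutes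
  with \<open>D = d + L \<gamma>\<close> by the derivative of the Maurer--Cartan equation, and the Leibniz rule and flatness
  hold already for cochains.  Conjugating by \<open>e\<^bsup>L \<alpha>\<^esup>\<close> turns \<open>\<partial>/\<partial>v\<close> into \<open>\<partial>/\<partial>v - L \<beta>\<close> with
  \<open>\<beta> = ((e\<^bsup>ad \<alpha>\<^esup> - 1) / ad \<alpha>) (\<partial>\<alpha>/\<partial>v)\<close>, so that the connection changes by \<open>- [D, I \<beta>]\<close>, which is
  homotopic to zero.\<close>

section \<open>Linear maps, tensors and gradings\<close>

text \<open>Koszul signs shape the proof: tensors, elements of \<open>R\<close> and derivations need
  not be homogeneous, yet every sign refers to a degree. Operator identities are linear in their
  arguments, so they are verified on homogeneous pure tensors and extended by linearity. To do this
  only once, an action \<open>A\<close> that shifts degrees by \<open>p\<close> is treated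
  abstractly: \<open>p = 0\<close> gives \<open>L\<close> and, for the adjoint action, the bracket
  of \<open>g \<otimes> R\<close>; \<open>p = - 1\<close> gives \<open>I\<close>. Of the lifted
  structure, \<xi>^2 = 0 is what makes the connection flat and d\<xi> = 1 is what makes it commute
  with \<open>D\<close>. For inhomogeneous \<open>v\<close> no single sign relates
  \<open>N \<gamma> v\<close> composed with \<open>D\<close> to the opposite composite; an auxiliary
  map \<open>T\<close> takes the place of the sign. Naturality in \<open>R\<close> is also claimed.
  There the base-changed element is known only by its degree and by the Maurer-Cartan equation, and
  the cochain lemmas needed for it assume just these two facts.\<close>

lemma clinearI:
  assumes "\<And>x y. f (x + y) = f x + f y" "\<And>c x. f (c *\<^sub>C x) = c *\<^sub>C f x"
  shows "clinear f"
  unfolding Vector_Spaces.linear_iff using assms by (auto intro: cvector.vector_space_axioms)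

lemma clinear_add: "clinear f \<Longrightarrow> f (x + y) = f x + f y"
  and clinear_scale: "clinear f \<Longrightarrow> f (c *\<^sub>C x) = c *\<^sub>C f x"
  by (auto simp: Vector_Spaces.linear_iff)

lemma clinear_0: "clinear f \<Longrightarrow> f 0 = 0"
  using clinear_scale[of f 0 0] by simp

lemma clinear_neg: "clinear f \<Longrightarrow> f (- x) = - f x"
  using clinear_scale[of f "- 1" x] by simp

lemma clinear_diff: "clinear f \<Longrightarrow> f (x - y) = f x - f y"
  using clinear_add[of f x "- y"] by (simp add: clinear_neg)

lemma clinear_sum: "clinear f \<Longrightarrow> f (\<Sum>i\<in>A. F i) = (\<Sum>i\<in>A. f (F i))"
  by (induction A rule: infinite_finite_induct) (simp_all add: clinear_0 clinear_add)

lemmas clinear_simps = clinear_add clinear_scale clinear_0 clinear_neg clinear_diff clinear_sum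

lemma clinear_ident: "clinear (\<lambda>x. x)"
  and clinear_zero: "clinear (\<lambda>x. 0)"
  and clinear_plus: "clinear f \<Longrightarrow> clinear g \<Longrightarrow> clinear (\<lambda>x. f x + g x)"
  and clinear_minus: "clinear f \<Longrightarrow> clinear g \<Longrightarrow> clinear (\<lambda>x. f x - g x)"
  and clinear_uminus: "clinear f \<Longrightarrow> clinear (\<lambda>x. - f x)"
  and clinear_scaleC: "clinear f \<Longrightarrow> clinear (\<lambda>x. c *\<^sub>C f x)"
  and clinear_setsum: "(\<And>i. i \<in> A \<Longrightarrow> clinear (F i)) \<Longrightarrow> clinear (\<lambda>x. \<Sum>i\<in>A. F i x)"
  by (auto intro!: clinearI simp: clinear_simps algebra_simps scaleC_add_right scaleC_scaleC
      cvector.scale_right_diff_distrib sum.distrib cvector.scale_sum_right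
      cong: sum.cong)

named_theorems clin
declare clinear_ident [clin] clinear_zero [clin] clinear_plus [clin] clinear_minus [clin]
  clinear_uminus [clin] clinear_scaleC [clin]

lemma clinear_comp: "clinear F \<Longrightarrow> clinear f \<Longrightarrow> clinear (\<lambda>x. F (f x))"
  by (auto intro!: clinearI simp: clinear_simps)

lemma clinear_funpow: "clinear (f :: 'a::cvector \<Rightarrow> 'a) \<Longrightarrow> clinear (f ^^ n)"
proof (induction n)
  case 0
  show ?case by (simp only: funpow.simps id_def clinear_ident)
next
  case (Suc n)
  then show ?case using clinear_comp[of f "f ^^ n"] by (simp add: comp_def)
qed

lemma cbilinearI:
  assumes "\<And>x. clinear (f x)" "\<And>y. clinear (\<lambda>x. f x y)"
  shows "cbilinear f"
  using assms by (simp add: cbilinear_def)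

lemma cbilinearD:
  assumes "cbilinear f"
  shows "clinear (f x)" "clinear (\<lambda>x. f x y)"
  using assms by (simp_all add: cbilinear_def)

lemma cbilinear_comp1: "cbilinear f \<Longrightarrow> clinear F \<Longrightarrow> clinear (\<lambda>x. f (F x) y)"
  by (rule clinear_comp[of "\<lambda>x. f x y" F]) (simp_all add: cbilinearD)

lemma cbilinear_comp2: "cbilinear f \<Longrightarrow> clinear F \<Longrightarrow> clinear (\<lambda>y. f x (F y))"
  by (rule clinear_comp[of "f x" F]) (simp_all add: cbilinearD)

lemmas cbilinear_comp = cbilinear_comp1 cbilinear_comp2

text \<open>Discharges the closure condition of the span inductions: an identity between linear maps
  is then left to be checked on generators.\<close>

lemma subspace_eq: "clinear f \<Longrightarrow> clinear g \<Longrightarrow> cvector.subspace {x. f x = g x}"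
  unfolding cvector.subspace_def by (simp add: clinear_simps)

lemma subspace_vimage:
  assumes "clinear f" "cvector.subspace S"
  shows "cvector.subspace {x. f x \<in> S}"
  using assms(2) unfolding cvector.subspace_def by (simp add: clinear_simps[OF assms(1)])

lemma clinear_eq_on_span:
  assumes "clinear f" "clinear g" "x \<in> cvector.span S" "\<And>x. x \<in> S \<Longrightarrow> f x = g x"
  shows "f x = g x"
  using cvector.span_induct[OF assms(3) subspace_eq[OF assms(1,2)]] assms(4) by auto

section \<open>Bilinearity and generators of the tensor product\<close>

lemma cbilinear_tens: "cbilinear ((\<otimes>) :: 'a::cvector \<Rightarrow> 'b::cvector \<Rightarrow> ('a, 'b) tensor)"
proof (intro cbilinearI clinearI)
  fix x x' :: 'a and y y' :: 'b and c
  note D = tensor_eq_def bilinear_rels_def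
  \<comment> \<open>The difference of the two sides is literally one of the generating
    relations.\<close>
  show "x \<otimes> (y + y') = x \<otimes> y + x \<otimes> y'" "(x + x') \<otimes> y = x \<otimes> y + x' \<otimes> y"
    by (transfer, unfold D diff_diff_eq[symmetric], rule cvector.span_base, blast)+
  show "x \<otimes> (c *\<^sub>C y) = c *\<^sub>C (x \<otimes> y)" "(c *\<^sub>C x) \<otimes> y = c *\<^sub>C (x \<otimes> y)"
    by (transfer, unfold D, rule cvector.span_base, blast)+
qed

lemmas clinear_tens [clin] = cbilinear_comp[OF cbilinear_tens]
lemmas tens_simps = clinear_simps[OF cbilinearD(1)[OF cbilinear_tens]]
  clinear_simps[OF cbilinearD(2)[OF cbilinear_tens]]

lemma span_tens: "cvector.span {x \<otimes> y | x y. True} = (UNIV :: ('a::cvector, 'b::cvector) tensor set)"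
proof -
  have lin: "clinear (abs_tensor :: _ \<Rightarrow> ('a, 'b) tensor)"
    by (rule clinearI) (simp_all add: plus_tensor.abs_eq scaleC_tensor.abs_eq)
  have "t \<in> cvector.span {x \<otimes> y | x y. True}" for t :: "('a, 'b) tensor"
  proof -
    obtain p where t: "t = abs_tensor p"
      using Quotient3_abs_rep[OF Quotient3_tensor] by metis
    have "p = (\<Sum>k\<in>Poly_Mapping.keys p. Poly_Mapping.lookup p k *\<^sub>C Poly_Mapping.single k 1)"
      by (rule poly_mapping_eqI)
        (auto simp: Poly_Mapping.lookup_sum lookup_scaleC scaleC_complex_def lookup_single when_def
          if_distrib[of "(*) _"] Poly_Mapping.in_keys_iff sum.delta' cong: if_cong)
    then have "t = (\<Sum>k\<in>Poly_Mapping.keys p.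
        Poly_Mapping.lookup p k *\<^sub>C abs_tensor (Poly_Mapping.single k 1))"
      unfolding t using clinear_sum[OF lin] clinear_scale[OF lin] by (metis (no_types, lifting) sum.cong)
    also have "\<dots> = (\<Sum>k\<in>Poly_Mapping.keys p. Poly_Mapping.lookup p k *\<^sub>C (fst k \<otimes> snd k))"
      by (simp add: tens.abs_eq)
    also have "\<dots> \<in> cvector.span {x \<otimes> y | x y. True}"
      by (intro cvector.span_sum cvector.span_scale cvector.span_base) auto
    finally show ?thesis .
  qed
  then show ?thesis by auto
qed

text \<open>The lift evaluates its function on one chosen representative of \<open>t\<close>, so
  linearity in the function is read off from the finite sum.\<close>

lemma tensor_lift_fun:
  "tensor_lift (\<lambda>x y. f x y + g x y) t = tensor_lift f t + tensor_lift g t"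
  "tensor_lift (\<lambda>x y. f x y - g x y) t = tensor_lift f t - tensor_lift g t"
  "tensor_lift (\<lambda>x y. c *\<^sub>C f x y) t = c *\<^sub>C tensor_lift f t"
  by (simp_all add: tensor_lift_def free_lift_def scaleC_add_right sum.distrib
      cvector.scale_right_diff_distrib sum_subtractf cvector.scale_sum_right scaleC_scaleC mult.commute)

lemma clinear_tensor_lift_fun:
  assumes "\<And>x y. clinear (\<lambda>a. f a x y)"
  shows "clinear (\<lambda>a. tensor_lift (f a) t)"
proof (rule clinearI)
  fix a b c
  have "f (a + b) = (\<lambda>x y. f a x y + f b x y)" "f (c *\<^sub>C a) = (\<lambda>x y. c *\<^sub>C f a x y)"
    by (simp_all add: fun_eq_iff clinear_simps[OF assms])
  then show "tensor_lift (f (a + b)) t = tensor_lift (f a) t + tensor_lift (f b) t"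
    "tensor_lift (f (c *\<^sub>C a)) t = c *\<^sub>C tensor_lift (f a) t"
    by (simp_all add: tensor_lift_fun)
qed

section \<open>Koszul signs and homogeneous components\<close>

lemma ksign_simps [simp]: "ksign 0 = 1" "ksign 1 = - 1" "ksign (- n) = ksign n"
  "ksign n * ksign n = 1" "ksign n * (ksign n * z) = z" "ksign (n * n) = ksign n"
  by (auto simp: ksign_def)

lemma ksign_add: "ksign (m + n) = ksign m * ksign n"
  by (auto simp: ksign_def)

lemma ksign_diff: "ksign (m - n) = ksign m * ksign n"
  by (auto simp: ksign_def)

text \<open>Any finite set containing the support may index the sum, so decompositions with
  different supports become comparable.\<close>

lemma is_decomp_iff:
  assumes "finite S" "\<And>i. i \<notin> S \<Longrightarrow> c i = 0"
  shows "is_decomp G x c \<longleftrightarrow> (\<forall>i. c i \<in> G i) \<and> x = (\<Sum>i\<in>S. c i)"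
proof -
  have fin: "{i. c i \<noteq> 0} \<subseteq> S" using assms(2) by auto
  then have "(\<Sum>i | c i \<noteq> 0. c i) = (\<Sum>i\<in>S. c i)"
    by (intro sum.mono_neutral_left assms) auto
  then show ?thesis
    unfolding is_decomp_def using finite_subset[OF fin assms(1)] by simp
qed

lemma hpart_eqI:
  assumes "grading G" "is_decomp G x c"
  shows "hpart G x = c"
  using assms the1_equality[of "is_decomp G x" c] unfolding hpart_def grading_def by blast

lemma is_decomp_hpart:
  assumes "grading G"
  shows "is_decomp G x (hpart G x)"
  using assms theI'[of "is_decomp G x"] unfolding hpart_def grading_def by blast

lemma grading_subspace: "grading G \<Longrightarrow> cvector.subspace (G i)"
  by (simp add: grading_def)

lemmas grading_closed = cvector.subspace_0[OF grading_subspace]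
  cvector.subspace_add[OF grading_subspace] cvector.subspace_scale[OF grading_subspace]
  cvector.subspace_diff[OF grading_subspace] cvector.subspace_neg[OF grading_subspace]

lemma hpart_hom:
  assumes G: "grading G" and x: "x \<in> G i"
  shows "hpart G x = (\<lambda>j. if j = i then x else 0)"
proof (rule hpart_eqI[OF G])
  have "is_decomp G x (\<lambda>j. if j = i then x else 0) \<longleftrightarrow>
      (\<forall>j. (if j = i then x else 0) \<in> G j) \<and> x = (\<Sum>j\<in>{i}. if j = i then x else 0)"
    by (rule is_decomp_iff) simp_all
  then show "is_decomp G x (\<lambda>j. if j = i then x else 0)"
    using x grading_closed(1)[OF G] by simp
qed

lemma hpart_mem: "grading G \<Longrightarrow> hpart G x i \<in> G i"
  and finite_hpart: "grading G \<Longrightarrow> finite {i. hpart G x i \<noteq> 0}"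
  and sum_hpart: "grading G \<Longrightarrow> (\<Sum>i | hpart G x i \<noteq> 0. hpart G x i) = x"
  using is_decomp_hpart[of G x] unfolding is_decomp_def by metis+

text \<open>Sums and multiples of decompositions, taken componentwise, are again decompositions;
  uniqueness identifies them with the chosen ones.\<close>

lemma clinear_hpart:
  assumes G: "grading G"
  shows "clinear (\<lambda>x. hpart G x i)"
proof (rule clinearI)
  fix x y c
  let ?S = "{i. hpart G x i \<noteq> 0} \<union> {i. hpart G y i \<noteq> 0}"
  have S: "finite ?S" by (simp add: finite_hpart[OF G])
  have x: "(\<Sum>i\<in>?S. hpart G x i) = x"
    by (subst (2) sum_hpart[OF G, of x, symmetric], rule sum.mono_neutral_right)
      (auto simp: finite_hpart[OF G])
  have y: "(\<Sum>i\<in>?S. hpart G y i) = y"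
    by (subst (2) sum_hpart[OF G, of y, symmetric], rule sum.mono_neutral_right)
      (auto simp: finite_hpart[OF G])
  have "is_decomp G (x + y) (\<lambda>i. hpart G x i + hpart G y i)"
    by (subst is_decomp_iff[OF S])
      (auto simp: grading_closed[OF G] hpart_mem[OF G] sum.distrib x y)
  then have "hpart G (x + y) = (\<lambda>i. hpart G x i + hpart G y i)"
    by (rule hpart_eqI[OF G])
  moreover have "is_decomp G (c *\<^sub>C x) (\<lambda>i. c *\<^sub>C hpart G x i)"
    by (subst is_decomp_iff[OF S])
      (auto simp: grading_closed[OF G] hpart_mem[OF G] cvector.scale_sum_right[symmetric] x)
  then have "hpart G (c *\<^sub>C x) = (\<lambda>i. c *\<^sub>C hpart G x i)"
    by (rule hpart_eqI[OF G])
  ultimately show "hpart G (x + y) i = hpart G x i + hpart G y i"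
    "hpart G (c *\<^sub>C x) i = c *\<^sub>C hpart G x i" by simp_all
qed

lemma span_grading:
  assumes G: "grading G"
  shows "cvector.span (\<Union>i. G i) = UNIV"
proof -
  have "x \<in> cvector.span (\<Union>i. G i)" for x
    by (subst sum_hpart[OF G, symmetric], intro cvector.span_sum cvector.span_base)
      (use hpart_mem[OF G] in auto)
  then show ?thesis by auto
qed

lemma hom_eqI:
  assumes "grading G" "clinear f" "clinear g" "\<And>i x. x \<in> G i \<Longrightarrow> f x = g x"
  shows "f x = g x"
  by (rule clinear_eq_on_span[of f g x "\<Union>i. G i"]) (use assms in \<open>auto simp: span_grading\<close>)

lemma hom_induct:
  assumes "grading G" "cvector.subspace {x. P x}" "\<And>i x. x \<in> G i \<Longrightarrow> P x"
  shows "P x"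
  using cvector.span_induct[of x "\<Union>i. G i" P] assms by (auto simp: span_grading)

lemma clinear_hsum:
  assumes G: "grading G" and f: "\<And>j. clinear (f j)"
  shows "clinear (\<lambda>x. hsum G x f)"
proof (rule clinearI)
  have sup: "hsum G x f = (\<Sum>j\<in>S. f j (hpart G x j))"
    if "finite S" "\<And>j. j \<notin> S \<Longrightarrow> hpart G x j = 0" for x S
    unfolding hsum_def by (rule sum.mono_neutral_left) (use that f clinear_0 in auto)
  fix x y c
  let ?S = "{i. hpart G x i \<noteq> 0} \<union> {i. hpart G y i \<noteq> 0}"
  have S: "finite ?S" by (simp add: finite_hpart[OF G])
  show "hsum G (x + y) f = hsum G x f + hsum G y f"
    by (subst (1 2 3) sup[OF S])
      (auto simp: clinear_simps[OF f] clinear_simps[OF clinear_hpart[OF G]] sum.distrib)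
  show "hsum G (c *\<^sub>C x) f = c *\<^sub>C hsum G x f"
    by (subst (1 2) sup[OF S])
      (auto simp: clinear_simps[OF f] clinear_simps[OF clinear_hpart[OF G]] cvector.scale_sum_right)
qed

lemma clinear_hsum_fun:
  assumes "\<And>j x. clinear (\<lambda>a. f a j x)"
  shows "clinear (\<lambda>a. hsum G x (f a))"
  unfolding hsum_def by (rule clinear_setsum) (rule assms)

text \<open>Zero is homogeneous of every degree but gives an empty sum, whence the condition on
  \<open>f i 0\<close>.\<close>

lemma hsum_hom: "grading G \<Longrightarrow> x \<in> G i \<Longrightarrow> f i 0 = 0 \<Longrightarrow> hsum G x f = f i x"
  by (cases "x = 0") (auto simp: hsum_def hpart_hom cong: if_cong)

lemma clinear_par: "grading G \<Longrightarrow> clinear (par G)"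
  unfolding par_def[abs_def] by (rule clinear_hsum) (auto intro: clin)

lemma par_hom: "grading G \<Longrightarrow> x \<in> G i \<Longrightarrow> par G x = ksign i *\<^sub>C x"
  unfolding par_def by (subst hsum_hom) auto

lemma par_par: "grading G \<Longrightarrow> par G (par G x) = x"
  by (rule hom_eqI[of G "\<lambda>x. par G (par G x)" "\<lambda>x. x"])
    (simp_all add: clinear_comp[OF clinear_par clinear_par] clinear_ident par_hom
      clinear_scale[OF clinear_par] scaleC_scaleC scaleC_one)

lemma clinear_kos: "grading G \<Longrightarrow> clinear (kos G j)"
  by (cases "even j") (simp_all add: kos_def[abs_def] clinear_par clin)

lemma kos_hom: "grading G \<Longrightarrow> x \<in> G i \<Longrightarrow> kos G j x = ksign (i * j) *\<^sub>C x"
  by (simp add: kos_def par_hom scaleC_one ksign_def)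

lemma clinear_kos_op: "grading G \<Longrightarrow> clinear v \<Longrightarrow> clinear (kos_op G j v)"
  by (simp add: kos_op_def clinear_comp[of "par G" "\<lambda>x. v (par G x)"] clinear_comp[of v "par G"] clinear_par)

text \<open>For odd \<open>j\<close>, conjugation by parity contributes the signs of the degrees i
  and i + k, whose product depends on \<open>k\<close> alone.\<close>

lemma kos_op_hom:
  assumes G: "grading G" and v: "clinear v" "\<And>i x. x \<in> G i \<Longrightarrow> v x \<in> G (i + k)"
  shows "kos_op G j v = (\<lambda>x. ksign (k * j) *\<^sub>C v x)"
proof -
  have hom: "kos_op G j v x = ksign (k * j) *\<^sub>C v x" if x: "x \<in> G i" for x i
    by (simp add: kos_op_def par_hom[OF G x] clinear_simps[OF clinear_par[OF G]] clinear_simps[OF v(1)]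
        par_hom[OF G v(2)[OF x]] scaleC_scaleC scaleC_one ksign_add)
      (auto simp: ksign_def scaleC_one)
  have "kos_op G j v x = ksign (k * j) *\<^sub>C v x" for x
    by (rule hom_eqI[OF G clinear_kos_op[OF G v(1)] clinear_scaleC[OF v(1)]]) (rule hom)
  then show ?thesis by auto
qed

text \<open>Each factor is split into homogeneous components separately: the right one with a
  homogeneous left one held fixed, then the left one.\<close>

lemma tensor_induct [case_names subspace tens]:
  assumes "grading G" "grading K" "cvector.subspace {t. P t}"
    and "\<And>i j x y. x \<in> G i \<Longrightarrow> y \<in> K j \<Longrightarrow> P (x \<otimes> y)"
  shows "P t"
proof -
  have G: "cvector.subspace {x. P (x \<otimes> y)}" for y
    using subspace_vimage[OF clinear_tens(1)[OF clinear_ident] assms(3), of y] by simp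
  have K: "cvector.subspace {y. P (x \<otimes> y)}" for x
    using subspace_vimage[OF clinear_tens(2)[OF clinear_ident] assms(3), of x] by simp
  have 1: "P (x \<otimes> y)" if "x \<in> G i" for x i y
    using hom_induct[OF assms(2) K] assms(4)[OF that] by blast
  have 2: "P (x \<otimes> y)" for x y
    using hom_induct[OF assms(1) G] 1 by blast
  have "t \<in> cvector.span {x \<otimes> y | x y. True}" unfolding span_tens by (rule UNIV_I)
  then show ?thesis
    using cvector.span_induct[OF _ assms(3)] 2 by blast
qed

lemma tensor_gr_induct [consumes 1, case_names subspace tens]:
  assumes "t \<in> tensor_gr G K n" "cvector.subspace {x. P x}"
    and "\<And>i j x y. x \<in> G i \<Longrightarrow> y \<in> K j \<Longrightarrow> i + j = n \<Longrightarrow> P (x \<otimes> y)"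
  shows "P t"
  using cvector.span_induct[OF assms(1)[unfolded tensor_gr_def] assms(2)] assms(3) by auto

lemma tens_mem: "x \<in> G i \<Longrightarrow> y \<in> K j \<Longrightarrow> i + j = n \<Longrightarrow> x \<otimes> y \<in> tensor_gr G K n"
  unfolding tensor_gr_def by (rule cvector.span_base) auto

lemma subspace_tensor_gr: "cvector.subspace (tensor_gr G K n)"
  unfolding tensor_gr_def by (rule cvector.subspace_span)

lemmas tensor_gr_closed = cvector.subspace_0[OF subspace_tensor_gr]
  cvector.subspace_add[OF subspace_tensor_gr] cvector.subspace_scale[OF subspace_tensor_gr]
  cvector.subspace_diff[OF subspace_tensor_gr] cvector.subspace_neg[OF subspace_tensor_gr]
  cvector.subspace_sum[OF subspace_tensor_gr]

section \<open>Operators on tensor products with a graded algebra\<close>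

text \<open>T \<otimes> id carries no Koszul sign, because \<open>T\<close> meets the left factor
  first. Signs appear only when \<open>T\<close> is moved past scalars or derivations of
  \<open>R\<close>.\<close>

definition tmap :: "('a::cvector \<Rightarrow> 'b::cvector) \<Rightarrow> ('a, 'r::cvector) tensor \<Rightarrow> ('b, 'r) tensor"
  where "tmap T = tensor_lift (\<lambda>x s. T x \<otimes> s)"

lemma cbilinear_tmap: "clinear T \<Longrightarrow> cbilinear (\<lambda>x s. T x \<otimes> s)"
  by (intro cbilinearI clinear_tens clinear_ident)

lemma tmap_tens: "clinear T \<Longrightarrow> tmap T (x \<otimes> s) = T x \<otimes> s"
  unfolding tmap_def by (simp add: tensor_lift_tens cbilinear_tmap)

lemma clinear_tmap: "clinear T \<Longrightarrow> clinear (tmap T)"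
  unfolding tmap_def by (simp add: clinear_tensor_lift cbilinear_tmap)

lemma clinear_tmap_comp: "clinear T \<Longrightarrow> clinear f \<Longrightarrow> clinear (\<lambda>x. tmap T (f x))"
  by (rule clinear_comp[OF clinear_tmap])

lemma clinear_tmap_fun: "(\<And>x. clinear (\<lambda>a. T a x)) \<Longrightarrow> clinear (\<lambda>a. tmap (T a) y)"
  unfolding tmap_def by (intro clinear_tensor_lift_fun clinear_tens)

lemma tmap_fun:
  "tmap (\<lambda>x. S x + T x) y = tmap S y + tmap T y"
  "tmap (\<lambda>x. S x - T x) y = tmap S y - tmap T y"
  "tmap (\<lambda>x. c *\<^sub>C T x) y = c *\<^sub>C tmap T y"
  by (simp_all only: tmap_def tens_simps tensor_lift_fun)

text \<open>Leaves out the differential, so that both the Artin algebra and \<complex>[\<xi>] are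
  instances and share the sign computations.\<close>

locale graded_alg =
  fixes R :: "'r::cvector dga"
  assumes grR: "grading (Gr R)" and cbilinear_Mul: "cbilinear (Mul R)"
    and Mul_mem: "\<And>i j x y. x \<in> Gr R i \<Longrightarrow> y \<in> Gr R j \<Longrightarrow> Mul R x y \<in> Gr R (i + j)"
    and Mul_assoc: "\<And>x y z. Mul R (Mul R x y) z = Mul R x (Mul R y z)"
    and One_mem: "One R \<in> Gr R 0" and One_left: "\<And>x. Mul R (One R) x = x"
    and Mul_comm: "\<And>i j x y. x \<in> Gr R i \<Longrightarrow> y \<in> Gr R j \<Longrightarrow>
      Mul R x y = ksign (i * j) *\<^sub>C Mul R y x"

lemma graded_alg_dg_comm: "dg_comm_algebra R \<Longrightarrow> graded_alg R"
  unfolding dg_comm_algebra_def dg_space_def by unfold_locales blast+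

locale graded_pair = graded_alg R for R :: "'r::cvector dga" +
  fixes h :: "'h::cvector dg"
  assumes grh: "grading (Gr h)"
begin

lemmas clinear_Mul [clin] = cbilinear_comp[OF cbilinear_Mul]
lemmas Mul_simps = clinear_simps[OF cbilinearD(1)[OF cbilinear_Mul]]
  clinear_simps[OF cbilinearD(2)[OF cbilinear_Mul]]

lemma clinear_kos_comp [clin]: "clinear f \<Longrightarrow> clinear (\<lambda>x. kos (Gr R) j (f x))"
  by (rule clinear_comp[OF clinear_kos[OF grR]])

lemma cbilinear_kos:
  assumes "clinear T"
  shows "cbilinear (\<lambda>x s. hsum (Gr h) x (\<lambda>j x\<^sub>j. T x\<^sub>j \<otimes> Mul R (kos (Gr R) j r) s))"
  by (intro cbilinearI clinear_hsum clinear_hsum_fun clin grh assms)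

section \<open>Scalar multiplication by the graded algebra\<close>

lemma R_scale_tens:
  "x \<in> Gr h j \<Longrightarrow> R_scale h R r (x \<otimes> s) = x \<otimes> Mul R (kos (Gr R) j r) s"
  unfolding R_scale_def
  by (subst tensor_lift_tens[OF cbilinear_kos[OF clinear_ident]])
    (simp add: hsum_hom[OF grh] tens_simps)

lemma clinear_R_scale: "clinear (R_scale h R r)"
  unfolding R_scale_def by (rule clinear_tensor_lift[OF cbilinear_kos[OF clinear_ident]])

lemma clinear_R_scale_fun: "clinear (\<lambda>r. R_scale h R r y)"
  unfolding R_scale_def by (intro clinear_tensor_lift_fun clinear_hsum_fun clin)

lemma clinear_R_scale_comp [clin]: "clinear f \<Longrightarrow> clinear (\<lambda>x. R_scale h R r (f x))"
  by (rule clinear_comp[OF clinear_R_scale])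

lemma R_scale_hom:
  "x \<in> Gr h j \<Longrightarrow> r \<in> Gr R i \<Longrightarrow> R_scale h R r (x \<otimes> s) = ksign (i * j) *\<^sub>C (x \<otimes> Mul R r s)"
  by (simp add: R_scale_tens kos_hom[OF grR] Mul_simps tens_simps)

lemma R_scale_One: "R_scale h R (One R) y = y"
  by (induct y rule: tensor_induct[OF grh grR], rule subspace_eq, (intro clin)+)
    (simp add: R_scale_hom[OF _ One_mem] One_left scaleC_one)

lemma R_scale_R_scale:
  assumes "r \<in> Gr R i" "s \<in> Gr R j"
  shows "R_scale h R r (R_scale h R s y) = R_scale h R (Mul R r s) y"
  by (induct y rule: tensor_induct[OF grh grR], rule subspace_eq, (intro clin)+)
    (simp add: R_scale_hom[OF _ assms(1)] R_scale_hom[OF _ assms(2)] R_scale_hom[OF _ Mul_mem[OF assms]]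
      clinear_simps[OF clinear_R_scale] scaleC_scaleC Mul_assoc ksign_add ring_distribs mult.commute)

lemma R_scale_comm:
  assumes "r \<in> Gr R i" "s \<in> Gr R j"
  shows "R_scale h R r (R_scale h R s y) = ksign (i * j) *\<^sub>C R_scale h R s (R_scale h R r y)"
  unfolding R_scale_R_scale[OF assms] R_scale_R_scale[OF assms(2,1)] Mul_comm[OF assms]
  by (simp add: clinear_simps[OF clinear_R_scale_fun])

text \<open>Passing a vector of degree j costs the sign of i j before \<open>T\<close> acts and that
  of i (j + p) afterwards; the discrepancy i p does not depend on the vector.\<close>

lemma R_scale_tmap:
  assumes "r \<in> Gr R i" and T: "clinear T" "\<And>j x. x \<in> Gr h j \<Longrightarrow> T x \<in> Gr h (j + p)"
  shows "R_scale h R r (tmap T y) = ksign (i * p) *\<^sub>C tmap T (R_scale h R r y)"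
  by (induct y rule: tensor_induct[OF grh grR], rule subspace_eq, (intro clin clinear_tmap_comp T)+)
    (simp add: R_scale_hom[OF _ assms(1)] R_scale_hom[OF T(2) assms(1)] tmap_tens T(1)
      clinear_simps[OF clinear_tmap[OF T(1)]] scaleC_scaleC ksign_add ring_distribs mult.commute)

section \<open>Derivations acting through the second factor\<close>

lemma cbilinear_kos_op:
  assumes "clinear v"
  shows "cbilinear (\<lambda>x r. hsum (Gr h) x (\<lambda>j x\<^sub>j. x\<^sub>j \<otimes> kos_op (Gr R) j v r))"
  by (intro cbilinearI clinear_hsum clinear_hsum_fun clin clinear_kos_op grh grR assms)

lemma dd_tens: "clinear v \<Longrightarrow> x \<in> Gr h j \<Longrightarrow> dd h R v (x \<otimes> r) = x \<otimes> kos_op (Gr R) j v r"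
  unfolding dd_def by (subst tensor_lift_tens[OF cbilinear_kos_op])
    (simp_all add: hsum_hom[OF grh] tens_simps)

lemma clinear_dd: "clinear v \<Longrightarrow> clinear (dd h R v)"
  unfolding dd_def by (rule clinear_tensor_lift[OF cbilinear_kos_op])

lemma clinear_dd_comp: "clinear v \<Longrightarrow> clinear f \<Longrightarrow> clinear (\<lambda>x. dd h R v (f x))"
  by (rule clinear_comp[OF clinear_dd])

lemma dd_hom:
  assumes "clinear v" "\<And>i x. x \<in> Gr R i \<Longrightarrow> v x \<in> Gr R (i + k)" "x \<in> Gr h j"
  shows "dd h R v (x \<otimes> r) = ksign (k * j) *\<^sub>C (x \<otimes> v r)"
  by (simp add: dd_tens[OF assms(1,3)] kos_op_hom[OF grR assms(1,2)] tens_simps)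

lemma dd_fun:
  assumes v: "clinear v" and w: "clinear w"
  shows "dd h R (\<lambda>r. v r + w r) y = dd h R v y + dd h R w y"
    "dd h R (\<lambda>r. c *\<^sub>C v r) y = c *\<^sub>C dd h R v y"
proof -
  have 1: "kos_op (Gr R) j (\<lambda>r. v r + w r) = (\<lambda>r. kos_op (Gr R) j v r + kos_op (Gr R) j w r)"
    "kos_op (Gr R) j (\<lambda>r. c *\<^sub>C v r) = (\<lambda>r. c *\<^sub>C kos_op (Gr R) j v r)" for j
    by (auto simp: kos_op_def clinear_simps[OF clinear_par[OF grR]])
  show "dd h R (\<lambda>r. v r + w r) y = dd h R v y + dd h R w y"
    by (induct y rule: tensor_induct[OF grh grR], rule subspace_eq, (intro clin clinear_dd clinear_dd_comp v w)+)
      (simp add: dd_tens v w clinear_plus tens_simps 1)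
  show "dd h R (\<lambda>r. c *\<^sub>C v r) y = c *\<^sub>C dd h R v y"
    by (induct y rule: tensor_induct[OF grh grR], rule subspace_eq, (intro clin clinear_dd clinear_dd_comp v w)+)
      (simp add: dd_tens v w clinear_scaleC tens_simps 1)
qed

text \<open>Conjugation by the parity involution is multiplicative, since the two inner copies of
  \<open>par\<close> cancel.\<close>

lemma dd_comp:
  assumes v: "clinear v" and w: "clinear w"
  shows "dd h R (\<lambda>r. v (w r)) y = dd h R v (dd h R w y)"
proof -
  have 1: "kos_op (Gr R) j (\<lambda>r. v (w r)) r = kos_op (Gr R) j v (kos_op (Gr R) j w r)" for j r
    by (auto simp: kos_op_def par_par[OF grR])
  show ?thesis
    by (induct y rule: tensor_induct[OF grh grR], rule subspace_eq,
        (intro clinear_dd clinear_dd_comp clinear_comp[OF v w] v w clin)+) (simp add: 1 dd_tens v w clinear_comp[OF v w])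
qed

lemma dd_tmap:
  assumes v: "clinear v" "\<And>i x. x \<in> Gr R i \<Longrightarrow> v x \<in> Gr R (i + k)"
    and T: "clinear T" "\<And>j x. x \<in> Gr h j \<Longrightarrow> T x \<in> Gr h (j + p)"
  shows "dd h R v (tmap T y) = ksign (k * p) *\<^sub>C tmap T (dd h R v y)"
  by (induct y rule: tensor_induct[OF grh grR], rule subspace_eq, (intro clin clinear_tmap_comp clinear_dd_comp T v)+)
    (simp add: dd_hom[OF v] dd_hom[OF v T(2)] tmap_tens T(1)
      clinear_simps[OF clinear_tmap[OF T(1)]] scaleC_scaleC ksign_add ring_distribs mult.commute)

lemma Der_homD:
  assumes "v \<in> Der_hom R k"
  shows "clinear v" "\<And>i x. x \<in> Gr R i \<Longrightarrow> v x \<in> Gr R (i + k)"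
    "\<And>i r s. r \<in> Gr R i \<Longrightarrow> v (Mul R r s) = Mul R (v r) s + ksign (k * i) *\<^sub>C Mul R r (v s)"
  using assms by (auto simp: Der_hom_def)

lemma dd_R_scale:
  assumes v: "v \<in> Der_hom R k" and r: "r \<in> Gr R i"
  shows "dd h R v (R_scale h R r y)
    = R_scale h R (v r) y + ksign (k * i) *\<^sub>C R_scale h R r (dd h R v y)"
  by (induct y rule: tensor_induct[OF grh grR], rule subspace_eq, (intro clin clinear_dd_comp Der_homD(1)[OF v])+)
    (simp add: dd_hom[OF Der_homD(1,2)[OF v]] R_scale_hom[OF _ r] R_scale_hom[OF _ Der_homD(2)[OF v r]]
      clinear_simps[OF clinear_dd[OF Der_homD(1)[OF v]]] clinear_simps[OF clinear_R_scale]
      Der_homD(3)[OF v r] tens_simps scaleC_add_right scaleC_scaleC ksign_add ring_distribs mult_ac)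

lemma dd_Mul:
  assumes v: "v \<in> Der_hom R k" and r: "r \<in> Gr R i"
  shows "dd h R (\<lambda>s. Mul R r (v s)) y = R_scale h R r (dd h R v y)"
proof -
  have c: "clinear (\<lambda>s. Mul R r (v s))" by (intro clin Der_homD(1)[OF v])
  have d: "Mul R r (v s) \<in> Gr R (j + (i + k))" if "s \<in> Gr R j" for s j
    using Mul_mem[OF r Der_homD(2)[OF v that]] by (simp add: ac_simps)
  show ?thesis
    by (induct y rule: tensor_induct[OF grh grR], rule subspace_eq, (intro clin clinear_dd clinear_dd_comp c Der_homD(1)[OF v])+)
      (simp add: dd_hom[OF Der_homD(1,2)[OF v]] R_scale_hom[OF _ r] dd_hom[OF c d]
        clinear_simps[OF clinear_R_scale] tens_simps scaleC_scaleC ksign_add ring_distribs mult_ac)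
qed

section \<open>Extended actions and their commutation rules\<close>

lemma ext_act_lift:
  assumes act: "cbilinear act"
  shows "ext_act h R act t y = tensor_lift (\<lambda>a r. tmap (act a) (R_scale h R r y)) t"
proof -
  have "tensor_lift (\<lambda>x s. hsum (Gr h) x (\<lambda>j x\<^sub>j. act a x\<^sub>j \<otimes> Mul R (kos (Gr R) j r) s)) y
      = tmap (act a) (R_scale h R r y)" for a r
  proof -
    note b = cbilinear_kos[OF cbilinearD(1)[OF act, of a]]
    have tens: "tensor_lift (\<lambda>x s. hsum (Gr h) x (\<lambda>j x\<^sub>j. act a x\<^sub>j \<otimes> Mul R (kos (Gr R) j r) s)) (x \<otimes> s)
      = tmap (act a) (R_scale h R r (x \<otimes> s))" if "x \<in> Gr h j" for x s j
      by (simp add: tensor_lift_tens[OF b] R_scale_tens[OF that] tmap_tens[OF cbilinearD(1)[OF act]]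
          hsum_hom[OF grh that] clinear_simps[OF cbilinearD(1)[OF act]] tens_simps)
    show ?thesis
      by (induct y rule: tensor_induct[OF grh grR], rule subspace_eq,
          (intro clinear_tmap_comp clin cbilinearD(1)[OF act] clinear_tensor_lift[OF b])+) (rule tens)
  qed
  then show ?thesis by (simp add: ext_act_def)
qed

lemma cbilinear_ext_act_aux:
  "cbilinear act \<Longrightarrow> cbilinear (\<lambda>a r. tmap (act a) (R_scale h R r y))"
  by (intro cbilinearI clinear_tmap_fun clinear_tmap_comp clinear_R_scale_fun) (auto simp: cbilinearD)

text \<open>Splits the action of a \<otimes> r into scaling by \<open>r\<close> followed by
  \<open>act a\<close>. The commutation rules below are assembled from this and from the rules for
  \<open>tmap\<close>, \<open>R_scale\<close> and \<open>dd\<close>.\<close>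

lemma ext_act_tens:
  "cbilinear act \<Longrightarrow> ext_act h R act (a \<otimes> r) y = tmap (act a) (R_scale h R r y)"
  by (simp add: ext_act_lift tensor_lift_tens[OF cbilinear_ext_act_aux])

lemma cbilinear_ext_act: "cbilinear act \<Longrightarrow> cbilinear (ext_act h R act)"
proof (rule cbilinearI)
  fix y assume act: "cbilinear act"
  show "clinear (\<lambda>t. ext_act h R act t y)"
    by (simp add: ext_act_lift[OF act] clinear_tensor_lift[OF cbilinear_ext_act_aux[OF act]])
next
  fix t assume act: "cbilinear act"
  show "clinear (ext_act h R act t)"
    unfolding ext_act_lift[OF act, abs_def]
    by (intro clinear_tensor_lift_fun clinear_tmap_comp clin cbilinearD(1)[OF act])
qed

lemma clinear_ext_act1:
    "cbilinear act \<Longrightarrow> clinear f \<Longrightarrow> clinear (\<lambda>x. ext_act h R act (f x) y)"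
  and clinear_ext_act2:
    "cbilinear act \<Longrightarrow> clinear F \<Longrightarrow> clinear (\<lambda>x. ext_act h R act t (F x))"
  by (rule cbilinear_comp1[OF cbilinear_ext_act], assumption+)
    (rule cbilinear_comp2[OF cbilinear_ext_act], assumption+)

lemma ext_act_fun_diff:
  fixes A B :: "'a::cvector \<Rightarrow> 'h \<Rightarrow> 'h" and G :: "int \<Rightarrow> 'a set"
  assumes A: "cbilinear A" and B: "cbilinear B" and g: "grading G"
  shows "ext_act h R (\<lambda>a x. A a x - B a x) t y = ext_act h R A t y - ext_act h R B t y"
proof -
  have AB: "cbilinear (\<lambda>a x. A a x - B a x)"
    by (intro cbilinearI clin cbilinearD[OF A] cbilinearD[OF B])
  show ?thesis
    by (induct t rule: tensor_induct[OF g grR], rule subspace_eq, (intro clin clinear_ext_act1 AB A B)+)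
      (simp add: ext_act_tens A B AB tmap_fun)
qed

lemma ext_act_fun_tmap:
  fixes A :: "'a::cvector \<Rightarrow> 'h \<Rightarrow> 'h" and D :: "'b::cvector \<Rightarrow> 'a" and G :: "int \<Rightarrow> 'b set"
  assumes A: "cbilinear A" and D: "clinear D" and g: "grading G"
  shows "ext_act h R (\<lambda>a. A (D a)) t y = ext_act h R A (tmap D t) y"
proof -
  have AD: "cbilinear (\<lambda>a. A (D a))"
    by (rule cbilinearI[OF cbilinearD(1)[OF A] cbilinear_comp1[OF A D]])
  show ?thesis
    by (induct t rule: tensor_induct[OF g grR], rule subspace_eq, (intro clin clinear_ext_act1 clinear_tmap_comp AD A D)+)
      (simp add: ext_act_tens A AD tmap_tens D)
qed

lemma tmap_tmap:
  fixes y :: "('h, 'r) tensor"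
  assumes S: "clinear S" and T: "clinear T"
  shows "tmap S (tmap T y) = tmap (\<lambda>x. S (T x)) y"
  by (induct y rule: tensor_induct[OF grh grR], rule subspace_eq, (intro clinear_tmap_comp clinear_tmap clinear_comp[OF S T] S T clin)+)
    (simp add: tmap_tens S T clinear_comp[OF S T])

text \<open>\<open>B a\<close> is the graded commutator of \<open>T\<close> with \<open>A a\<close>.
  Besides the sign of i + p in \<open>rel\<close>, moving \<open>T\<close> past the scalar of degree
  n - i completes the exponent to n + p.\<close>

lemma ext_act_dif:
  assumes T: "clinear T" "\<And>j x. x \<in> Gr h j \<Longrightarrow> T x \<in> Gr h (j + 1)"
    and A: "cbilinear A" and B: "cbilinear B"
    and rel: "\<And>i a x. a \<in> G i \<Longrightarrow> T (A a x) = B a x + ksign (i + p) *\<^sub>C A a (T x)"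
    and s: "s \<in> tensor_gr G (Gr R) n"
  shows "tmap T (ext_act h R A s y) = ext_act h R B s y + ksign (n + p) *\<^sub>C ext_act h R A s (tmap T y)"
using s
proof (induct s rule: tensor_gr_induct)
  fix i j a r assume a: "a \<in> G i" and r: "r \<in> Gr R j" and n: "i + j = n"
  let ?y = "R_scale h R r y"
  have 1: "tmap T (tmap (A a) ?y) = tmap (B a) ?y + ksign (i + p) *\<^sub>C tmap (A a) (tmap T ?y)"
    by (simp add: tmap_tmap T cbilinearD[OF A] rel[OF a] tmap_fun)
  show "tmap T (ext_act h R A (a \<otimes> r) y)
      = ext_act h R B (a \<otimes> r) y + ksign (n + p) *\<^sub>C ext_act h R A (a \<otimes> r) (tmap T y)"
    by (simp add: ext_act_tens A B 1 R_scale_tmap[OF r T] clinear_simps[OF clinear_tmap]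
        cbilinearD[OF A] scaleC_scaleC n[symmetric] ksign_add mult_ac)
qed (rule subspace_eq, (intro clin clinear_tmap_comp clinear_ext_act1 T A B)+)

text \<open>\<open>A\<close> behaves like a symbol of degree \<open>p\<close> standing in front of
  \<open>s\<close>: the derivation passes it to reach \<open>s\<close>, and passes both to reach
  \<open>y\<close>.\<close>

lemma ext_act_dd:
  fixes g :: "'a::cvector dg"
  assumes v: "v \<in> Der_hom R k"
    and A: "cbilinear A" "\<And>i j a x. a \<in> Gr g i \<Longrightarrow> x \<in> Gr h j \<Longrightarrow> A a x \<in> Gr h (i + j + p)"
    and g: "grading (Gr g)" and s: "s \<in> tensor_gr (Gr g) (Gr R) n"
  shows "dd h R v (ext_act h R A s y)
    = ksign (k * p) *\<^sub>C ext_act h R A (dd g R v s) y + ksign (k * (n + p)) *\<^sub>C ext_act h R A s (dd h R v y)"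
proof -
  interpret G: graded_pair R g by unfold_locales (rule g)
  note v' = Der_homD[OF v]
  show ?thesis
  using s
  proof (induct s rule: tensor_gr_induct)
    fix i j a r assume a: "a \<in> Gr g i" and r: "r \<in> Gr R j" and n: "i + j = n"
    have Aa: "A a x \<in> Gr h (l + (i + p))" if "x \<in> Gr h l" for x l
      using A(2)[OF a that] by (simp add: ac_simps)
    show "dd h R v (ext_act h R A (a \<otimes> r) y)
      = ksign (k * p) *\<^sub>C ext_act h R A (dd g R v (a \<otimes> r)) y
        + ksign (k * (n + p)) *\<^sub>C ext_act h R A (a \<otimes> r) (dd h R v y)"
      by (simp add: ext_act_tens A(1) G.dd_hom[OF v'(1,2) a] dd_tmap[OF v'(1,2) cbilinearD(1)[OF A(1)] Aa]
          dd_R_scale[OF v r] clinear_simps[OF clinear_tmap[OF cbilinearD(1)[OF A(1)]]]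
          clinear_simps[OF cbilinearD(2)[OF cbilinear_ext_act[OF A(1)]]]
          scaleC_scaleC scaleC_add_right n[symmetric] ksign_add ring_distribs mult_ac)
  qed (rule subspace_eq, (intro clin clinear_dd_comp G.clinear_dd_comp clinear_ext_act1 v' A)+)
qed

text \<open>A scalar can be moved past \<open>s\<close> or absorbed into it. The first form serves
  the Leibniz rule, the second the \<open>R\<close>-linearity of the connection in the vector
  field.\<close>

lemma ext_act_R_scale:
  fixes g :: "'a::cvector dg"
  assumes r: "r \<in> Gr R k"
    and A: "cbilinear A" "\<And>i j a x. a \<in> Gr g i \<Longrightarrow> x \<in> Gr h j \<Longrightarrow> A a x \<in> Gr h (i + j + p)"
    and g: "grading (Gr g)"
  shows "s \<in> tensor_gr (Gr g) (Gr R) n \<Longrightarrow>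
      R_scale h R r (ext_act h R A s y) = ksign (k * (n + p)) *\<^sub>C ext_act h R A s (R_scale h R r y)"
    and "R_scale h R r (ext_act h R A s y) = ksign (k * p) *\<^sub>C ext_act h R A (R_scale g R r s) y"
proof -
  interpret G: graded_pair R g by unfold_locales (rule g)
  have Aa: "A a x \<in> Gr h (l + (i + p))" if "a \<in> Gr g i" "x \<in> Gr h l" for a x i l
      using A(2)[OF that] by (simp add: ac_simps)
  show "R_scale h R r (ext_act h R A s y) = ksign (k * (n + p)) *\<^sub>C ext_act h R A s (R_scale h R r y)"
    if s: "s \<in> tensor_gr (Gr g) (Gr R) n"
  using s
  proof (induct s rule: tensor_gr_induct)
    fix i j a u assume a: "a \<in> Gr g i" and u: "u \<in> Gr R j" and n: "i + j = n"
    show "R_scale h R r (ext_act h R A (a \<otimes> u) y)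
        = ksign (k * (n + p)) *\<^sub>C ext_act h R A (a \<otimes> u) (R_scale h R r y)"
      by (simp add: ext_act_tens A(1) R_scale_tmap[OF r cbilinearD(1)[OF A(1)] Aa[OF a]]
          R_scale_comm[OF r u] clinear_simps[OF clinear_tmap[OF cbilinearD(1)[OF A(1)]]]
          scaleC_scaleC n[symmetric] ksign_add ring_distribs mult_ac)
  qed (rule subspace_eq, (intro clin clinear_ext_act1 A)+)
  show "R_scale h R r (ext_act h R A s y) = ksign (k * p) *\<^sub>C ext_act h R A (R_scale g R r s) y"
  proof (induct s rule: tensor_induct[OF g grR])
    fix i j a u assume a: "a \<in> Gr g i" and u: "u \<in> Gr R j"
    show "R_scale h R r (ext_act h R A (a \<otimes> u) y)
        = ksign (k * p) *\<^sub>C ext_act h R A (R_scale g R r (a \<otimes> u)) y"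
      by (simp add: ext_act_tens A(1) R_scale_tmap[OF r cbilinearD(1)[OF A(1)] Aa[OF a]]
          R_scale_R_scale[OF r u] G.R_scale_hom[OF a r]
          clinear_simps[OF cbilinearD(2)[OF cbilinear_ext_act[OF A(1)]]]
          scaleC_scaleC ksign_add ring_distribs mult_ac)
  qed (rule subspace_eq, (intro clin clinear_ext_act1 G.clinear_R_scale_comp A)+)
qed

text \<open>A common source for the Jacobi identity in g \<otimes> R and for all commutators of
  \<open>L\<close> and \<open>I\<close>. The shifts \<open>p\<close>, \<open>q\<close> are the
  degrees of the symbols \<open>A\<close>, \<open>B\<close>; the sign of i q arises from moving the
  symbol \<open>B\<close> past \<open>a\<close>.\<close>

lemma ext_act_bracket:
  fixes g :: "'a::cvector dg"
  assumes A: "cbilinear A" "\<And>i j a x. a \<in> Gr g i \<Longrightarrow> x \<in> Gr h j \<Longrightarrow> A a x \<in> Gr h (i + j + p)"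
    and B: "cbilinear B" "\<And>i j a x. a \<in> Gr g i \<Longrightarrow> x \<in> Gr h j \<Longrightarrow> B a x \<in> Gr h (i + j + q)"
    and C: "cbilinear C" and br: "cbilinear br" and g: "grading (Gr g)"
    and rel: "\<And>i j a b x. a \<in> Gr g i \<Longrightarrow> b \<in> Gr g j \<Longrightarrow>
      A a (B b x) = ksign ((i + p) * (j + q)) *\<^sub>C B b (A a x) + ksign (i * q) *\<^sub>C C (br a b) x"
    and s: "s \<in> tensor_gr (Gr g) (Gr R) m" and t: "t \<in> tensor_gr (Gr g) (Gr R) n"
  shows "ext_act h R A s (ext_act h R B t y)
    = ksign ((m + p) * (n + q)) *\<^sub>C ext_act h R B t (ext_act h R A s y)
      + ksign (m * q) *\<^sub>C ext_act h R C (ext_act g R br s t) y"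
proof -
  interpret G: graded_pair R g by unfold_locales (rule g)
  note A1 = cbilinearD(1)[OF A(1)] and B1 = cbilinearD(1)[OF B(1)]
  show ?thesis
  using s
  proof (induct s rule: tensor_gr_induct)
    fix i j a r assume a: "a \<in> Gr g i" and r: "r \<in> Gr R j" and m: "i + j = m"
    show "ext_act h R A (a \<otimes> r) (ext_act h R B t y)
      = ksign ((m + p) * (n + q)) *\<^sub>C ext_act h R B t (ext_act h R A (a \<otimes> r) y)
        + ksign (m * q) *\<^sub>C ext_act h R C (ext_act g R br (a \<otimes> r) t) y"
    using t
    proof (induct t rule: tensor_gr_induct)
      fix k l b u assume b: "b \<in> Gr g k" and u: "u \<in> Gr R l" and n: "k + l = n"
      have Aa: "A a x \<in> Gr h (l + (i + p))" if "x \<in> Gr h l" for x l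
        using A(2)[OF a that] by (simp add: ac_simps)
      have Bb: "B b x \<in> Gr h (l + (k + q))" if "x \<in> Gr h l" for x l
        using B(2)[OF b that] by (simp add: ac_simps)
      \<comment> \<open>Both scalars are gathered innermost, next to \<open>y\<close>, so that the
        relation between \<open>a\<close> and \<open>b\<close> applies to what remains.\<close>
      let ?y = "R_scale h R r (R_scale h R u y)"
      have 1: "tmap (A a) (tmap (B b) ?y)
        = ksign ((i + p) * (k + q)) *\<^sub>C tmap (B b) (tmap (A a) ?y)
          + ksign (i * q) *\<^sub>C tmap (C (br a b)) ?y"
        by (simp add: tmap_tmap A1 B1 rel[OF a b] tmap_fun)
      show "ext_act h R A (a \<otimes> r) (ext_act h R B (b \<otimes> u) y)
        = ksign ((m + p) * (n + q)) *\<^sub>C ext_act h R B (b \<otimes> u) (ext_act h R A (a \<otimes> r) y)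
          + ksign (m * q) *\<^sub>C ext_act h R C (ext_act g R br (a \<otimes> r) (b \<otimes> u)) y"
        by (simp add: ext_act_tens A(1) B(1) C G.ext_act_tens br G.R_scale_hom[OF b r]
            R_scale_R_scale[OF r u, symmetric]
            R_scale_tmap[OF r B1 Bb] R_scale_tmap[OF u A1 Aa] R_scale_comm[OF u r]
            clinear_simps[OF clinear_tmap] A1 B1 1 tmap_tens cbilinearD(1)[OF br]
            clinear_simps[OF cbilinearD(2)[OF cbilinear_ext_act[OF C]]]
            scaleC_scaleC scaleC_add_right m[symmetric] n[symmetric] ksign_add ring_distribs mult_ac)
    qed (rule subspace_eq, (intro clin clinear_ext_act1 clinear_ext_act2 G.clinear_ext_act2 A B C br)+)
  qed (rule subspace_eq, (intro clin clinear_ext_act1 clinear_ext_act2 G.clinear_ext_act1 A B C br)+)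
qed

end

section \<open>The adic filtration of a graded Artin algebra\<close>

lemma mon_length_superset:
  assumes "finite S" "Poly_Mapping.keys a \<subseteq> S"
  shows "mon_length a = (\<Sum>s\<in>S. Poly_Mapping.lookup a s)"
  unfolding mon_length_def
  by (rule sum.mono_neutral_left) (use assms in \<open>auto simp: Poly_Mapping.in_keys_iff\<close>)

lemma mon_length_add: "mon_length (a + b) = mon_length a + mon_length b"
proof -
  let ?S = "Poly_Mapping.keys a \<union> Poly_Mapping.keys b"
  have "mon_length c = (\<Sum>s\<in>?S. Poly_Mapping.lookup c s)" if "c \<in> {a, b, a + b}" for c
    by (rule mon_length_superset) (use that Poly_Mapping.keys_add[of a b] in auto)
  then show ?thesis by (simp add: Poly_Mapping.lookup_add sum.distrib)
qed

lemma mon_length_pos: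
  assumes "a \<noteq> 0"
  shows "1 \<le> mon_length a"
proof -
  obtain s where s: "s \<in> Poly_Mapping.keys a" using assms by fastforce
  then have "Poly_Mapping.lookup a s \<le> mon_length a"
    unfolding mon_length_def by (intro member_le_sum) auto
  moreover have "Poly_Mapping.lookup a s \<noteq> 0" using s by (simp add: Poly_Mapping.in_keys_iff)
  ultimately show ?thesis by linarith
qed

lemma keys_gmult:
  assumes "c \<in> Poly_Mapping.keys (gmult deg p q)"
  obtains a b where "a \<in> Poly_Mapping.keys p" "b \<in> Poly_Mapping.keys q" "c = a + b"
    "mon_sign deg a b \<noteq> 0"
proof -
  have "Poly_Mapping.lookup (gmult deg p q) c \<noteq> 0" using assms by (simp add: Poly_Mapping.in_keys_iff)
  then obtain a where a: "a \<in> Poly_Mapping.keys p" and "(\<Sum>b\<in>Poly_Mapping.keys q.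
      Poly_Mapping.lookup (Poly_Mapping.single (a + b)
      (mon_sign deg a b * Poly_Mapping.lookup p a * Poly_Mapping.lookup q b)) c) \<noteq> 0"
    unfolding gmult_def Poly_Mapping.lookup_sum by (meson sum.not_neutral_contains_not_neutral)
  then obtain b where b: "b \<in> Poly_Mapping.keys q" and "Poly_Mapping.lookup (Poly_Mapping.single (a + b)
      (mon_sign deg a b * Poly_Mapping.lookup p a * Poly_Mapping.lookup q b)) c \<noteq> 0"
    by (meson sum.not_neutral_contains_not_neutral)
  then have "c = a + b" "mon_sign deg a b \<noteq> 0"
    by (auto simp: lookup_single when_def split: if_splits)
  then show thesis using that a b by blast
qed

text \<open>\<open>mon_sign\<close> vanishes as soon as an odd variable would occur twice, so every
  surviving monomial is admissible.\<close>

lemma gmult_gpolys: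
  assumes "p \<in> gpolys n deg" "q \<in> gpolys n deg"
  shows "gmult deg p q \<in> gpolys n deg"
proof -
  have "c \<in> gmons n deg" if c: "c \<in> Poly_Mapping.keys (gmult deg p q)" for c
    using c
  proof (cases rule: keys_gmult)
    case (1 a b)
    then have "a \<in> gmons n deg" "b \<in> gmons n deg" using assms by (auto simp: gpolys_def)
    moreover have "Poly_Mapping.lookup a s + Poly_Mapping.lookup b s \<le> 1" if "odd (deg s)" for s
      using 1(4) that unfolding mon_sign_def by (metis not_less)
    ultimately show ?thesis
      using Poly_Mapping.keys_add[of a b] unfolding 1(3) gmons_def
      by (auto simp: Poly_Mapping.lookup_add)
  qed
  then show ?thesis by (auto simp: gpolys_def)
qed

lemma subspace_clinear_image:
  "clinear f \<Longrightarrow> cvector.subspace S \<Longrightarrow> cvector.subspace (f ` S)"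
  unfolding cvector.subspace_def
  by (auto simp: image_iff) (metis clinear_0 clinear_add clinear_scale)+

lemma ideal_One: "dg_comm_algebra R \<Longrightarrow> alg_ideal R J \<Longrightarrow> One R \<in> J \<Longrightarrow> J = UNIV"
  unfolding dg_comm_algebra_def alg_ideal_def by (metis UNIV_eq_I)

text \<open>\<open>F k\<close> is the image of the polynomials whose monomials all have length at
  least \<open>k\<close>, that is, the k-th power of the ideal of the generators. Since R =
  \<complex> + F 1 with \<open>F 1\<close> nilpotent, every proper ideal lies in \<open>F 1\<close>;
  this also gives the uniqueness that \<open>max_ideal\<close> demands.\<close>

lemma artin_filtration:
  fixes R :: "'r::cvector dga"
  assumes R: "graded_artin R"
  obtains F :: "nat \<Rightarrow> 'r set" and N where
    "\<And>k. cvector.subspace (F k)" "F 0 = UNIV" "F N = {0}" "F 1 = max_ideal R"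
    "\<And>i j x y. x \<in> F i \<Longrightarrow> y \<in> F j \<Longrightarrow> Mul R x y \<in> F (i + j)"
proof -
  have alg: "dg_comm_algebra R" and One0: "One R \<noteq> 0" using R by (auto simp: graded_artin_def)
  have Mul: "cbilinear (Mul R)" and One: "\<And>x. Mul R (One R) x = x" "\<And>x. Mul R x (One R) = x"
    using alg by (auto simp: dg_comm_algebra_def)
  obtain n deg and \<phi> :: "gpoly \<Rightarrow> 'r" and N where \<phi>: "clinear \<phi>"
    and \<phi>1: "\<phi> (Poly_Mapping.single 0 1) = One R"
    and \<phi>m: "\<And>p q. p \<in> gpolys n deg \<Longrightarrow> q \<in> gpolys n deg \<Longrightarrow> \<phi> (gmult deg p q) = Mul R (\<phi> p) (\<phi> q)"
    and \<phi>s: "\<phi> ` gpolys n deg = UNIV"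
    and \<phi>N: "\<And>p. p \<in> gpolys n deg \<Longrightarrow> \<forall>a\<in>Poly_Mapping.keys p. mon_length a \<ge> N \<Longrightarrow> \<phi> p = 0"
    using R unfolding graded_artin_def by blast
  define P where "P k = {p \<in> gpolys n deg. \<forall>a\<in>Poly_Mapping.keys p. k \<le> mon_length a}" for k
  define F where "F k = \<phi> ` P k" for k
  have "cvector.subspace (P k)" for k
    unfolding cvector.subspace_def P_def gpolys_def
    by (auto dest!: subsetD[OF Poly_Mapping.keys_add])
      (auto simp: Poly_Mapping.in_keys_iff lookup_scaleC scaleC_complex_def)
  then have sub: "cvector.subspace (F k)" for k
    unfolding F_def by (rule subspace_clinear_image[OF \<phi>])
  have F0: "F 0 = UNIV" using \<phi>s by (simp add: F_def P_def)
  have FN: "F N = {0}"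
    using cvector.subspace_0[OF sub[of N]] \<phi>N by (auto simp: F_def P_def)
  have FM: "Mul R x y \<in> F (i + j)" if x: "x \<in> F i" and y: "y \<in> F j" for x y i j
  proof -
    obtain p q where p: "p \<in> P i" "x = \<phi> p" and q: "q \<in> P j" "y = \<phi> q"
      using x y by (auto simp: F_def)
    have "gmult deg p q \<in> P (i + j)"
      unfolding P_def
      using gmult_gpolys[of p n deg q] p(1) q(1)
      by (auto simp: P_def mon_length_add elim!: keys_gmult intro!: add_mono)
    moreover have "Mul R x y = \<phi> (gmult deg p q)"
      using \<phi>m[of p q] p q by (simp add: P_def)
    ultimately show ?thesis by (simp add: F_def)
  qed
  have ideal1: "alg_ideal R (F 1)"
    unfolding alg_ideal_def using sub FM[of _ 0 _ 1] FM[of _ 1 _ 0] by (simp add: F0)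
  \<comment> \<open>A unit inside \<open>F 1\<close> would, being idempotent, lie in every power,
    hence in \<open>F N = {0}\<close>.\<close>
  have "One R \<in> F k" if "One R \<in> F 1" for k
    using FM[OF that, of "One R"] by (induction k) (simp_all add: F0 One)
  then have One1: "One R \<notin> F 1" using FN One0 by (metis singletonD)
  \<comment> \<open>The scalar \<open>c\<close> is the constant term of a polynomial representing
    \<open>r\<close>; all other monomials have positive length.\<close>
  have dec: "\<exists>c m. r = c *\<^sub>C One R + m \<and> m \<in> F 1" for r
  proof -
    obtain p where p: "p \<in> gpolys n deg" "r = \<phi> p" using \<phi>s by (metis UNIV_I image_iff)
    define c where "c = Poly_Mapping.lookup p 0"
    define q where "q = p - c *\<^sub>C 1"
    have "Poly_Mapping.lookup q a = (if a = 0 then 0 else Poly_Mapping.lookup p a)" for a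
      by (simp add: q_def c_def lookup_minus lookup_scaleC scaleC_complex_def lookup_one when_def)
    then have "Poly_Mapping.keys q \<subseteq> Poly_Mapping.keys p - {0}"
      by (auto simp: Poly_Mapping.in_keys_iff split: if_splits)
    then have "q \<in> P 1" using p(1) mon_length_pos by (auto simp: P_def gpolys_def)
    moreover have "r = c *\<^sub>C One R + \<phi> q"
      by (simp add: p q_def clinear_simps[OF \<phi>] \<phi>1[simplified])
    ultimately show ?thesis by (auto simp: F_def)
  qed
  have proper: "J \<subseteq> F 1" if J: "alg_ideal R J" "J \<noteq> UNIV" for J
  proof
    fix x assume x: "x \<in> J"
    obtain c m where cm: "x = c *\<^sub>C One R + m" "m \<in> F 1" using dec by blast
    have Jsub: "cvector.subspace J" and Jmul: "\<And>r y. y \<in> J \<Longrightarrow> Mul R r y \<in> J"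
      using J(1) by (auto simp: alg_ideal_def)
    have "c = 0"
    proof (rule ccontr)
      assume c: "c \<noteq> 0"
      \<comment> \<open>Up to a scalar, \<open>x\<close> is 1 - z with \<open>z\<close> nilpotent.
        Instead of inverting it by a geometric series, 1 is shown to be congruent modulo
        \<open>J\<close> to an element of each \<open>F k\<close>, and \<open>F N\<close> contains
        only 0.\<close>
      define z where "z = - (inverse c *\<^sub>C m)"
      have z1: "z \<in> F 1" unfolding z_def
        using cm(2) sub cvector.subspace_neg cvector.subspace_scale by blast
      have "One R - z = inverse c *\<^sub>C x"
        by (simp add: z_def cm(1) scaleC_add_right scaleC_scaleC c)
      then have z: "One R - z \<in> J" using x Jsub cvector.subspace_scale by metis
      have pow: "\<exists>w\<in>F k. One R - w \<in> J" for k
      proof (induction k)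
        case 0
        show ?case
          by (rule bexI[of _ "One R"]) (simp_all add: F0 cvector.subspace_0[OF Jsub])
      next
        case (Suc k)
        then obtain w where w: "w \<in> F k" "One R - w \<in> J" by blast
        have "One R - Mul R z w = (One R - z) + Mul R z (One R - w)"
          by (simp add: clinear_diff[OF cbilinearD(1)[OF Mul]] One)
        then have "One R - Mul R z w \<in> J"
          using z Jmul[OF w(2)] cvector.subspace_add[OF Jsub] by metis
        then show ?case using FM[OF z1 w(1)] by auto
      qed
      have "One R \<in> J" using pow[of N] by (simp add: FN)
      then show False using ideal_One[OF alg J(1)] J(2) by blast
    qed
    then show "x \<in> F 1" using cm by simp
  qed
  have "max_ideal R = F 1"
    unfolding max_ideal_def
  proof (rule the_equality)
    show "alg_ideal R (F 1) \<and> F 1 \<noteq> UNIV \<and> (\<forall>J. alg_ideal R J \<and> F 1 \<subseteq> J \<longrightarrow> J = F 1 \<or> J = UNIV)"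
      using ideal1 One1 proper by blast
    show "M = F 1" if "alg_ideal R M \<and> M \<noteq> UNIV
      \<and> (\<forall>J. alg_ideal R J \<and> M \<subseteq> J \<longrightarrow> J = M \<or> J = UNIV)" for M
      using that ideal1 One1 proper by blast
  qed
  then show thesis using that[of F N] sub F0 FN FM by simp
qed

section \<open>Exponentials of nilpotent operators\<close>

lemma fin_sum_eq: "(\<And>n. n \<ge> N \<Longrightarrow> t n = 0) \<Longrightarrow> fin_sum t = (\<Sum>n<N. t n)"
  unfolding fin_sum_def by (rule sum.mono_neutral_left) (auto simp: not_less[symmetric])

text \<open>The binomial theorem for left multiplication by \<open>X\<close>, the sum of right
  multiplication by \<open>X\<close> and ad X, which commute. The iterated commutators are supplied
  as a family \<open>B\<close>, so that concrete operators can be substituted; \<open>j\<close> is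
  arbitrary because the induction raises it.\<close>

lemma funpow_commutator:
  fixes X :: "'a::cvector \<Rightarrow> 'a"
  assumes X: "clinear X" and B: "\<And>n y. X (B n y) = B n (X y) + B (Suc n) y"
  shows "(X ^^ n) (B j y) = (\<Sum>k\<le>n. of_nat (n choose k) *\<^sub>C B (j + k) ((X ^^ (n - k)) y))"
proof (induction n arbitrary: j y)
  case 0
  show ?case by (simp add: scaleC_one)
next
  case (Suc n)
  let ?f = "\<lambda>k. B (j + k) ((X ^^ (Suc n - k)) y)"
  have 1: "(X ^^ n) (B j (X y)) = (\<Sum>k\<le>n. of_nat (n choose k) *\<^sub>C ?f k)"
    unfolding Suc
    by (intro sum.cong refl) (simp add: funpow_swap1 Suc_diff_le)
  have 2: "(X ^^ n) (B (Suc j) y) = (\<Sum>k\<le>n. of_nat (n choose k) *\<^sub>C ?f (Suc k))"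
    unfolding Suc by simp
  have "(X ^^ Suc n) (B j y) = (X ^^ n) (B j (X y)) + (X ^^ n) (B (Suc j) y)"
    by (simp add: funpow_swap1 B clinear_add[OF clinear_funpow[OF X]])
  \<comment> \<open>The range grows by one at no cost because \<open>n choose Suc n\<close> is 0;
    Pascal's rule then applies term by term.\<close>
  also have "\<dots> = (\<Sum>k\<le>Suc n. of_nat (n choose k) *\<^sub>C ?f k)
      + (\<Sum>k\<le>n. of_nat (n choose k) *\<^sub>C ?f (Suc k))"
    unfolding 1 2 by simp
  also have "\<dots> = ?f 0 + (\<Sum>k\<le>n. of_nat (n choose Suc k) *\<^sub>C ?f (Suc k)
      + of_nat (n choose k) *\<^sub>C ?f (Suc k))"
    by (subst sum.atMost_Suc_shift) (simp add: sum.distrib scaleC_one)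
  also have "\<dots> = (\<Sum>k\<le>Suc n. of_nat (Suc n choose k) *\<^sub>C ?f k)"
    by (simp add: sum.atMost_Suc_shift scaleC_one scaleC_add_left[symmetric] add.commute
        del: sum.atMost_Suc)
  finally show ?case .
qed

lemma op_exp_eq:
  assumes "\<forall>n\<ge>N. \<forall>y. (X ^^ n) y = 0"
  shows "op_exp X y = (\<Sum>n<N. inverse (fact n) *\<^sub>C (X ^^ n) y)"
  unfolding op_exp_def by (rule fin_sum_eq) (simp add: assms)

lemma clinear_op_exp:
  assumes X: "clinear X" and N: "\<forall>n\<ge>N. \<forall>y. (X ^^ n) y = 0"
  shows "clinear (op_exp X)"
  unfolding op_exp_eq[OF N, abs_def] by (intro clinear_setsum clinear_scaleC clinear_funpow X)

text \<open>\<open>e\<^sup>X B\<^sub>0 = (e\<^bsup>ad X\<^esup> B\<^sub>0) e\<^sup>X\<close>, where \<open>B\<^sub>n = (ad X)\<^sup>n B\<^sub>0\<close>.\<close>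

lemma op_exp_conj:
  fixes X :: "'a::cvector \<Rightarrow> 'a"
  assumes X: "clinear X" and N: "\<forall>n\<ge>N. \<forall>y. (X ^^ n) y = 0"
    and B: "\<And>n y. X (B n y) = B n (X y) + B (Suc n) y" "\<And>n. clinear (B n)"
    and BM: "\<And>n y. n \<ge> M \<Longrightarrow> B n y = 0"
  shows "op_exp X (B 0 y) = (\<Sum>k<M. inverse (fact k) *\<^sub>C B k (op_exp X y))"
proof -
  let ?f = "\<lambda>k l. (inverse (fact k) * inverse (fact l)) *\<^sub>C B k ((X ^^ l) y)"
  have zero: "?f k l = 0" if "k \<ge> M \<or> l \<ge> N" for k l
    using that N by (auto simp: BM clinear_0[OF B(2)])
  have summand: "inverse (fact n) *\<^sub>C (X ^^ n) (B 0 y) = (\<Sum>k\<le>n. ?f k (n - k))" for n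
    unfolding funpow_commutator[of X B, OF X B(1)]
    by (auto intro!: sum.cong simp: cvector.scale_sum_right scaleC_scaleC binomial_fact field_simps
        fact_nonzero)
  \<comment> \<open>The bound M + N makes the triangle of index pairs contain the rectangle k < M, l
    < N, outside which all terms vanish.\<close>
  have "op_exp X (B 0 y) = (\<Sum>n<M + N. inverse (fact n) *\<^sub>C (X ^^ n) (B 0 y))"
    by (rule op_exp_eq) (use N in simp)
  also have "\<dots> = (\<Sum>n<M + N. \<Sum>k\<le>n. ?f k (n - k))" by (simp only: summand)
  also have "\<dots> = (\<Sum>(k, l)\<in>{(k, l). k + l < M + N}. ?f k l)"
    by (rule sum.triangle_reindex[symmetric])
  also have "\<dots> = (\<Sum>(k, l)\<in>{..<M} \<times> {..<N}. ?f k l)"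
  proof (rule sum.mono_neutral_right)
    show "finite {(k, l). k + l < M + N}"
      by (rule finite_subset[of _ "{..<M + N} \<times> {..<M + N}"]) auto
    show "\<forall>i\<in>{(k, l). k + l < M + N} - {..<M} \<times> {..<N}. (case i of (k, l) \<Rightarrow> ?f k l) = 0"
    proof (rule ballI)
      fix i assume i: "i \<in> {(k, l). k + l < M + N} - {..<M} \<times> {..<N}"
      obtain k l where kl: "i = (k, l)" by (cases i)
      then have "k \<ge> M \<or> l \<ge> N" using i by auto
      then show "(case i of (k, l) \<Rightarrow> ?f k l) = 0" unfolding kl prod.case by (rule zero)
    qed
  qed auto
  also have "\<dots> = (\<Sum>k<M. \<Sum>l<N. ?f k l)" by (simp add: sum.cartesian_product)
  also have "\<dots> = (\<Sum>k<M. inverse (fact k) *\<^sub>C B k (op_exp X y))"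
    by (simp add: op_exp_eq[OF N] clinear_simps[OF B(2)] cvector.scale_sum_right scaleC_scaleC)
  finally show ?thesis .
qed

section \<open>Nilpotency of the action of the maximal ideal\<close>

definition tensor_fil :: "'r set \<Rightarrow> ('h::cvector, 'r::cvector) tensor set"
  where "tensor_fil S = cvector.span {x \<otimes> s | x s. s \<in> S}"

lemma subspace_tensor_fil: "cvector.subspace (tensor_fil S)"
  unfolding tensor_fil_def by (rule cvector.subspace_span)

lemma tens_tensor_fil: "s \<in> S \<Longrightarrow> x \<otimes> s \<in> tensor_fil S"
  unfolding tensor_fil_def by (rule cvector.span_base) auto

context graded_pair
begin

lemma ext_act_tensor_fil:
  fixes G :: "int \<Rightarrow> 'a::cvector set"
  assumes A: "cbilinear A" and t: "t \<in> tensor_gr G (\<lambda>j. Gr R j \<inter> M) n"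
    and M: "\<And>r s. r \<in> M \<Longrightarrow> s \<in> S \<Longrightarrow> Mul R r s \<in> S'"
    and y: "y \<in> tensor_fil S"
  shows "ext_act h R A t y \<in> tensor_fil S'"
  using t
proof (induct t rule: tensor_gr_induct)
  case subspace
  show ?case by (rule subspace_vimage[OF clinear_ext_act1[OF A clinear_ident] subspace_tensor_fil])
next
  case (tens i j a r)
  have lin: "clinear (\<lambda>y. tmap (A a) (R_scale h R r y))"
    by (intro clinear_tmap_comp clin cbilinearD(1)[OF A])
  have hom: "tmap (A a) (R_scale h R r (x \<otimes> s)) \<in> tensor_fil S'" if s: "s \<in> S" for x s
  proof (induct x rule: hom_induct[OF grh])
    case 1
    show ?case
      by (rule subspace_vimage[OF clinear_comp[OF lin clinear_tens(1)[OF clinear_ident]]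
            subspace_tensor_fil])
  next
    case (2 l x)
    show ?case
      using tens(2) M[OF _ s]
      by (simp add: R_scale_hom[OF 2, of r j] clinear_simps[OF clinear_tmap] cbilinearD(1)[OF A]
          tmap_tens cvector.subspace_scale[OF subspace_tensor_fil] tens_tensor_fil)
  qed
  have "tmap (A a) (R_scale h R r y) \<in> tensor_fil S'"
    by (rule cvector.span_induct[OF y[unfolded tensor_fil_def]
          subspace_vimage[OF lin subspace_tensor_fil]]) (use hom in auto)
  then show ?case by (simp add: ext_act_tens[OF A])
qed

end

text \<open>The maximal ideal is \<open>F 1\<close>, so each application raises the filtration
  degree by one. The bound is the nilpotency order \<open>N\<close> of the filtration of
  \<open>R\<close>, hence uniform in the action and in \<open>t\<close>.\<close>

lemma ext_act_nilpotent:
  fixes R :: "'r::cvector dga" and h :: "'h::cvector dg"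
  assumes R: "graded_artin R" and h: "grading (Gr h)"
  obtains N where "\<And>G A t n. cbilinear A \<Longrightarrow> t \<in> tensor_gr G (\<lambda>j. Gr R j \<inter> max_ideal R) n \<Longrightarrow>
    \<forall>k\<ge>N. \<forall>y. (ext_act h R (A :: 'a::cvector \<Rightarrow> 'h \<Rightarrow> 'h) t ^^ k) y = 0"
proof -
  interpret graded_alg R using R by (simp add: graded_alg_dg_comm graded_artin_def)
  interpret graded_pair R h by unfold_locales (rule h)
  obtain F :: "nat \<Rightarrow> 'r set" and N where F: "\<And>k. cvector.subspace (F k)" "F 0 = UNIV" "F N = {0}"
    "F 1 = max_ideal R" "\<And>i j x y. x \<in> F i \<Longrightarrow> y \<in> F j \<Longrightarrow> Mul R x y \<in> F (i + j)"
    using artin_filtration[OF R] by blast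
  have "(ext_act h R A t ^^ k) y = 0"
    if A: "cbilinear A" and t: "t \<in> tensor_gr G (\<lambda>j. Gr R j \<inter> max_ideal R) n" and k: "k \<ge> N"
    for G n k t y and A :: "'a \<Rightarrow> 'h \<Rightarrow> 'h"
  proof -
    have fil: "(ext_act h R A t ^^ k) y \<in> tensor_fil (F k)" for k y
    proof (induction k)
      case 0
      have "tensor_fil (F 0) = (UNIV :: ('h, 'r) tensor set)"
        using span_tens by (simp add: tensor_fil_def F(2))
      then show ?case by simp
    next
      case (Suc k)
      have "ext_act h R A t ((ext_act h R A t ^^ k) y) \<in> tensor_fil (F (Suc k))"
        by (rule ext_act_tensor_fil[OF A t _ Suc]) (use F(5)[of _ 1 _ k] F(4) in simp)
      then show ?case by simp
    qed
    have "tensor_fil {0} \<subseteq> ({0} :: ('h, 'r) tensor set)"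
      unfolding tensor_fil_def
      by (rule cvector.span_minimal) (auto simp: tens_simps cvector.subspace_def)
    then have N: "(ext_act h R A t ^^ N) y = 0" for y
      using fil[of N y] by (auto simp: F(3))
    have "k = N + (k - N)" using k by simp
    then have "(ext_act h R A t ^^ k) y = (ext_act h R A t ^^ N) ((ext_act h R A t ^^ (k - N)) y)"
      by (metis comp_apply funpow_add)
    then show ?thesis by (simp add: N)
  qed
  then show thesis using that by blast
qed

section \<open>Base change\<close>

lemma base_change_tens: "clinear \<phi> \<Longrightarrow> base_change \<phi> (x \<otimes> r) = x \<otimes> \<phi> r"
  and clinear_base_change: "clinear \<phi> \<Longrightarrow> clinear (base_change \<phi>)"
  by (simp_all add: base_change_def tensor_lift_tens clinear_tensor_lift
      cbilinearI[OF clinear_tens(2)  clinear_tens(1)[OF clinear_ident]])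

lemma clinear_base_change_comp: "clinear \<phi> \<Longrightarrow> clinear f \<Longrightarrow> clinear (\<lambda>x. base_change \<phi> (f x))"
  by (rule clinear_comp[OF clinear_base_change])

locale graded_base_change = graded_pair R h + R': graded_pair R' h
  for R :: "'r::cvector dga" and R' :: "'s::cvector dga" and h :: "'h::cvector dg" +
  fixes \<phi> :: "'r \<Rightarrow> 's"
  assumes hom: "artin_hom R R' \<phi>"
begin

lemma clinear_hom: "clinear \<phi>" and hom_mem: "\<And>i r. r \<in> Gr R i \<Longrightarrow> \<phi> r \<in> Gr R' i"
  and hom_Mul: "\<And>r s. \<phi> (Mul R r s) = Mul R' (\<phi> r) (\<phi> s)"
  using hom by (auto simp: artin_hom_def)

lemma hom_par: "\<phi> (par (Gr R) r) = par (Gr R') (\<phi> r)"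
proof (induct r rule: hom_induct[OF grR])
  case 1
  show ?case
    by (intro subspace_eq clinear_comp[OF clinear_hom clinear_par[OF grR]]
        clinear_comp[OF clinear_par[OF R'.grR] clinear_hom])
qed (simp add: par_hom[OF grR] par_hom[OF R'.grR hom_mem] clinear_simps[OF clinear_hom])

lemma base_change_tmap:
  fixes T :: "'a::cvector \<Rightarrow> 'b::cvector" and G :: "int \<Rightarrow> 'a set"
  assumes T: "clinear T" and G: "grading G"
  shows "base_change \<phi> (tmap T t) = tmap T (base_change \<phi> t)"
  by (induct t rule: tensor_induct[OF G grR], rule subspace_eq,
      (intro clin clinear_tmap_comp clinear_base_change_comp clinear_hom T)+)
    (simp add: base_change_tens clinear_hom tmap_tens T)

lemma base_change_R_scale:
  assumes r: "r \<in> Gr R i"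
  shows "base_change \<phi> (R_scale h R r y) = R_scale h R' (\<phi> r) (base_change \<phi> y)"
  by (induct y rule: tensor_induct[OF grh grR], rule subspace_eq,
      (intro clin R'.clinear_R_scale_comp clinear_base_change_comp clinear_hom)+)
    (simp add: base_change_tens clinear_hom R_scale_hom[OF _ r] R'.R_scale_hom[OF _ hom_mem[OF r]]
      hom_Mul clinear_simps[OF clinear_base_change])

lemma base_change_ext_act:
  fixes A :: "'a::cvector \<Rightarrow> 'h \<Rightarrow> 'h" and G :: "int \<Rightarrow> 'a set"
  assumes A: "cbilinear A" and G: "grading G"
  shows "base_change \<phi> (ext_act h R A t y) = ext_act h R' A (base_change \<phi> t) (base_change \<phi> y)"
  by (induct t rule: tensor_induct[OF G grR], rule subspace_eq,
      (intro clin clinear_ext_act1 R'.clinear_ext_act1 clinear_base_change_comp clinear_hom A)+)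
    (simp add: base_change_tens clinear_hom ext_act_tens A R'.ext_act_tens
      base_change_tmap[OF cbilinearD(1)[OF A] grh] base_change_R_scale)

text \<open>A degree-preserving \<phi> commutes with parity, so the parity conjugates of related
  maps are related again.\<close>

lemma base_change_dd:
  assumes v: "clinear v" and v': "clinear v'" and vv: "\<And>r. \<phi> (v r) = v' (\<phi> r)"
  shows "base_change \<phi> (dd h R v y) = dd h R' v' (base_change \<phi> y)"
proof -
  have kos: "\<phi> (kos_op (Gr R) j v r) = kos_op (Gr R') j v' (\<phi> r)" for j r
    by (simp add: kos_op_def hom_par vv)
  show ?thesis
    by (induct y rule: tensor_induct[OF grh grR], rule subspace_eq,
        (intro clin clinear_dd_comp R'.clinear_dd_comp clinear_base_change_comp clinear_hom v v')+)
      (simp add: base_change_tens clinear_hom dd_tens[OF v] R'.dd_tens[OF v'] kos)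
qed

lemma base_change_mem:
  assumes "t \<in> tensor_gr G (Gr R) n"
  shows "base_change \<phi> t \<in> tensor_gr G (Gr R') n"
  using assms
proof (induct t rule: tensor_gr_induct)
  case subspace
  show ?case by (rule subspace_vimage[OF clinear_base_change[OF clinear_hom] subspace_tensor_gr])
qed (auto simp: base_change_tens[OF clinear_hom] intro: tens_mem hom_mem)

end

section \<open>The actions of \<open>g\<close> and \<open>\<xi>g\<close> on the extension of scalars\<close>

text \<open>Puts the only possible decomposition in closed form, which settles existence and
  uniqueness at once.\<close>

lemma is_decomp_Cxi:
  "is_decomp (Gr Cxi) x c \<longleftrightarrow> c = (\<lambda>i. if i = 0 then (fst x, 0) else if i = - 1 then (0, snd x) else 0)"
    (is "_ \<longleftrightarrow> c = ?c x")
proof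
  assume c: "is_decomp (Gr Cxi) x c"
  then have mem: "c i \<in> Gr Cxi i" for i by (simp add: is_decomp_def)
  have c0: "c i = 0" if "i \<noteq> 0" "i \<noteq> - 1" for i using mem[of i] that by (simp add: Cxi_def)
  have "is_decomp (Gr Cxi) x c \<longleftrightarrow> (\<forall>i. c i \<in> Gr Cxi i) \<and> x = (\<Sum>i\<in>{0, - 1}. c i)"
    by (rule is_decomp_iff) (use c0 in auto)
  then have x: "x = c 0 + c (- 1)" using c by simp
  have "snd (c 0) = 0" "fst (c (- 1)) = 0" using mem[of 0] mem[of "- 1"] by (auto simp: Cxi_def)
  then show "c = ?c x" by (auto simp: fun_eq_iff c0 x prod_eq_iff)
next
  assume c: "c = ?c x"
  have "is_decomp (Gr Cxi) x (?c x) \<longleftrightarrow> (\<forall>i. ?c x i \<in> Gr Cxi i) \<and> x = (\<Sum>i\<in>{0, - 1}. ?c x i)"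
    by (rule is_decomp_iff) auto
  then show "is_decomp (Gr Cxi) x c" by (auto simp: c Cxi_def prod_eq_iff)
qed

lemma graded_alg_Cxi: "graded_alg Cxi"
proof
  show "grading (Gr Cxi)"
    unfolding grading_def is_decomp_Cxi
    by (auto simp: cvector.subspace_def Cxi_def scaleC_prod_def scaleC_complex_def zero_prod_def
        plus_prod_def)
  show "cbilinear (Mul Cxi)"
    by (intro cbilinearI clinearI)
      (auto simp: Cxi_def scaleC_prod_def scaleC_complex_def algebra_simps)
  show "Mul Cxi x y \<in> Gr Cxi (i + j)" if "x \<in> Gr Cxi i" "y \<in> Gr Cxi j" for i j x y
    using that by (auto simp: Cxi_def zero_prod_def split: if_splits)
  show "Mul Cxi x y = ksign (i * j) *\<^sub>C Mul Cxi y x" if "x \<in> Gr Cxi i" "y \<in> Gr Cxi j" for i j x y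
    using that by (auto simp: Cxi_def zero_prod_def scaleC_one ksign_def scaleC_prod_def
        scaleC_complex_def split: if_splits)
qed (auto simp: Cxi_def algebra_simps)

lemma clinear_Dif_Cxi: "clinear (Dif Cxi)"
  by (rule clinearI) (auto simp: Cxi_def scaleC_prod_def scaleC_complex_def)

text \<open>The Koszul sign in the bracket is that of an extended action. The record is rebuilt
  because \<open>ext_act\<close> expects a plain \<open>dg\<close>.\<close>

lemma tensor_br_ext_act: "tensor_br L A = ext_act \<lparr>Gr = Gr L, Dif = Dif L\<rparr> A (Br L)"
  by (simp add: fun_eq_iff tensor_br_def ext_act_def)

lemma cbilinear_tensor_dif:
  assumes "grading (Gr V)" "clinear (Dif V)" "clinear (Dif W)"
  shows "cbilinear (\<lambda>x y. Dif V x \<otimes> y + par (Gr V) x \<otimes> Dif W y)"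
  using assms by (intro cbilinearI clin clinear_par)

lemma tensor_dif_tmap:
  assumes "grading (Gr V)" "clinear (Dif V)" "Dif W = (\<lambda>_. 0)"
  shows "tensor_dif V W = tmap (Dif V)"
  by (simp add: tensor_dif_def tmap_def assms tens_simps)

lemma dd_dg: "dd V R v = dd \<lparr>Gr = Gr V, Dif = Dif V\<rparr> R v"
  by (simp add: dd_def)

locale lie_algebra_artin =
  fixes g :: "'g::cvector dgl" and R :: "'r::cvector dga"
  assumes lie: "dg_lie_algebra g" and artin: "graded_artin R"
begin

text \<open>\<open>tensor_br g R\<close> is the extension of scalars of the adjoint action on the dg space \<open>g'\<close>, so that
  the results on \<open>ext_act\<close> give the Jacobi identity and the derivation rules in \<open>g \<otimes> R\<close>.\<close>

abbreviation "g' \<equiv> \<lparr>Gr = Gr g, Dif = Dif g\<rparr>"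
abbreviation "A n \<equiv> tensor_gr (Gr g) (Gr R) n"
abbreviation "dA \<equiv> tensor_dif g R"
abbreviation "br \<equiv> tensor_br g R"
abbreviation "W \<equiv> dd g R"

section \<open>The dg Lie algebra structure of g \<otimes> R\<close>

lemma grg: "grading (Gr g)" and clinear_Difg: "clinear (Dif g)"
  and Difg_mem: "\<And>i x. x \<in> Gr g i \<Longrightarrow> Dif g x \<in> Gr g (i + 1)"
  and cbilinear_Br: "cbilinear (Br g)"
  and Br_mem: "\<And>i j x y. x \<in> Gr g i \<Longrightarrow> y \<in> Gr g j \<Longrightarrow> Br g x y \<in> Gr g (i + j)"
  and Br_antisym: "\<And>i j x y. x \<in> Gr g i \<Longrightarrow> y \<in> Gr g j \<Longrightarrow> Br g x y = - (ksign (i * j) *\<^sub>C Br g y x)"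
  and Br_jacobi: "\<And>i j x y z. x \<in> Gr g i \<Longrightarrow> y \<in> Gr g j \<Longrightarrow>
    Br g x (Br g y z) = Br g (Br g x y) z + ksign (i * j) *\<^sub>C Br g y (Br g x z)"
  and Dif_Br: "\<And>i x y. x \<in> Gr g i \<Longrightarrow>
    Dif g (Br g x y) = Br g (Dif g x) y + ksign i *\<^sub>C Br g x (Dif g y)"
  using lie unfolding dg_lie_algebra_def dg_space_def by metis+

lemma DifR: "Dif R = (\<lambda>_. 0)" and comm_alg: "dg_comm_algebra R"
  using artin by (auto simp: graded_artin_def)

sublocale graded_alg R
  by (rule graded_alg_dg_comm[OF comm_alg])

sublocale G: graded_pair R g'
  by unfold_locales (simp add: grg)

lemma dA_tmap: "dA = tmap (Dif g)"
  by (rule tensor_dif_tmap[OF grg clinear_Difg DifR])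

lemmas br_ext = tensor_br_ext_act[of g R]
lemmas W_dd = dd_dg[of g R]

lemma cbilinear_br: "cbilinear br"
  unfolding br_ext by (rule G.cbilinear_ext_act[OF cbilinear_Br])

lemma clinear_dA: "clinear dA"
  unfolding dA_tmap by (rule clinear_tmap[OF clinear_Difg])

lemma clinear_W: "clinear v \<Longrightarrow> clinear (W v)"
  unfolding W_dd by (rule G.clinear_dd)

lemma br_tens:
  "b \<in> Gr g j \<Longrightarrow> r \<in> Gr R i \<Longrightarrow> br (a \<otimes> r) (b \<otimes> s) = ksign (i * j) *\<^sub>C (Br g a b \<otimes> Mul R r s)"
  by (simp add: br_ext G.ext_act_tens cbilinear_Br G.R_scale_hom[of b j r i] tmap_tens
      cbilinearD[OF cbilinear_Br] clinear_simps[OF clinear_tmap])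

lemma dA_mem: "t \<in> A n \<Longrightarrow> dA t \<in> A (n + 1)"
proof (induct t rule: tensor_gr_induct)
  case subspace
  show ?case by (rule subspace_vimage[OF clinear_dA subspace_tensor_gr])
qed (auto simp: dA_tmap tmap_tens clinear_Difg intro: tens_mem Difg_mem)

lemma W_mem:
  assumes v: "clinear v" "\<And>i x. x \<in> Gr R i \<Longrightarrow> v x \<in> Gr R (i + k)"
  shows "t \<in> A n \<Longrightarrow> W v t \<in> A (n + k)"
proof (induct t rule: tensor_gr_induct)
  case subspace
  show ?case by (rule subspace_vimage[OF clinear_W[OF v(1)] subspace_tensor_gr])
next
  case (tens i j x y)
  then show ?case
    by (auto simp: W_dd G.dd_hom[OF v, of x i] intro!: tensor_gr_closed tens_mem v(2))
qed

lemma br_mem: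
  assumes s: "s \<in> A m" and t: "t \<in> A n"
  shows "br s t \<in> A (m + n)"
  using s
proof (induct s rule: tensor_gr_induct)
  case subspace
  show ?case
    by (rule subspace_vimage[OF _ subspace_tensor_gr])
      (rule cbilinear_comp1[OF cbilinear_br clinear_ident])
next
  case (tens i j a r)
  note ar = tens
  show ?case using t
  proof (induct t rule: tensor_gr_induct)
    case subspace
    show ?case
      by (rule subspace_vimage[OF _ subspace_tensor_gr])
        (rule cbilinear_comp2[OF cbilinear_br clinear_ident])
  next
    case (tens k l b u)
    then show ?case using ar
      by (auto simp: br_tens intro!: tensor_gr_closed tens_mem Br_mem Mul_mem)
  qed
qed

lemma br_antisym:
  assumes s: "s \<in> A m" and t: "t \<in> A n"
  shows "br s t = - (ksign (m * n) *\<^sub>C br t s)"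
  using s
proof (induct s rule: tensor_gr_induct)
  case subspace
  show ?case
    by (rule subspace_eq; intro clin cbilinear_comp1[OF cbilinear_br] cbilinear_comp2[OF cbilinear_br])
next
  case (tens i j a r)
  note ar = tens
  show ?case using t
  proof (induct t rule: tensor_gr_induct)
    case subspace
    show ?case
      by (rule subspace_eq; intro clin cbilinear_comp1[OF cbilinear_br] cbilinear_comp2[OF cbilinear_br])
  next
    case (tens k l b u)
    show ?case
      unfolding br_tens[OF tens(1) ar(2)] br_tens[OF ar(1) tens(2)]
        Br_antisym[OF ar(1) tens(1)] Mul_comm[OF ar(2) tens(2)] ar(3)[symmetric] tens(3)[symmetric]
      by (simp add: tens_simps scaleC_scaleC ksign_add ring_distribs mult_ac)
  qed
qed

lemma br_jacobi:
  "s \<in> A i \<Longrightarrow> t \<in> A j \<Longrightarrow> br s (br t y) = ksign (i * j) *\<^sub>C br t (br s y) + br (br s t) y"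
proof -
  assume st: "s \<in> A i" "t \<in> A j"
  \<comment> \<open>The vanishing shifts are written out to match the pattern of
    \<open>ext_act_bracket\<close>.\<close>
  have rel: "Br g a (Br g b x)
      = ksign ((i + 0) * (j + 0)) *\<^sub>C Br g b (Br g a x) + ksign (i * 0) *\<^sub>C Br g (Br g a b) x"
    if "a \<in> Gr g' i" "b \<in> Gr g' j" for i j a b x
    using Br_jacobi[of a i b j x] that by (simp add: scaleC_one)
  have "ext_act g' R (Br g) s (ext_act g' R (Br g) t y)
      = ksign ((i + 0) * (j + 0)) *\<^sub>C ext_act g' R (Br g) t (ext_act g' R (Br g) s y)
        + ksign (i * 0) *\<^sub>C ext_act g' R (Br g) (ext_act g' R (Br g) s t) y"
    by (rule G.ext_act_bracket[where g = g' and br = "Br g"];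
        (rule cbilinear_Br | (rule rel; assumption) | simp add: Br_mem grg st))
  then show ?thesis by (simp add: br_ext scaleC_one)
qed

lemma dA_br:
  "s \<in> A i \<Longrightarrow> dA (br s y) = br (dA s) y + ksign i *\<^sub>C br s (dA y)"
  unfolding br_ext dA_tmap
  using G.ext_act_dif[of "Dif g" "Br g" "\<lambda>a. Br g (Dif g a)" "Gr g" 0 s i y]
    G.ext_act_fun_tmap[OF cbilinear_Br clinear_Difg grg, of s y]
  by (simp add: cbilinear_Br clinear_Difg Difg_mem Dif_Br
      cbilinearI[OF cbilinearD(1)[OF cbilinear_Br] cbilinear_comp1[OF cbilinear_Br clinear_Difg]])

lemma W_br:
  "v \<in> Der_hom R k \<Longrightarrow> s \<in> A n \<Longrightarrow> W v (br s y) = br (W v s) y + ksign (k * n) *\<^sub>C br s (W v y)"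
  unfolding br_ext W_dd
  using G.ext_act_dd[of v k "Br g" g' 0 s n y]
  by (simp add: cbilinear_Br Br_mem grg scaleC_one)

lemma W_dA: "v \<in> Der_hom R k \<Longrightarrow> W v (dA y) = ksign k *\<^sub>C dA (W v y)"
  unfolding dA_tmap W_dd
  using G.dd_tmap[of v k "Dif g" 1 y] G.Der_homD[of v k]
  by (simp add: clinear_Difg Difg_mem)

lemma MC_mem: "\<gamma> \<in> MC g R \<Longrightarrow> \<gamma> \<in> A 1"
  and MC_eq: "\<gamma> \<in> MC g R \<Longrightarrow> dA \<gamma> + (1/2) *\<^sub>C br \<gamma> \<gamma> = 0"
  and gM_mem: "\<alpha> \<in> gM g R n \<Longrightarrow> \<alpha> \<in> A n"
proof -
  have sub: "gM g R n \<subseteq> A n" for n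
    unfolding gM_def tensor_gr_def by (rule cvector.span_mono) auto
  then show "\<alpha> \<in> gM g R n \<Longrightarrow> \<alpha> \<in> A n" by auto
  show "\<gamma> \<in> MC g R \<Longrightarrow> \<gamma> \<in> A 1" "\<gamma> \<in> MC g R \<Longrightarrow> dA \<gamma> + (1/2) *\<^sub>C br \<gamma> \<gamma> = 0"
    using sub by (auto simp: MC_def tensor_dgl_def)
qed

end

locale xi_module = lie_algebra_artin g R
  for g :: "'g::cvector dgl" and R :: "'r::cvector dga" +
  fixes h :: "'h::cvector dg" and m :: "'g \<Rightarrow> 'h \<Rightarrow> 'h" and mx :: "('g, cxi) tensor \<Rightarrow> 'h \<Rightarrow> 'h"
  assumes module: "dg_lie_module g h m"
    and xmodule: "dg_lie_module (tensor_dgl g Cxi) h mx"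
    and mx_One: "\<And>a x. mx (a \<otimes> One Cxi) x = m a x"
begin

abbreviation "ia \<equiv> \<lambda>a. mx (xi_times g a)"
abbreviation "L \<equiv> ext_act h R m"
abbreviation "I \<equiv> i_op g h mx R"
abbreviation "dE \<equiv> tensor_dif h R"
abbreviation "V \<equiv> dd h R"

lemma grh: "grading (Gr h)" and clinear_Difh: "clinear (Dif h)"
  and Difh_mem: "\<And>i x. x \<in> Gr h i \<Longrightarrow> Dif h x \<in> Gr h (i + 1)"
  and cbilinear_m: "cbilinear m"
  and m_mem: "\<And>i j a x. a \<in> Gr g i \<Longrightarrow> x \<in> Gr h j \<Longrightarrow> m a x \<in> Gr h (i + j)"
  and m_Br: "\<And>i j a b x. a \<in> Gr g i \<Longrightarrow> b \<in> Gr g j \<Longrightarrow>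
    m (Br g a b) x = m a (m b x) - ksign (i * j) *\<^sub>C m b (m a x)"
  and Dif_m: "\<And>i a x. a \<in> Gr g i \<Longrightarrow> Dif h (m a x) = m (Dif g a) x + ksign i *\<^sub>C m a (Dif h x)"
  using module unfolding dg_lie_module_def dg_space_def by metis+

lemma
  shows cbilinear_mx: "cbilinear mx"
    and mx_mem: "\<And>i j a x. a \<in> tensor_gr (Gr g) (Gr Cxi) i \<Longrightarrow> x \<in> Gr h j \<Longrightarrow> mx a x \<in> Gr h (i + j)"
    and mx_br: "\<And>i j a b x. a \<in> tensor_gr (Gr g) (Gr Cxi) i \<Longrightarrow> b \<in> tensor_gr (Gr g) (Gr Cxi) j \<Longrightarrow>
      mx (tensor_br g Cxi a b) x = mx a (mx b x) - ksign (i * j) *\<^sub>C mx b (mx a x)"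
    and Dif_mx: "\<And>i a x. a \<in> tensor_gr (Gr g) (Gr Cxi) i \<Longrightarrow>
      Dif h (mx a x) = mx (tensor_dif g Cxi a) x + ksign i *\<^sub>C mx a (Dif h x)"
  using xmodule unfolding dg_lie_module_def tensor_dgl_def by simp_all

sublocale H: graded_pair R h
  by unfold_locales (simp add: grh)

section \<open>Cartan relations between \<open>m\<close> and \<open>ia\<close>\<close>

lemma ia_hom: "a \<in> Gr g i \<Longrightarrow> ia a x = ksign i *\<^sub>C mx (a \<otimes> xi) x"
  by (simp add: xi_times_def par_hom[OF grg] tens_simps clinear_simps[OF cbilinearD(2)[OF cbilinear_mx]])

lemma cbilinear_ia: "cbilinear ia"
proof (rule cbilinearI)
  show "clinear (ia a)" for a by (rule cbilinearD(1)[OF cbilinear_mx])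
  show "clinear (\<lambda>a. ia a x)" for x
    unfolding xi_times_def
    by (rule cbilinear_comp1[OF cbilinear_mx clinear_tens(1)[OF clinear_par[OF grg]]])
qed

lemma xi_mem: "xi \<in> Gr Cxi (- 1)" and One_Cxi_mem: "One Cxi \<in> Gr Cxi 0"
  by (simp_all add: xi_def Cxi_def)

lemma tens_xi_mem: "a \<in> Gr g i \<Longrightarrow> a \<otimes> xi \<in> tensor_gr (Gr g) (Gr Cxi) (i - 1)"
  and tens_One_mem: "a \<in> Gr g i \<Longrightarrow> a \<otimes> One Cxi \<in> tensor_gr (Gr g) (Gr Cxi) i"
  using tens_mem[of a "Gr g" i xi "Gr Cxi" "- 1" "i - 1"] tens_mem[of a "Gr g" i "One Cxi" "Gr Cxi" 0 i]
  by (simp_all add: xi_mem One_Cxi_mem)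

lemma ia_mem: "a \<in> Gr g i \<Longrightarrow> x \<in> Gr h j \<Longrightarrow> ia a x \<in> Gr h (i + j + (- 1))"
  using mx_mem[OF tens_xi_mem, of a i x j]
  by (simp add: ia_hom grading_closed(3)[OF grh] algebra_simps)

lemma br_Cxi:
  "b \<in> Gr g j \<Longrightarrow> r \<in> Gr Cxi i \<Longrightarrow>
    tensor_br g Cxi (a \<otimes> r) (b \<otimes> s) = ksign (i * j) *\<^sub>C (Br g a b \<otimes> Mul Cxi r s)"
proof -
  interpret X: graded_alg Cxi by (rule graded_alg_Cxi)
  interpret X: graded_pair Cxi g' by unfold_locales (simp add: grg)
  show "b \<in> Gr g j \<Longrightarrow> r \<in> Gr Cxi i \<Longrightarrow> ?thesis"
    by (simp add: tensor_br_ext_act X.ext_act_tens cbilinear_Br X.R_scale_hom[of b j r i] tmap_tens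
        cbilinearD[OF cbilinear_Br] clinear_simps[OF clinear_tmap])
qed

lemma dif_tens_xi: "a \<in> Gr g i \<Longrightarrow>
    tensor_dif g Cxi (a \<otimes> xi) = Dif g a \<otimes> xi + ksign i *\<^sub>C (a \<otimes> One Cxi)"
  unfolding tensor_dif_def
  by (subst tensor_lift_tens[OF cbilinear_tensor_dif[OF grg clinear_Difg clinear_Dif_Cxi]])
    (simp add: par_hom[OF grg] tens_simps, simp add: Cxi_def xi_def)

text \<open>Comes from [a \<otimes> 1, b \<otimes> \<xi>] = [a, b] \<otimes> \<xi>. The extra sign
  of \<open>i\<close> compares \<xi>[a, b] with \<xi>b, since \<xi> is written on the right of the
  tensor.\<close>

lemma m_ia:
  assumes a: "a \<in> Gr g i" and b: "b \<in> Gr g j"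
  shows "m a (ia b x) = ksign (i * (j - 1)) *\<^sub>C ia b (m a x) + ksign i *\<^sub>C ia (Br g a b) x"
proof -
  have "tensor_br g Cxi (a \<otimes> One Cxi) (b \<otimes> xi) = Br g a b \<otimes> xi"
    using br_Cxi[OF b One_Cxi_mem, of a xi] by (simp add: scaleC_one) (simp add: Cxi_def xi_def)
  then have "mx (Br g a b \<otimes> xi) x
      = m a (mx (b \<otimes> xi) x) - ksign (i * (j - 1)) *\<^sub>C mx (b \<otimes> xi) (m a x)"
    using mx_br[OF tens_One_mem[OF a] tens_xi_mem[OF b], of x] by (simp add: mx_One)
  then have "m a (mx (b \<otimes> xi) x)
      = ksign (i * (j - 1)) *\<^sub>C mx (b \<otimes> xi) (m a x) + mx (Br g a b \<otimes> xi) x"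
    by (simp add: algebra_simps)
  then show ?thesis
    by (simp add: ia_hom[OF b] ia_hom[OF Br_mem[OF a b]] clinear_simps[OF cbilinearD(1)[OF cbilinear_m]]
        scaleC_add_right scaleC_scaleC ksign_add mult_ac)
qed

text \<open>The bracket of a \<otimes> \<xi> and b \<otimes> \<xi> contains \<xi>^2 = 0.\<close>

lemma ia_ia:
  assumes a: "a \<in> Gr g i" and b: "b \<in> Gr g j"
  shows "ia a (ia b x) = ksign ((i - 1) * (j - 1)) *\<^sub>C ia b (ia a x)"
proof -
  have "tensor_br g Cxi (a \<otimes> xi) (b \<otimes> xi) = 0"
    using br_Cxi[OF b xi_mem, of a xi] by (simp add: Cxi_def xi_def tens_simps flip: zero_prod_def)
  then have "mx (a \<otimes> xi) (mx (b \<otimes> xi) x) = ksign ((i - 1) * (j - 1)) *\<^sub>C mx (b \<otimes> xi) (mx (a \<otimes> xi) x)"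
    using mx_br[OF tens_xi_mem[OF a] tens_xi_mem[OF b], of x]
    by (simp add: clinear_0[OF cbilinearD(2)[OF cbilinear_mx]])
  then show ?thesis
    by (simp add: ia_hom[OF b] ia_hom[OF a] clinear_simps[OF cbilinearD(1)[OF cbilinear_mx]]
        scaleC_scaleC mult_ac)
qed

text \<open>Cartan's formula: d(\<xi>a) = a - \<xi> da, because d\<xi> = 1.\<close>

lemma Dif_ia:
  assumes a: "a \<in> Gr g i"
  shows "Dif h (ia a x) = (m a x - ia (Dif g a) x) + ksign (i + (- 1)) *\<^sub>C ia a (Dif h x)"
proof -
  have "Dif h (mx (a \<otimes> xi) x)
      = mx (Dif g a \<otimes> xi) x + ksign i *\<^sub>C m a x + ksign (i - 1) *\<^sub>C mx (a \<otimes> xi) (Dif h x)"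
    using Dif_mx[OF tens_xi_mem[OF a], of x]
    by (simp add: dif_tens_xi[OF a] mx_One clinear_simps[OF cbilinearD(2)[OF cbilinear_mx]])
  then show ?thesis
    by (simp add: ia_hom[OF a] ia_hom[OF Difg_mem[OF a]] clinear_simps[OF clinear_Difh]
        cvector.scale_right_diff_distrib scaleC_add_right scaleC_scaleC ksign_add ksign_diff
        scaleC_one mult_ac)
qed

section \<open>The Cartan relations after extension of scalars to R\<close>

lemma dE_tmap: "dE = tmap (Dif h)"
  by (rule tensor_dif_tmap[OF grh clinear_Difh DifR])

lemma I_ext: "I = ext_act h R ia"
  by (simp add: i_op_def)

lemma cbilinear_L: "cbilinear L"
  by (rule H.cbilinear_ext_act[OF cbilinear_m])

lemma cbilinear_I: "cbilinear I"
  unfolding I_ext by (rule H.cbilinear_ext_act[OF cbilinear_ia])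

lemma clinear_dE: "clinear dE"
  unfolding dE_tmap by (rule clinear_tmap[OF clinear_Difh])

lemma L_L: "s \<in> A i \<Longrightarrow> t \<in> A j \<Longrightarrow> L s (L t y) = ksign (i * j) *\<^sub>C L t (L s y) + L (br s t) y"
  unfolding br_ext
  using H.ext_act_bracket[of m g' 0 m 0 m "Br g" s i t j y]
  by (simp add: cbilinear_m m_mem m_Br grg scaleC_one cbilinear_Br)

lemma L_I: "s \<in> A i \<Longrightarrow> t \<in> A j \<Longrightarrow>
    L s (I t y) = ksign (i * (j - 1)) *\<^sub>C I t (L s y) + ksign i *\<^sub>C I (br s t) y"
  unfolding br_ext I_ext
  using H.ext_act_bracket[of m g' 0 ia "- 1" ia "Br g" s i t j y]
  by (simp add: cbilinear_m cbilinear_ia m_mem ia_mem[simplified] m_ia grg cbilinear_Br)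

lemma I_I: "s \<in> A i \<Longrightarrow> t \<in> A j \<Longrightarrow> I s (I t y) = ksign ((i - 1) * (j - 1)) *\<^sub>C I t (I s y)"
proof -
  assume st: "s \<in> A i" "t \<in> A j"
  have zero: "cbilinear (\<lambda>(a :: 'g) (x :: 'h). 0 :: 'h)"
    by (intro cbilinearI clin)
  have rel: "ia a (ia b x) = ksign ((i + - 1) * (j + - 1)) *\<^sub>C ia b (ia a x) + ksign (i * - 1) *\<^sub>C 0"
    if "a \<in> Gr g' i" "b \<in> Gr g' j" for i j a b x
    using ia_ia[of a i b j x] that by simp
  \<comment> \<open>The zero action, which takes the place of the bracket term here, is obtained as
    \<open>m\<close> minus itself.\<close>
  have 0: "ext_act h R (\<lambda>a x. 0) t y = 0" for t :: "('g, 'r) tensor"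
    using H.ext_act_fun_diff[OF cbilinear_m cbilinear_m grg, of t y] by simp
  have "ext_act h R ia s (ext_act h R ia t y)
      = ksign ((i + - 1) * (j + - 1)) *\<^sub>C ext_act h R ia t (ext_act h R ia s y)
        + ksign (i * - 1) *\<^sub>C ext_act h R (\<lambda>a x. 0) (ext_act g' R (Br g) s t) y"
    by (rule H.ext_act_bracket[where g = g' and br = "Br g"];
        (rule cbilinear_Br cbilinear_ia zero | (rule rel; assumption) | (rule ia_mem; simp) | simp add: grg st))
  then show ?thesis by (simp add: I_ext 0)
qed

lemma dE_L: "s \<in> A i \<Longrightarrow> dE (L s y) = L (dA s) y + ksign i *\<^sub>C L s (dE y)"
  unfolding dE_tmap dA_tmap
  using H.ext_act_dif[of "Dif h" m "\<lambda>a. m (Dif g a)" "Gr g" 0 s i y]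
    H.ext_act_fun_tmap[OF cbilinear_m clinear_Difg grg, of s y]
  by (simp add: cbilinear_m clinear_Difh Difh_mem Dif_m
      cbilinearI[OF cbilinearD(1)[OF cbilinear_m] cbilinear_comp1[OF cbilinear_m clinear_Difg]])

lemma dE_I: "s \<in> A i \<Longrightarrow> dE (I s y) = L s y - I (dA s) y - ksign i *\<^sub>C I s (dE y)"
proof -
  assume s: "s \<in> A i"
  have b: "cbilinear (\<lambda>a. ia (Dif g a))"
    by (rule cbilinearI[OF cbilinearD(1)[OF cbilinear_ia] cbilinear_comp1[OF cbilinear_ia clinear_Difg]])
  have b': "cbilinear (\<lambda>a x. m a x - ia (Dif g a) x)"
    by (intro cbilinearI clin cbilinearD[OF b] cbilinearD[OF cbilinear_m])
  show ?thesis
    unfolding dE_tmap dA_tmap I_ext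
    using H.ext_act_dif[OF clinear_Difh Difh_mem cbilinear_ia b' Dif_ia s, of y]
      H.ext_act_fun_tmap[OF cbilinear_ia clinear_Difg grg, of s y]
      H.ext_act_fun_diff[OF cbilinear_m b grg, of s y]
    by (simp add: ksign_diff)
qed

lemma V_L: "v \<in> Der_hom R k \<Longrightarrow> s \<in> A n \<Longrightarrow> V v (L s y) = L (W v s) y + ksign (k * n) *\<^sub>C L s (V v y)"
  unfolding W_dd
  using H.ext_act_dd[of v k m g' 0 s n y]
  by (simp add: cbilinear_m m_mem grg scaleC_one)

text \<open>The derivation passes the odd symbol \<xi> before it reaches \<open>s\<close>; this is
  the sign that the definition of \<open>nabla\<close> anticipates.\<close>

lemma V_I: "v \<in> Der_hom R k \<Longrightarrow> s \<in> A n \<Longrightarrow>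
    V v (I s y) = ksign k *\<^sub>C I (W v s) y + ksign (k * (n - 1)) *\<^sub>C I s (V v y)"
  unfolding W_dd I_ext
  using H.ext_act_dd[of v k ia g' "- 1" s n y]
  by (simp add: cbilinear_ia ia_mem[simplified] grg)

lemma V_dE: "v \<in> Der_hom R k \<Longrightarrow> V v (dE y) = ksign k *\<^sub>C dE (V v y)"
  unfolding dE_tmap
  using H.dd_tmap[of v k "Dif h" 1 y] H.Der_homD[of v k]
  by (simp add: clinear_Difh Difh_mem)

lemma R_scale_dE: "r \<in> Gr R i \<Longrightarrow> R_scale h R r (dE y) = ksign i *\<^sub>C dE (R_scale h R r y)"
  unfolding dE_tmap
  using H.R_scale_tmap[of r i "Dif h" 1 y] by (simp add: clinear_Difh Difh_mem)

lemma R_scale_L: "r \<in> Gr R i \<Longrightarrow> s \<in> A n \<Longrightarrow>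
    R_scale h R r (L s y) = ksign (i * n) *\<^sub>C L s (R_scale h R r y)"
  using H.ext_act_R_scale(1)[of r i m g' 0 s n y] by (simp add: cbilinear_m m_mem grg)

lemma R_scale_I: "r \<in> Gr R i \<Longrightarrow> s \<in> A n \<Longrightarrow>
    R_scale h R r (I s y) = ksign (i * (n - 1)) *\<^sub>C I s (R_scale h R r y)"
  unfolding I_ext
  using H.ext_act_R_scale(1)[of r i ia g' "- 1" s n y]
  by (simp add: cbilinear_ia ia_mem[simplified] grg)

lemma R_scale_I': "r \<in> Gr R i \<Longrightarrow>
    R_scale h R r (I s y) = ksign i *\<^sub>C I (R_scale g' R r s) y"
  unfolding I_ext
  using H.ext_act_R_scale(2)[of r i ia g' "- 1" s y]
  by (simp add: cbilinear_ia ia_mem[simplified] grg)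

end

section \<open>The connection on cochains\<close>

lemma ksign_cases: obtains "ksign k = 1" | "ksign k = - 1"
  by (cases "even k") (auto simp: ksign_def)

text \<open>Adds one homogeneous derivation at a time. Linearity of the partial sum is carried along
  because additivity of the operators in the vector field requires it.\<close>

lemma Der_induct [consumes 1, case_names zero add]:
  assumes v: "v \<in> Der R" and zero: "P (\<lambda>r. 0)"
    and add: "\<And>v w k. v \<in> Der_hom R k \<Longrightarrow> clinear w \<Longrightarrow> P w \<Longrightarrow> P (\<lambda>r. v r + w r)"
  shows "P v"
proof -
  obtain K w where K: "finite K" "\<forall>k\<in>K. w k \<in> Der_hom R k" and v: "v = (\<lambda>r. \<Sum>k\<in>K. w k r)"
    using v unfolding Der_def by blast
  have "P (\<lambda>r. \<Sum>k\<in>K. w k r) \<and> clinear (\<lambda>r. \<Sum>k\<in>K. w k r)"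
    using K
  proof (induction K rule: finite_induct)
    case empty
    then show ?case by (simp add: zero clinear_zero)
  next
    case (insert k K)
    then have "w k \<in> Der_hom R k" "clinear (w k)" by (auto simp: Der_hom_def)
    then show ?case using insert add[of "w k" k] by (simp add: clinear_plus)
  qed
  then show ?thesis by (simp add: v)
qed

lemma Der_clinear: "v \<in> Der R \<Longrightarrow> clinear v"
  by (induct v rule: Der_induct) (auto simp: Der_hom_def intro: clin)

context lie_algebra_artin
begin

lemma W_fun:
  "clinear v \<Longrightarrow> clinear w \<Longrightarrow> W (\<lambda>r. v r + w r) y = W v y + W w y"
  "clinear v \<Longrightarrow> W (\<lambda>r. c *\<^sub>C v r) y = c *\<^sub>C W v y"
  unfolding W_dd using G.dd_fun(1)[of v w y] G.dd_fun(2)[of v v c y] by auto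

lemma kos_op_fun:
  "kos_op (Gr R) j (\<lambda>r. v r + w r) = (\<lambda>r. kos_op (Gr R) j v r + kos_op (Gr R) j w r)"
  "kos_op (Gr R) j (\<lambda>r. c *\<^sub>C v r) = (\<lambda>r. c *\<^sub>C kos_op (Gr R) j v r)"
  by (auto simp: kos_op_def clinear_simps[OF clinear_par[OF grR]])

text \<open>The derivative of the Maurer-Cartan equation: \<gamma> is odd, so antisymmetry makes the
  two terms of the differentiated bracket equal, and the factor 1/2 disappears. Only degree and
  equation of \<gamma> are assumed, which is what a base-changed element provides.\<close>

lemma W_MC:
  assumes v: "v \<in> Der_hom R k" and \<gamma>: "\<gamma> \<in> A 1" "dA \<gamma> + (1/2) *\<^sub>C br \<gamma> \<gamma> = 0"
  shows "dA (W v \<gamma>) + br \<gamma> (W v \<gamma>) = 0"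
proof -
  note v' = G.Der_homD[OF v]
  have t: "W v \<gamma> \<in> A (1 + k)" by (rule W_mem[OF v'(1,2) \<gamma>(1)])
  have "W v (dA \<gamma> + (1/2) *\<^sub>C br \<gamma> \<gamma>)
      = ksign k *\<^sub>C dA (W v \<gamma>) + (1/2) *\<^sub>C (br (W v \<gamma>) \<gamma> + ksign k *\<^sub>C br \<gamma> (W v \<gamma>))"
    by (simp add: clinear_simps[OF clinear_W[OF v'(1)]] W_dA[OF v] W_br[OF v \<gamma>(1)])
  also have "br (W v \<gamma>) \<gamma> = ksign k *\<^sub>C br \<gamma> (W v \<gamma>)"
    using br_antisym[OF t \<gamma>(1)] by (simp add: ksign_add)
  also have "(1/2) *\<^sub>C (ksign k *\<^sub>C br \<gamma> (W v \<gamma>) + ksign k *\<^sub>C br \<gamma> (W v \<gamma>)) = ksign k *\<^sub>C br \<gamma> (W v \<gamma>)"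
    by (simp add: scaleC_add_right scaleC_scaleC flip: scaleC_add_left)
  finally have "ksign k *\<^sub>C (dA (W v \<gamma>) + br \<gamma> (W v \<gamma>)) = 0"
    using \<gamma>(2) by (simp add: clinear_0[OF clinear_W[OF v'(1)]] scaleC_add_right)
  moreover have "ksign k \<noteq> 0" by (simp add: ksign_def)
  ultimately show ?thesis using cvector.scale_eq_0_iff by blast
qed

end

context xi_module
begin

abbreviation "D \<equiv> D_op h m R"
abbreviation "N \<equiv> nabla g h mx R"

lemma D_eq: "D \<gamma> y = dE y + L \<gamma> y"
  by (simp add: D_op_def)

lemma clinear_D: "clinear (D \<gamma>)"
  unfolding D_op_def[abs_def]
  by (rule clinear_plus[OF clinear_dE cbilinearD(1)[OF cbilinear_L]])

lemma clinear_V: "clinear v \<Longrightarrow> clinear (V v)"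
  by (rule H.clinear_dd)

lemma clinear_N: "clinear v \<Longrightarrow> clinear (N \<gamma> v)"
  unfolding nabla_def[abs_def]
  by (rule clinear_plus[OF clinear_V cbilinearD(1)[OF cbilinear_I]])

lemmas I_simps = clinear_simps[OF cbilinearD(1)[OF cbilinear_I]]
  clinear_simps[OF cbilinearD(2)[OF cbilinear_I]]
lemmas L_simps = clinear_simps[OF cbilinearD(1)[OF cbilinear_L]]
  clinear_simps[OF cbilinearD(2)[OF cbilinear_L]]

text \<open>Phrased for homogeneous linear maps so that it applies directly to graded brackets and
  to multiples r v of derivations.\<close>

lemma N_hom:
  assumes v: "clinear v" "\<And>i r. r \<in> Gr R i \<Longrightarrow> v r \<in> Gr R (i + k)"
  shows "N \<gamma> v y = V v y + ksign k *\<^sub>C I (W v \<gamma>) y"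
proof -
  have "kos_op (Gr R) (- 1) v = (\<lambda>r. ksign (k * - 1) *\<^sub>C v r)"
    by (rule kos_op_hom[OF grR v])
  then show ?thesis using v(1) by (simp add: nabla_def W_fun I_simps)
qed

lemma N_Der_hom: "v \<in> Der_hom R k \<Longrightarrow> N \<gamma> v y = V v y + ksign k *\<^sub>C I (W v \<gamma>) y"
  by (rule N_hom) (auto dest: H.Der_homD)

lemma N_fun:
  assumes "clinear v" "clinear w"
  shows "N \<gamma> (\<lambda>r. v r + w r) y = N \<gamma> v y + N \<gamma> w y" "N \<gamma> (\<lambda>r. c *\<^sub>C v r) y = c *\<^sub>C N \<gamma> v y"
  unfolding nabla_def kos_op_fun using assms
  by (simp_all add: W_fun clinear_kos_op grR H.dd_fun I_simps scaleC_add_right)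

lemma N_zero: "N \<gamma> (\<lambda>r. 0) y = 0"
  using N_fun(2)[OF clinear_ident clinear_ident, of \<gamma> 0 y] by simp

text \<open>The term \<open>L t\<close> in the commutator of d with \<open>I t\<close> cancels the
  one from differentiating \<open>L \<gamma>\<close>. What remains is \<open>I\<close> applied to
  the differentiated Maurer-Cartan equation \<open>W_MC\<close>.\<close>

lemma D_N:
  assumes v: "v \<in> Der_hom R k" and \<gamma>: "\<gamma> \<in> A 1" "dA \<gamma> + (1/2) *\<^sub>C br \<gamma> \<gamma> = 0"
  shows "D \<gamma> (N \<gamma> v y) = ksign k *\<^sub>C N \<gamma> v (D \<gamma> y)"
proof -
  note v' = H.Der_homD[OF v]
  define t where "t = W v \<gamma>"
  have t: "t \<in> A (1 + k)" unfolding t_def by (rule W_mem[OF v'(1,2) \<gamma>(1)])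
  have "dA t = - br \<gamma> t" using W_MC[OF v \<gamma>] by (simp add: t_def add_eq_0_iff2)
  moreover have "dE (V v y) = ksign k *\<^sub>C V v (dE y)"
    using V_dE[OF v, of y] by (simp add: scaleC_scaleC)
  moreover have "L \<gamma> (V v y) = ksign k *\<^sub>C (V v (L \<gamma> y) - L t y)"
    using V_L[OF v \<gamma>(1), of y] by (simp add: t_def scaleC_scaleC)
  ultimately show ?thesis
    using dE_I[OF t, of y] L_I[OF \<gamma>(1) t, of y]
    by (cases rule: ksign_cases[of k])
      (simp_all add: D_eq N_Der_hom[OF v] ksign_add I_simps L_simps clinear_simps[OF clinear_dE]
        clinear_simps[OF clinear_V[OF v'(1)]] scaleC_one flip: t_def)
qed

text \<open>The two operators \<open>I\<close> graded-commute by \<open>I_I\<close>. In the mixed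
  terms the second derivatives of \<gamma> combine into its derivative along the graded
  bracket.\<close>

lemma N_N:
  assumes v: "v \<in> Der_hom R k" and w: "w \<in> Der_hom R l" and \<gamma>: "\<gamma> \<in> A 1"
  shows "N \<gamma> v (N \<gamma> w y) - ksign (k * l) *\<^sub>C N \<gamma> w (N \<gamma> v y) = N \<gamma> (der_bracket k l v w) y"
proof -
  note v' = H.Der_homD[OF v] and w' = H.Der_homD[OF w]
  have lin: "clinear (\<lambda>r. v (w r))" "clinear (\<lambda>r. w (v r))"
    by (rule clinear_comp[OF v'(1) w'(1)], rule clinear_comp[OF w'(1) v'(1)])
  have br: "der_bracket k l v w = (\<lambda>r. v (w r) + (- ksign (k * l)) *\<^sub>C w (v r))"
    by (simp add: der_bracket_def)
  have br_lin: "clinear (der_bracket k l v w)"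
    unfolding br by (intro clinear_plus clinear_scaleC lin)
  have br_mem: "der_bracket k l v w r \<in> Gr R (i + (k + l))" if r: "r \<in> Gr R i" for i r
    using v'(2)[OF w'(2)[OF r]] w'(2)[OF v'(2)[OF r]] unfolding br
    by (auto intro!: grading_closed[OF grR] simp: ac_simps)
  have Vbr: "V (der_bracket k l v w) y = V v (V w y) - ksign (k * l) *\<^sub>C V w (V v y)" for y
    unfolding br
    by (simp add: H.dd_fun(1)[OF lin(1) clinear_scaleC[OF lin(2)]] H.dd_fun(2)[OF lin(2) lin(2)]
        H.dd_comp v'(1) w'(1) del: cvector.scale_minus_left) simp
  have Wbr: "W (der_bracket k l v w) y = W v (W w y) - ksign (k * l) *\<^sub>C W w (W v y)" for y
    unfolding br W_dd
    by (simp add: G.dd_fun(1)[OF lin(1) clinear_scaleC[OF lin(2)]] G.dd_fun(2)[OF lin(2) lin(2)]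
        G.dd_comp v'(1) w'(1) del: cvector.scale_minus_left) simp
  have s: "W v \<gamma> \<in> A (1 + k)" by (rule W_mem[OF v'(1,2) \<gamma>])
  have t: "W w \<gamma> \<in> A (1 + l)" by (rule W_mem[OF w'(1,2) \<gamma>])
  have Nbr: "N \<gamma> (der_bracket k l v w) y
      = V (der_bracket k l v w) y + ksign (k + l) *\<^sub>C I (W (der_bracket k l v w) \<gamma>) y" for y
    by (rule N_hom[OF br_lin br_mem])
  \<comment> \<open>Expresses the sign of a product through those of its factors, so that four cases
    determine every sign below.\<close>
  have kl: "ksign (k * l) = (if ksign k = - 1 \<and> ksign l = - 1 then - 1 else 1)"
    by (auto simp: ksign_def)
  show ?thesis
    unfolding N_Der_hom[OF v] N_Der_hom[OF w] Nbr Vbr Wbr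
    by (cases rule: ksign_cases[of k]; cases rule: ksign_cases[of l])
      (simp_all add: V_I[OF v t] V_I[OF w s] I_I[OF s t] kl ksign_add I_simps clinear_simps[OF clinear_V[OF v'(1)]]
        clinear_simps[OF clinear_V[OF w'(1)]] scaleC_one mult.commute algebra_simps)
qed

text \<open>The derivative of \<gamma> has degree 1 + k, so \<open>I\<close> of it has degree
  \<open>k\<close> like the derivation itself, and \<open>r\<close> passes both at the same
  cost.\<close>

lemma N_R_scale:
  assumes v: "v \<in> Der_hom R k" and \<gamma>: "\<gamma> \<in> A 1" and r: "r \<in> Gr R i"
  shows "N \<gamma> v (R_scale h R r y)
    = R_scale h R (v r) y + R_scale h R (ksign (k * i) *\<^sub>C r) (N \<gamma> v y)"
proof -
  note v' = H.Der_homD[OF v]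
  have t: "W v \<gamma> \<in> A (1 + k)" by (rule W_mem[OF v'(1,2) \<gamma>])
  show ?thesis
    unfolding N_Der_hom[OF v]
    by (simp add: H.dd_R_scale[OF v r] R_scale_I[OF r t] clinear_simps[OF H.clinear_R_scale]
        clinear_simps[OF H.clinear_R_scale_fun] scaleC_add_right scaleC_scaleC mult_ac)
qed

text \<open>For homogeneous \<open>r\<close> of degree i, the map r v has degree i + k. Taking
  \<open>r\<close> out of \<open>I\<close> uses up the sign of i and leaves the sign of
  \<open>k\<close> belonging to \<open>v\<close>.\<close>

lemma N_Mul:
  assumes v: "v \<in> Der R"
  shows "N \<gamma> (\<lambda>s. Mul R r (v s)) y = R_scale h R r (N \<gamma> v y)"
  using v
proof (induct v rule: Der_induct)
  case zero
  show ?case by (simp add: H.Mul_simps N_zero clinear_0[OF H.clinear_R_scale])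
next
  case (add v w k)
  note v' = H.Der_homD[OF add(1)]
  have lin: "clinear (\<lambda>s. Mul R r (v s))" for r
    by (rule cbilinear_comp2[OF cbilinear_Mul v'(1)])
  have "N \<gamma> (\<lambda>s. Mul R r (v s)) y = R_scale h R r (N \<gamma> v y)"
  proof (induct r rule: hom_induct[OF grR])
    case 1
    have "clinear (\<lambda>r. N \<gamma> (\<lambda>s. Mul R r (v s)) y)"
      by (rule clinearI) (simp_all add: H.Mul_simps N_fun[OF lin lin])
    then show ?case by (rule subspace_eq[OF _ H.clinear_R_scale_fun])
  next
    case (2 i r)
    have mem: "Mul R r (v s) \<in> Gr R (j + (i + k))" if "s \<in> Gr R j" for s j
      using Mul_mem[OF 2 v'(2)[OF that]] by (simp add: ac_simps)
    have NM: "N \<gamma> (\<lambda>s. Mul R r (v s)) y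
        = V (\<lambda>s. Mul R r (v s)) y + ksign (i + k) *\<^sub>C I (W (\<lambda>s. Mul R r (v s)) \<gamma>) y"
      by (rule N_hom[OF lin mem])
    have "W (\<lambda>s. Mul R r (v s)) \<gamma> = R_scale g' R r (W v \<gamma>)"
      unfolding W_dd by (rule G.dd_Mul[OF add(1) 2])
    then show ?case
      unfolding N_Der_hom[OF add(1)] NM
      by (simp add: H.dd_Mul[OF add(1) 2] clinear_simps[OF H.clinear_R_scale] R_scale_I'[OF 2]
          scaleC_scaleC ksign_add mult_ac)
  qed
  then show ?case
    using add by (simp add: H.Mul_simps N_fun(1)[OF v'(1) add(2)] clinear_add[OF H.clinear_R_scale]
        N_fun(1)[OF lin cbilinear_comp2[OF cbilinear_Mul add(2)]])
qed

text \<open>\<open>D\<close> is odd, so passing it costs the sign of the degree of \<open>r\<close>;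
  for inhomogeneous \<open>r\<close> that sign is the parity involution.\<close>

lemma D_R_scale:
  assumes \<gamma>: "\<gamma> \<in> A 1"
  shows "D \<gamma> (R_scale h R r y) = R_scale h R (par (Gr R) r) (D \<gamma> y)"
proof (induct r rule: hom_induct[OF grR])
  case 1
  show ?case
    by (rule subspace_eq[OF clinear_comp[OF clinear_D H.clinear_R_scale_fun]
          clinear_comp[OF H.clinear_R_scale_fun clinear_par[OF grR]]])
next
  case (2 i r)
  have "R_scale h R r (D \<gamma> y) = ksign i *\<^sub>C D \<gamma> (R_scale h R r y)"
    using R_scale_dE[OF 2, of y] R_scale_L[OF 2 \<gamma>, of y]
    by (simp add: D_eq clinear_add[OF H.clinear_R_scale] scaleC_add_right)
  then show ?case
    by (simp add: par_hom[OF grR 2] clinear_scale[OF H.clinear_R_scale_fun] scaleC_scaleC)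
qed

lemma R_scale_D:
  "\<gamma> \<in> A 1 \<Longrightarrow> R_scale h R r (D \<gamma> y) = D \<gamma> (R_scale h R (par (Gr R) r) y)"
  by (simp add: D_R_scale par_par[OF grR])

text \<open>\<open>T\<close> is the sum of the operators of the homogeneous parts of
  \<open>v\<close>, each with its own sign. The first equation together with \<open>T 0 = 0\<close>
  preserves cocycles, the second preserves coboundaries.\<close>

lemma D_N_Der:
  assumes v: "v \<in> Der R" and \<gamma>: "\<gamma> \<in> A 1" "dA \<gamma> + (1/2) *\<^sub>C br \<gamma> \<gamma> = 0"
  obtains T where "T 0 = 0" "\<And>y. D \<gamma> (N \<gamma> v y) = T (D \<gamma> y)" "\<And>y. N \<gamma> v (D \<gamma> y) = D \<gamma> (T y)"
proof -
  have "\<exists>T. T 0 = 0 \<and> (\<forall>y. D \<gamma> (N \<gamma> v y) = T (D \<gamma> y) \<and> N \<gamma> v (D \<gamma> y) = D \<gamma> (T y))"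
    using v
  proof (induct v rule: Der_induct)
    case zero
    show ?case by (rule exI[of _ "\<lambda>_. 0"]) (simp add: N_zero clinear_0[OF clinear_D])
  next
    case (add v w k)
    note v' = H.Der_homD[OF add(1)]
    obtain T where T: "T 0 = 0" "\<And>y. D \<gamma> (N \<gamma> w y) = T (D \<gamma> y)" "\<And>y. N \<gamma> w (D \<gamma> y) = D \<gamma> (T y)"
      using add(3) by blast
    show ?case
      by (rule exI[of _ "\<lambda>y. ksign k *\<^sub>C N \<gamma> v y + T y"])
        (simp add: N_fun(1)[OF v'(1) add(2)] T D_N[OF add(1) \<gamma>] clinear_simps[OF clinear_D]
          clinear_0[OF clinear_N[OF v'(1)]] scaleC_scaleC)
  qed
  then show thesis using that by blast
qed

end

section \<open>Gauge transformations\<close>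

text \<open>\<open>B\<close> will be a differential or a derivation, while its commutators
  \<open>T n\<close> with \<open>X\<close> are actions of Lie algebra elements. Listing
  \<open>B\<close> in front of the \<open>T n\<close> shifts the index, which turns the exponential
  series of ad X into that of (e^ad - 1) / ad.\<close>

lemma op_exp_shift:
  fixes X :: "'a::cvector \<Rightarrow> 'a"
  assumes X: "clinear X" and K: "\<forall>n\<ge>K. \<forall>y. (X ^^ n) y = 0"
    and B: "\<And>y. X (B y) = B (X y) + T 0 y" "clinear B"
    and T: "\<And>n y. X (T n y) = T n (X y) + T (Suc n) y" "\<And>n. clinear (T n)"
      "\<And>n y. n \<ge> M \<Longrightarrow> T n y = 0"
  shows "op_exp X (B y) = B (op_exp X y) + (\<Sum>n<M. inverse (fact (Suc n)) *\<^sub>C T n (op_exp X y))"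
proof -
  have "op_exp X (case_nat B T 0 y)
      = (\<Sum>k<Suc M. inverse (fact k) *\<^sub>C case_nat B T k (op_exp X y))"
  proof (rule op_exp_conj[OF X K])
    show "X (case_nat B T n y) = case_nat B T n (X y) + case_nat B T (Suc n) y" for n y
      by (cases n) (simp_all add: B T)
    show "clinear (case_nat B T n)" for n by (cases n) (simp_all add: B T)
    show "case_nat B T n y = 0" if "n \<ge> Suc M" for n y using that by (cases n) (simp_all add: T)
  qed
  then show ?thesis by (simp add: sum.lessThan_Suc_shift scaleC_one del: sum.lessThan_Suc)
qed

context lie_algebra_artin
begin

lemma funpow_br_mem: "\<alpha> \<in> A 0 \<Longrightarrow> t \<in> A n \<Longrightarrow> (br \<alpha> ^^ k) t \<in> A n"
  by (induction k) (use br_mem[of \<alpha> 0] in auto)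

text \<open>\<open>(e\<^bsup>ad \<alpha>\<^esup> - 1) / ad \<alpha>\<close>, provided that \<open>(ad \<alpha>)\<^sup>K = 0\<close>.\<close>

definition phi :: "nat \<Rightarrow> ('g, 'r) tensor \<Rightarrow> ('g, 'r) tensor \<Rightarrow> ('g, 'r) tensor"
  where "phi K \<alpha> t = (\<Sum>n<K. inverse (fact (Suc n)) *\<^sub>C (br \<alpha> ^^ n) t)"

lemma clinear_br: "clinear (br \<alpha>)"
  by (rule cbilinearD(1)[OF cbilinear_br])

lemma clinear_phi: "clinear (phi K \<alpha>)"
  unfolding phi_def[abs_def] by (intro clinear_setsum clinear_scaleC clinear_funpow clinear_br)

lemma phi_mem: "\<alpha> \<in> A 0 \<Longrightarrow> t \<in> A n \<Longrightarrow> phi K \<alpha> t \<in> A n"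
  unfolding phi_def by (auto intro!: tensor_gr_closed funpow_br_mem)

lemma op_exp_phi:
  assumes K: "\<forall>n\<ge>K. \<forall>y. (br \<alpha> ^^ n) y = 0"
  shows "op_exp (br \<alpha>) t = t + phi K \<alpha> (br \<alpha> t)"
proof -
  have "op_exp (br \<alpha>) t = (\<Sum>n<Suc K. inverse (fact n) *\<^sub>C (br \<alpha> ^^ n) t)"
    by (rule op_exp_eq) (use K in simp)
  then show ?thesis
    by (simp add: sum.lessThan_Suc_shift phi_def scaleC_one funpow_swap1 del: sum.lessThan_Suc)
qed

text \<open>Both series of the gauge action become one value of \<open>phi\<close>, at the element
  whose action is the commutator of \<open>L \<alpha>\<close> with
  \<open>D \<gamma>\<close>.\<close>

lemma gauge_phi:
  assumes K: "\<forall>n\<ge>K. \<forall>y. (br \<alpha> ^^ n) y = 0"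
  shows "gauge g R \<alpha> \<gamma> = \<gamma> + phi K \<alpha> (br \<alpha> \<gamma> - dA \<alpha>)"
proof -
  have "fin_sum (\<lambda>n. inverse (fact (n + 1)) *\<^sub>C (br \<alpha> ^^ n) (dA \<alpha>)) = phi K \<alpha> (dA \<alpha>)"
    using K by (subst fin_sum_eq[of K]) (simp_all add: phi_def)
  then show ?thesis
    using op_exp_phi[OF K, of \<gamma>]
    by (simp add: gauge_def Let_def tensor_dgl_def op_exp_def clinear_diff[OF clinear_phi])
qed

text \<open>The Lie algebra is extended by an element acting as the differential; in this extension
  the gauge action is the adjoint action on \<open>\<gamma> + d\<close>, here the pair \<open>(\<gamma>, 1)\<close>.\<close>

lemma W_gauge:
  assumes v: "v \<in> Der_hom R k" and \<alpha>: "\<alpha> \<in> A 0" and K: "\<forall>n\<ge>K. \<forall>y. (br \<alpha> ^^ n) y = 0"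
    and \<beta>: "\<beta> = phi K \<alpha> (W v \<alpha>)"
  shows "W v (gauge g R \<alpha> \<gamma>)
    = op_exp (br \<alpha>) (W v \<gamma>) + br \<beta> (gauge g R \<alpha> \<gamma>) - ksign k *\<^sub>C dA \<beta>"
proof -
  note v' = G.Der_homD[OF v]
  \<comment> \<open>With d adjoined, \<open>X\<close> is ad \<alpha>, where [\<alpha>, d] = -
    d\<alpha>, and \<open>B\<close> differentiates along \<open>v\<close>. Their commutator is - ad
    (\<partial>\<alpha>/\<partial>v), and \<open>T n\<close> is - ad (b n), the second component of
    a pair being the coefficient of d.\<close>
  define X where "X u = (br \<alpha> (fst u) - snd u *\<^sub>C dA \<alpha>, 0 :: complex)" for u :: "('g, 'r) tensor \<times> complex"
  define B where "B u = (W v (fst u), 0 :: complex)" for u :: "('g, 'r) tensor \<times> complex"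
  define b where "b n = (br \<alpha> ^^ n) (W v \<alpha>)" for n
  define T where "T n u = (snd u *\<^sub>C ksign k *\<^sub>C dA (b n) - br (b n) (fst u), 0 :: complex)"
    for n and u :: "('g, 'r) tensor \<times> complex"
  have b: "b n \<in> A k" for n
    using funpow_br_mem[OF \<alpha> W_mem[OF v'(1,2) \<alpha>]] by (simp add: b_def)
  note lins = clinear_simps[OF clinear_br] clinear_simps[OF clinear_dA]
    clinear_simps[OF clinear_W[OF v'(1)]]
  have X_lin: "clinear X"
    by (rule clinearI) (auto simp: X_def lins scaleC_add_left scaleC_scaleC scaleC_prod_def
        cvector.scale_right_diff_distrib scaleC_complex_def algebra_simps)
  have B_lin: "clinear B"
    by (rule clinearI) (auto simp: B_def lins scaleC_prod_def)
  have T_lin: "clinear (T n)" for n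
    by (rule clinearI) (auto simp: T_def lins scaleC_add_left scaleC_scaleC scaleC_prod_def
        cvector.scale_right_diff_distrib scaleC_complex_def algebra_simps)
  have X_pow: "(X ^^ Suc n) u = ((br \<alpha> ^^ n) (br \<alpha> (fst u) - snd u *\<^sub>C dA \<alpha>), 0)" for n u
    by (induction n) (simp_all add: X_def)
  \<comment> \<open>The first application of \<open>X\<close> only clears the coefficient of d;
    nilpotency of ad \<alpha> takes \<open>K\<close> further ones.\<close>
  have XK: "\<forall>n\<ge>Suc K. \<forall>y. (X ^^ n) y = 0"
  proof (intro allI impI)
    fix n y assume "n \<ge> Suc K"
    then obtain n' where "n = Suc n'" "n' \<ge> K" by (cases n) auto
    then show "(X ^^ n) y = 0" using K by (simp only: X_pow zero_prod_def)
  qed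
  have X_exp: "op_exp X u = (fst u + phi K \<alpha> (br \<alpha> (fst u) - snd u *\<^sub>C dA \<alpha>), snd u)" for u
  proof -
    have "op_exp X u = (\<Sum>n<Suc K. inverse (fact n) *\<^sub>C (X ^^ n) u)" by (rule op_exp_eq[OF XK])
    also have "\<dots> = u + (\<Sum>n<K. inverse (fact (Suc n)) *\<^sub>C (X ^^ Suc n) u)"
      by (simp add: sum.lessThan_Suc_shift scaleC_one del: sum.lessThan_Suc funpow.simps)
    also have "\<dots> = (fst u + phi K \<alpha> (br \<alpha> (fst u) - snd u *\<^sub>C dA \<alpha>), snd u)"
      unfolding X_pow
      by (simp add: prod_eq_iff fst_sum snd_sum scaleC_prod_def phi_def)
    finally show ?thesis .
  qed
  have XB: "X (B u) = B (X u) + T 0 u" for u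
    using W_br[OF v \<alpha>, of "fst u"] W_dA[OF v, of \<alpha>]
    by (simp add: X_def B_def T_def b_def lins scaleC_one)
  have XT: "X (T n u) = T n (X u) + T (Suc n) u" for n u
  proof -
    have s: "br \<alpha> (b n) = b (Suc n)" by (simp add: b_def)
    have anti: "br (dA \<alpha>) (b n) = - (ksign k *\<^sub>C br (b n) (dA \<alpha>))"
      using br_antisym[OF dA_mem[OF \<alpha>] b, of n] by simp
    have 1: "br \<alpha> (br (b n) (fst u)) = br (b n) (br \<alpha> (fst u)) + br (b (Suc n)) (fst u)"
      using br_jacobi[OF \<alpha> b, of n "fst u"] by (simp add: s scaleC_one)
    have 2: "dA (b (Suc n)) = br \<alpha> (dA (b n)) - ksign k *\<^sub>C br (b n) (dA \<alpha>)"
      using dA_br[OF \<alpha>, of "b n"] by (simp add: s scaleC_one anti)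
    show ?thesis
      by (simp add: X_def T_def 1 2 lins scaleC_scaleC cvector.scale_right_diff_distrib algebra_simps)
  qed
  have TK: "T n u = 0" if "n \<ge> K" for n u
    using K that
    by (simp add: T_def b_def zero_prod_def lins clinear_0[OF cbilinearD(2)[OF cbilinear_br]])
  \<comment> \<open>Evaluated at \<gamma> + d, whose image under the exponential is the gauge
    transform plus d.\<close>
  have "op_exp X (B (\<gamma>, 1)) = B (op_exp X (\<gamma>, 1))
      + (\<Sum>n<K. inverse (fact (Suc n)) *\<^sub>C T n (op_exp X (\<gamma>, 1)))"
    by (rule op_exp_shift[OF X_lin XK XB B_lin XT T_lin TK])
  moreover have "op_exp X (\<gamma>, 1) = (gauge g R \<alpha> \<gamma>, 1)"
    by (simp add: X_exp gauge_phi[OF K] scaleC_one)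
  moreover have "op_exp X (B (\<gamma>, 1)) = (op_exp (br \<alpha>) (W v \<gamma>), 0)"
    by (simp add: X_exp B_def op_exp_phi[OF K])
  ultimately have "op_exp (br \<alpha>) (W v \<gamma>) = W v (gauge g R \<alpha> \<gamma>)
      + (\<Sum>n<K. inverse (fact (Suc n)) *\<^sub>C (ksign k *\<^sub>C dA (b n) - br (b n) (gauge g R \<alpha> \<gamma>)))"
    by (simp add: prod_eq_iff fst_sum scaleC_prod_def B_def T_def scaleC_one)
  also have "(\<Sum>n<K. inverse (fact (Suc n)) *\<^sub>C (ksign k *\<^sub>C dA (b n) - br (b n) (gauge g R \<alpha> \<gamma>)))
      = ksign k *\<^sub>C dA \<beta> - br \<beta> (gauge g R \<alpha> \<gamma>)"
    by (simp add: \<beta> phi_def b_def lins clinear_simps[OF cbilinearD(2)[OF cbilinear_br]]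
        cvector.scale_right_diff_distrib cvector.scale_sum_right sum_subtractf scaleC_scaleC mult_ac)
  finally show ?thesis by simp
qed

end

context xi_module
begin

text \<open>Used for \<open>D\<close> and for the derivation along \<open>v\<close>: both commute
  with \<open>L \<alpha>\<close> up to the action of an algebra element \<open>c\<close>, and
  further commutators stay among such actions.\<close>

lemma exp_L_shift:
  assumes \<alpha>: "\<alpha> \<in> A 0" and K: "\<forall>n\<ge>K. \<forall>y. (br \<alpha> ^^ n) y = 0" "\<forall>n\<ge>K. \<forall>y. (L \<alpha> ^^ n) y = 0"
    and B: "clinear B" "\<And>y. L \<alpha> (B y) = B (L \<alpha> y) + L c y" and c: "c \<in> A n"
  shows "op_exp (L \<alpha>) (B y) = B (op_exp (L \<alpha>) y) + L (phi K \<alpha> c) (op_exp (L \<alpha>) y)"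
proof -
  define T where "T n = L ((br \<alpha> ^^ n) c)" for n
  have "op_exp (L \<alpha>) (B y) = B (op_exp (L \<alpha>) y)
      + (\<Sum>n<K. inverse (fact (Suc n)) *\<^sub>C T n (op_exp (L \<alpha>) y))"
  proof (rule op_exp_shift[OF cbilinearD(1)[OF cbilinear_L] K(2) _ B(1)])
    show "L \<alpha> (B y) = B (L \<alpha> y) + T 0 y" for y by (simp add: B T_def)
    show "L \<alpha> (T n y) = T n (L \<alpha> y) + T (Suc n) y" for n y
      using L_L[OF \<alpha> funpow_br_mem[OF \<alpha> c], of n y] by (simp add: T_def scaleC_one)
    show "clinear (T n)" for n unfolding T_def by (rule cbilinearD(1)[OF cbilinear_L])
    show "T n y = 0" if "n \<ge> K" for n y using K(1) that by (simp add: T_def L_simps)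
  qed
  then show ?thesis by (simp add: T_def phi_def L_simps)
qed

text \<open>As \<alpha> has degree 0, nested commutators of \<open>L \<alpha>\<close> with
  \<open>I t\<close> produce \<open>I ((br \<alpha> ^^ n) t)\<close> without signs.\<close>

lemma exp_L_I:
  assumes \<alpha>: "\<alpha> \<in> A 0" and K: "\<forall>n\<ge>K. \<forall>y. (br \<alpha> ^^ n) y = 0" "\<forall>n\<ge>K. \<forall>y. (L \<alpha> ^^ n) y = 0"
    and t: "t \<in> A n"
  shows "op_exp (L \<alpha>) (I t y) = I (op_exp (br \<alpha>) t) (op_exp (L \<alpha>) y)"
proof -
  define T where "T n = I ((br \<alpha> ^^ n) t)" for n
  have "op_exp (L \<alpha>) (T 0 y) = (\<Sum>n<K. inverse (fact n) *\<^sub>C T n (op_exp (L \<alpha>) y))"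
  proof (rule op_exp_conj[OF cbilinearD(1)[OF cbilinear_L] K(2)])
    show "L \<alpha> (T n y) = T n (L \<alpha> y) + T (Suc n) y" for n y
      using L_I[OF \<alpha> funpow_br_mem[OF \<alpha> t], of n y] by (simp add: T_def scaleC_one)
    show "clinear (T n)" for n unfolding T_def by (rule cbilinearD(1)[OF cbilinear_I])
    show "T n y = 0" if "n \<ge> K" for n y using K(1) that by (simp add: T_def I_simps)
  qed
  then show ?thesis by (simp add: T_def op_exp_eq[OF K(1)] I_simps)
qed

lemma nilpotent:
  assumes "\<alpha> \<in> gM g R 0"
  obtains K where "\<forall>n\<ge>K. \<forall>y. (br \<alpha> ^^ n) y = 0" "\<forall>n\<ge>K. \<forall>y. (L \<alpha> ^^ n) y = 0"
proof -
  have \<alpha>: "\<alpha> \<in> tensor_gr (Gr g) (\<lambda>j. Gr R j \<inter> max_ideal R) 0" using assms by (simp add: gM_def)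
  have g': "grading (Gr g')" by (simp add: grg)
  obtain K1 where K1: "\<forall>n\<ge>K1. \<forall>y. (br \<alpha> ^^ n) y = 0"
    unfolding br_ext using ext_act_nilpotent[OF artin g'] cbilinear_Br \<alpha> by metis
  obtain K2 where K2: "\<forall>n\<ge>K2. \<forall>y. (L \<alpha> ^^ n) y = 0"
    using ext_act_nilpotent[OF artin grh] cbilinear_m \<alpha> by metis
  show thesis by (rule that[of "max K1 K2"]) (use K1 K2 in auto)
qed

text \<open>The element \<open>t\<close> in the last claim is \<open>((e\<^bsup>ad \<alpha>\<^esup> - 1) / ad \<alpha>) (\<partial>\<alpha>/\<partial>v)\<close>: conjugation by \<open>e\<^sup>\<alpha>\<close>
  changes \<open>\<nabla>\<close> by the graded commutator of \<open>D\<close> with \<open>I t\<close>, which vanishes on cohomology.\<close>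

lemma exp_D:
  assumes mor: "gauge_mor g R \<alpha> \<gamma>\<^sub>1 \<gamma>\<^sub>2"
  shows "op_exp (L \<alpha>) (D \<gamma>\<^sub>1 y) = D \<gamma>\<^sub>2 (op_exp (L \<alpha>) y)"
    and "clinear (op_exp (L \<alpha>))"
    and "v \<in> Der_hom R k \<Longrightarrow> \<exists>t. op_exp (L \<alpha>) (N \<gamma>\<^sub>1 v y)
      = N \<gamma>\<^sub>2 v (op_exp (L \<alpha>) y) - D \<gamma>\<^sub>2 (I t (op_exp (L \<alpha>) y))
        - ksign k *\<^sub>C I t (D \<gamma>\<^sub>2 (op_exp (L \<alpha>) y))"
proof -
  have gM: "\<alpha> \<in> gM g R 0" and \<gamma>1: "\<gamma>\<^sub>1 \<in> A 1" and \<gamma>2: "\<gamma>\<^sub>2 \<in> A 1"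
    and \<gamma>2_eq: "gauge g R \<alpha> \<gamma>\<^sub>1 = \<gamma>\<^sub>2"
    using mor MC_mem by (auto simp: gauge_mor_def)
  have \<alpha>: "\<alpha> \<in> A 0" by (rule gM_mem[OF gM])
  obtain K where K: "\<forall>n\<ge>K. \<forall>y. (br \<alpha> ^^ n) y = 0" "\<forall>n\<ge>K. \<forall>y. (L \<alpha> ^^ n) y = 0"
    using nilpotent[OF gM] by blast
  show lin: "clinear (op_exp (L \<alpha>))"
    by (rule clinear_op_exp[OF cbilinearD(1)[OF cbilinear_L] K(2)])
  let ?Q = "op_exp (L \<alpha>)"
  have dA\<alpha>: "dA \<alpha> \<in> A 1" using dA_mem[OF \<alpha>] by simp
  \<comment> \<open>By \<open>gauge_phi\<close>, \<open>phi\<close> sends this commutator element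
    exactly to the difference of the two Maurer-Cartan elements.\<close>
  have "L \<alpha> (D \<gamma>\<^sub>1 y) = D \<gamma>\<^sub>1 (L \<alpha> y) + L (br \<alpha> \<gamma>\<^sub>1 - dA \<alpha>) y" for y
    using dE_L[OF \<alpha>, of y] L_L[OF \<alpha> \<gamma>1, of y] by (simp add: D_eq L_simps scaleC_one)
  moreover have "br \<alpha> \<gamma>\<^sub>1 - dA \<alpha> \<in> A 1"
    using br_mem[OF \<alpha> \<gamma>1] dA\<alpha> by (simp add: tensor_gr_closed)
  ultimately show "?Q (D \<gamma>\<^sub>1 y) = D \<gamma>\<^sub>2 (?Q y)"
    using exp_L_shift[OF \<alpha> K clinear_D, of \<gamma>\<^sub>1 "br \<alpha> \<gamma>\<^sub>1 - dA \<alpha>" 1 y] gauge_phi[OF K(1), of \<gamma>\<^sub>1] \<gamma>2_eq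
    by (simp add: D_eq L_simps)
  show "\<exists>t. ?Q (N \<gamma>\<^sub>1 v y) = N \<gamma>\<^sub>2 v (?Q y) - D \<gamma>\<^sub>2 (I t (?Q y)) - ksign k *\<^sub>C I t (D \<gamma>\<^sub>2 (?Q y))"
    if v: "v \<in> Der_hom R k"
  proof -
    note v' = H.Der_homD[OF v]
    define \<beta> where "\<beta> = phi K \<alpha> (W v \<alpha>)"
    have W\<alpha>: "W v \<alpha> \<in> A k" using W_mem[OF v'(1,2) \<alpha>] by simp
    have \<beta>: "\<beta> \<in> A k" unfolding \<beta>_def by (rule phi_mem[OF \<alpha> W\<alpha>])
    \<comment> \<open>The commutator is minus the action of \<partial>\<alpha>/\<partial>v; summing
      the series replaces it by minus that of \<beta>.\<close>
    have "L \<alpha> (V v y) = V v (L \<alpha> y) + L (- W v \<alpha>) y" for y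
      using V_L[OF v \<alpha>, of y] by (simp add: L_simps scaleC_one)
    then have QV: "?Q (V v y) = V v (?Q y) - L \<beta> (?Q y)"
      using exp_L_shift[OF \<alpha> K clinear_V[OF v'(1)], of "- W v \<alpha>" k y] W\<alpha>
      by (simp add: tensor_gr_closed L_simps \<beta>_def clinear_neg[OF clinear_phi])
    have QI: "?Q (I (W v \<gamma>\<^sub>1) y) = I (op_exp (br \<alpha>) (W v \<gamma>\<^sub>1)) (?Q y)"
      by (rule exp_L_I[OF \<alpha> K W_mem[OF v'(1,2) \<gamma>1]])
    have "br \<beta> \<gamma>\<^sub>2 = - (ksign k *\<^sub>C br \<gamma>\<^sub>2 \<beta>)"
      using br_antisym[OF \<beta> \<gamma>2] by simp
    \<comment> \<open>\<open>W_gauge\<close> solved for the conjugated derivative; antisymmetry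
      brings the bracket into the form in which \<open>L_I\<close> produces it.\<close>
    then have eW: "op_exp (br \<alpha>) (W v \<gamma>\<^sub>1) = W v \<gamma>\<^sub>2 + ksign k *\<^sub>C (br \<gamma>\<^sub>2 \<beta> + dA \<beta>)"
      using W_gauge[OF v \<alpha> K(1) \<beta>_def, of \<gamma>\<^sub>1] by (simp add: \<gamma>2_eq scaleC_add_right)
    \<comment> \<open>The graded commutator of \<open>D \<gamma>\<^sub>2\<close> with
      \<open>I \<beta>\<close> is \<open>L \<beta>\<close> minus \<open>I\<close> of
      \<open>dA \<beta> + br \<gamma>\<^sub>2 \<beta>\<close>: its first part accounts for
      \<open>QV\<close>, its second for \<open>eW\<close>.\<close>
    show ?thesis
      using dE_I[OF \<beta>, of "?Q y"] L_I[OF \<gamma>2 \<beta>, of "?Q y"]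
      by (intro exI[of _ \<beta>], cases rule: ksign_cases[of k])
        (simp_all add: N_Der_hom[OF v] D_eq QV QI eW clinear_simps[OF lin] I_simps ksign_diff scaleC_one)
  qed
qed

end

section \<open>The connection on cohomology\<close>

lemma coh_class_eqI:
  assumes D: "clinear D" and a: "a = b + D w"
  shows "coh_class D a = coh_class D b"
proof -
  have "a + D y = b + D (w + y)" "b + D y = a + D (y - w)" for y
    by (simp_all add: a clinear_simps[OF D] algebra_simps)
  then show ?thesis unfolding coh_class_def by blast
qed

lemma coh_class_add:
  assumes D: "clinear D"
  shows "{a + b | a b. a \<in> coh_class D z \<and> b \<in> coh_class D z'} = coh_class D (z + z')"
proof -
  have "z + D y + (z' + D y') = z + z' + D (y + y')" "z + z' + D y = (z + D y) + (z' + D 0)" for y y'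
    by (simp_all add: clinear_simps[OF D] algebra_simps)
  then show ?thesis unfolding coh_class_def by (intro set_eqI iffI; blast)
qed

text \<open>The union over representatives collapses to one coset, since \<open>T\<close> sends
  coboundaries to coboundaries and a coset is never empty.\<close>

lemma coh_map_class:
  assumes D: "clinear D" and D': "clinear D'" and T: "clinear T" "\<And>y. \<exists>w. T (D y) = D' w"
  shows "coh_map D' T (coh_class D z) = coh_class D' (T z)"
proof -
  have "coh_class D' (T x) = coh_class D' (T z)" if x: "x \<in> coh_class D z" for x
  proof -
    obtain y where y: "x = z + D y" using x by (auto simp: coh_class_def)
    obtain w where "T (D y) = D' w" using T(2) by blast
    then show ?thesis by (intro coh_class_eqI[OF D', of _ _ w]) (simp add: y clinear_add[OF T(1)])
  qed
  moreover have "z + D 0 \<in> coh_class D z" unfolding coh_class_def by blast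
  ultimately show ?thesis unfolding coh_map_def by blast
qed

context xi_module
begin

abbreviation "cls \<gamma> \<equiv> coh_class (D \<gamma>)"

text \<open>Isolates what passage to cohomology uses, so that sums, multiples and graded brackets
  are handled without showing them to be derivations.\<close>

definition descends :: "('g, 'r) tensor \<Rightarrow> ('r \<Rightarrow> 'r) \<Rightarrow> bool"
  where "descends \<gamma> v \<longleftrightarrow> clinear v \<and> (\<forall>y. \<exists>w. N \<gamma> v (D \<gamma> y) = D \<gamma> w)"

lemma H_nabla_class:
  assumes "descends \<gamma> v"
  shows "H_nabla g h m mx R \<gamma> v (cls \<gamma> z) = cls \<gamma> (N \<gamma> v z)"
  unfolding H_nabla_def using assms
  by (intro coh_map_class clinear_D clinear_N) (simp_all add: descends_def)

lemma descends_Der: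
  assumes v: "v \<in> Der R" and \<gamma>: "\<gamma> \<in> A 1" "dA \<gamma> + (1/2) *\<^sub>C br \<gamma> \<gamma> = 0"
  shows "descends \<gamma> v"
  unfolding descends_def by (metis Der_clinear[OF v] D_N_Der[OF v \<gamma>])

lemma descends_MC: "v \<in> Der R \<Longrightarrow> \<gamma> \<in> MC g R \<Longrightarrow> descends \<gamma> v"
  by (rule descends_Der[OF _ MC_mem MC_eq])

lemma descends_add: "descends \<gamma> v \<Longrightarrow> descends \<gamma> w \<Longrightarrow> descends \<gamma> (\<lambda>r. v r + w r)"
  unfolding descends_def by (auto simp: N_fun intro: clin) (metis clinear_add[OF clinear_D])

lemma descends_Mul:
  assumes v: "v \<in> Der R" and \<gamma>: "\<gamma> \<in> MC g R"
  shows "descends \<gamma> (\<lambda>s. Mul R r (v s))"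
proof -
  have "clinear (\<lambda>s. Mul R r (v s))"
    by (rule cbilinear_comp2[OF cbilinear_Mul Der_clinear[OF v]])
  moreover have "\<exists>w. R_scale h R r (N \<gamma> v (D \<gamma> y)) = D \<gamma> w" for y
    using descends_MC[OF v \<gamma>] R_scale_D[OF MC_mem[OF \<gamma>]] unfolding descends_def by metis
  ultimately show ?thesis by (simp add: descends_def N_Mul[OF v])
qed

text \<open>By flatness on cochains, the operator along the bracket is a graded commutator of
  operators that preserve coboundaries.\<close>

lemma descends_der_bracket:
  assumes v: "v \<in> Der_hom R k" and w: "w \<in> Der_hom R l" and \<gamma>: "\<gamma> \<in> MC g R"
  shows "descends \<gamma> (der_bracket k l v w)"
proof -
  have "clinear (der_bracket k l v w)"
    unfolding der_bracket_def
    by (intro clinear_minus clinear_scaleC clinear_comp[of v w] clinear_comp[of w v]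
        H.Der_homD(1)[OF v] H.Der_homD(1)[OF w])
  moreover have D: "N \<gamma> v (D \<gamma> y) = D \<gamma> (ksign k *\<^sub>C N \<gamma> v y)" "N \<gamma> w (D \<gamma> y) = D \<gamma> (ksign l *\<^sub>C N \<gamma> w y)" for y
    by (simp_all add: clinear_scale[OF clinear_D] scaleC_scaleC
        D_N[OF v MC_mem[OF \<gamma>] MC_eq[OF \<gamma>]] D_N[OF w MC_mem[OF \<gamma>] MC_eq[OF \<gamma>]])
  have "\<exists>x. N \<gamma> (der_bracket k l v w) (D \<gamma> y) = D \<gamma> x" for y
    unfolding N_N[OF v w MC_mem[OF \<gamma>], symmetric] D
    by (metis clinear_scale[OF clinear_D] clinear_diff[OF clinear_D])
  ultimately show ?thesis by (simp add: descends_def)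
qed

lemma N_cocycle:
  "v \<in> Der R \<Longrightarrow> \<gamma> \<in> MC g R \<Longrightarrow> D \<gamma> z = 0 \<Longrightarrow> D \<gamma> (N \<gamma> v z) = 0"
  by (metis D_N_Der[OF _ MC_mem MC_eq])

lemma R_scale_class:
  "\<gamma> \<in> MC g R \<Longrightarrow> coh_map (D \<gamma>) (R_scale h R r) (cls \<gamma> z) = cls \<gamma> (R_scale h R r z)"
  by (rule coh_map_class[OF clinear_D clinear_D H.clinear_R_scale]) (metis R_scale_D MC_mem)

lemma H_trans_class:
  assumes "gauge_mor g R \<alpha> \<gamma>\<^sub>1 \<gamma>\<^sub>2"
  shows "H_trans h m R \<alpha> \<gamma>\<^sub>1 \<gamma>\<^sub>2 (cls \<gamma>\<^sub>1 z) = cls \<gamma>\<^sub>2 (op_exp (L \<alpha>) z)"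
  unfolding H_trans_def
  by (rule coh_map_class[OF clinear_D clinear_D exp_D(2)[OF assms]]) (metis exp_D(1)[OF assms])

text \<open>On a cocycle the half of the homotopy term that applies \<open>D\<close> first vanishes
  and the other half is a coboundary. This has no sign left, so it adds up over the homogeneous
  parts of \<open>v\<close>.\<close>

lemma exp_N_Der:
  assumes v: "v \<in> Der R" and mor: "gauge_mor g R \<alpha> \<gamma>\<^sub>1 \<gamma>\<^sub>2" and y: "D \<gamma>\<^sub>1 y = 0"
  shows "\<exists>w. op_exp (L \<alpha>) (N \<gamma>\<^sub>1 v y) = N \<gamma>\<^sub>2 v (op_exp (L \<alpha>) y) + D \<gamma>\<^sub>2 w"
  using v
proof (induct v rule: Der_induct)
  case zero
  show ?case
    by (rule exI[of _ 0]) (simp add: N_zero clinear_0[OF exp_D(2)[OF mor]] clinear_0[OF clinear_D])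
next
  case (add v u k)
  note v' = H.Der_homD[OF add(1)]
  have "D \<gamma>\<^sub>2 (op_exp (L \<alpha>) y) = 0"
    using exp_D(1)[OF mor, of y] y by (simp add: clinear_0[OF exp_D(2)[OF mor]])
  then obtain t where t: "op_exp (L \<alpha>) (N \<gamma>\<^sub>1 v y)
      = N \<gamma>\<^sub>2 v (op_exp (L \<alpha>) y) - D \<gamma>\<^sub>2 (I t (op_exp (L \<alpha>) y))"
    using exp_D(3)[OF mor add(1), of y] by (auto simp: I_simps)
  obtain w where w: "op_exp (L \<alpha>) (N \<gamma>\<^sub>1 u y) = N \<gamma>\<^sub>2 u (op_exp (L \<alpha>) y) + D \<gamma>\<^sub>2 w"
    using add(3) by blast
  show ?case
    by (rule exI[of _ "w - I t (op_exp (L \<alpha>) y)"])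
      (simp add: N_fun(1)[OF v'(1) add(2)] clinear_add[OF exp_D(2)[OF mor]] t w
        clinear_diff[OF clinear_D])
qed

lemma Der_hom_Der: "v \<in> Der_hom R k \<Longrightarrow> v \<in> Der R"
  unfolding Der_def by (rule CollectI, rule exI[of _ "{k}"], rule exI[of _ "\<lambda>_. v"]) simp

lemma flat_connection_H:
  "flat_connection R (MC g R) (gauge_mor g R) (H_sheaf h m R) (H_trans h m R) (H_nabla g h m mx R)"
proof -
  have classE: "\<exists>z. c = cls \<gamma> z \<and> D \<gamma> z = 0" if "c \<in> Car (H_sheaf h m R \<gamma>)" for c \<gamma>
    using that by (auto simp: H_sheaf_def cohomology_def)
  have classI: "cls \<gamma> z \<in> Car (H_sheaf h m R \<gamma>)" if "D \<gamma> z = 0" for z \<gamma>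
    using that by (auto simp: H_sheaf_def cohomology_def)
  have Add: "Add (H_sheaf h m R \<gamma>) (cls \<gamma> z) (cls \<gamma> z') = cls \<gamma> (z + z')" for \<gamma> z z'
    by (simp add: H_sheaf_def coh_class_add[OF clinear_D])
  have Scale: "Scale (H_sheaf h m R \<gamma>) r (cls \<gamma> z) = cls \<gamma> (R_scale h R r z)"
    if "\<gamma> \<in> MC g R" for \<gamma> r z
    using R_scale_class[OF that] by (simp add: H_sheaf_def)
  note nab = H_nabla_class[OF descends_MC]
  show ?thesis
    unfolding flat_connection_def
  proof (intro conjI ballI allI impI, goal_cases)
    case (1 \<gamma> v c)
    then show ?case using classE[OF 1(3)] by (auto simp: nab intro!: classI N_cocycle)
  next
    case (2 \<gamma> v c c')
    then show ?case using classE[OF 2(3)] classE[OF 2(4)]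
      by (auto simp: nab Add clinear_add[OF clinear_N[OF Der_clinear]])
  next
    case (3 \<gamma> v w c)
    then show ?case using classE[OF 3(4)]
      by (auto simp: nab Add H_nabla_class[OF descends_add[OF descends_MC descends_MC]]
          N_fun Der_clinear)
  next
    case (4 \<gamma> v r c)
    then show ?case using classE[OF 4(3)]
      by (auto simp: nab Scale H_nabla_class[OF descends_Mul] N_Mul)
  next
    case (5 \<gamma> k i v r c)
    then show ?case using classE[OF 5(4)]
      by (auto simp: nab[OF Der_hom_Der] Scale Add N_R_scale MC_mem)
  next
    case (6 \<gamma> k l v w c)
    obtain z where z: "c = cls \<gamma> z" using classE[OF 6(4)] by blast
    \<comment> \<open>The module record offers only addition and scaling, so the subtraction in the
      graded commutator is scaling by a multiple of the unit.\<close>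
    have "R_scale h R (- (ksign (k * l) *\<^sub>C One R)) y = - (ksign (k * l) *\<^sub>C y)" for y
      by (simp add: clinear_simps[OF H.clinear_R_scale_fun] H.R_scale_One)
    then show ?case
      using N_N[OF 6(2,3) MC_mem[OF 6(1)], of z]
      by (simp add: z nab[OF Der_hom_Der[OF 6(2)] 6(1)] nab[OF Der_hom_Der[OF 6(3)] 6(1)]
          Scale[OF 6(1)] Add H_nabla_class[OF descends_der_bracket[OF 6(2,3,1)]])
  next
    case (7 \<alpha> \<gamma>\<^sub>1 \<gamma>\<^sub>2 v c)
    then have MC: "\<gamma>\<^sub>1 \<in> MC g R" "\<gamma>\<^sub>2 \<in> MC g R" and mor: "gauge_mor g R \<alpha> \<gamma>\<^sub>1 \<gamma>\<^sub>2" by auto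
    obtain z where z: "c = cls \<gamma>\<^sub>1 z" "D \<gamma>\<^sub>1 z = 0" using classE[OF 7(3)] by blast
    obtain w where "op_exp (L \<alpha>) (N \<gamma>\<^sub>1 v z) = N \<gamma>\<^sub>2 v (op_exp (L \<alpha>) z) + D \<gamma>\<^sub>2 w"
      using exp_N_Der[OF 7(2) mor z(2)] by blast
    then show ?case
      by (simp add: z(1) nab[OF 7(2) MC(1)] nab[OF 7(2) MC(2)] H_trans_class[OF mor]
          coh_class_eqI[OF clinear_D])
  qed
qed

lemma H_nabla_formula:
  assumes "\<gamma> \<in> MC g R" "v \<in> Der_hom R k"
  shows "H_nabla g h m mx R \<gamma> v (cls \<gamma> z) = cls \<gamma> (V v z + ksign k *\<^sub>C I (W v \<gamma>) z)"
  using assms by (simp add: H_nabla_class[OF descends_MC] Der_hom_Der N_Der_hom)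

end

text \<open>Base change commutes with the differentials, the actions and related derivations, hence
  with \<open>D\<close> and \<open>N\<close> already on cochains.\<close>

lemma H_nabla_base_change:
  assumes X: "xi_module g R h m mx" and X': "xi_module g R' h m mx" and \<phi>: "artin_hom R R' \<phi>"
    and v: "v \<in> Der R" and v': "v' \<in> Der R'" and vv: "\<And>r. \<phi> (v r) = v' (\<phi> r)"
    and \<gamma>: "\<gamma> \<in> MC g R" and c: "c \<in> Car (H_sheaf h m R \<gamma>)"
  shows "coh_map (D_op h m R' (base_change \<phi> \<gamma>)) (base_change \<phi>) (H_nabla g h m mx R \<gamma> v c) =
    H_nabla g h m mx R' (base_change \<phi> \<gamma>) v'
      (coh_map (D_op h m R' (base_change \<phi> \<gamma>)) (base_change \<phi>) c)"
proof -
  interpret X: xi_module g R h m mx by (rule X)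
  interpret X': xi_module g R' h m mx by (rule X')
  interpret Bh: graded_base_change R R' h \<phi> by unfold_locales (rule \<phi>)
  interpret Bg: graded_base_change R R' X.g' \<phi> by unfold_locales (rule \<phi>)
  note lin = clinear_base_change[OF Bh.clinear_hom]
  define \<gamma>' where "\<gamma>' = base_change \<phi> \<gamma>"
  have bc_dA: "base_change \<phi> (X.dA t) = X'.dA (base_change \<phi> t)" for t
    unfolding X.dA_tmap X'.dA_tmap by (rule Bg.base_change_tmap[OF X.clinear_Difg X.grg])
  have bc_br: "base_change \<phi> (X.br s t) = X'.br (base_change \<phi> s) (base_change \<phi> t)" for s t
    unfolding X.br_ext X'.br_ext by (rule Bg.base_change_ext_act[OF X.cbilinear_Br X.grg])
  have "base_change \<phi> (X.dA \<gamma> + (1/2) *\<^sub>C X.br \<gamma> \<gamma>) = X'.dA \<gamma>' + (1/2) *\<^sub>C X'.br \<gamma>' \<gamma>'"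
    by (simp add: clinear_simps[OF lin] bc_dA bc_br \<gamma>'_def)
  \<comment> \<open>Degree and equation are all that descent to cohomology over \<open>R'\<close>
    uses, so nothing has to be said about the image of the maximal ideal.\<close>
  then have \<gamma>': "\<gamma>' \<in> X'.A 1" "X'.dA \<gamma>' + (1/2) *\<^sub>C X'.br \<gamma>' \<gamma>' = 0"
    using Bh.base_change_mem[OF X.MC_mem[OF \<gamma>]] X.MC_eq[OF \<gamma>]
    by (simp_all add: \<gamma>'_def clinear_0[OF lin])
  have bc_D: "base_change \<phi> (X.D \<gamma> y) = X'.D \<gamma>' (base_change \<phi> y)" for y
    using Bh.base_change_tmap[OF X.clinear_Difh X.grh, of y]
      Bh.base_change_ext_act[OF X.cbilinear_m X.grg, of \<gamma> y]
    by (simp add: X.D_eq X'.D_eq X.dE_tmap X'.dE_tmap clinear_add[OF lin] \<gamma>'_def)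
  \<comment> \<open>The connection differentiates \<gamma> along the sign-twisted field, so the
    twisted fields have to be related by \<phi> as well.\<close>
  have kos: "\<phi> (kos_op (Gr R) j v r) = kos_op (Gr R') j v' (\<phi> r)" for j r
    by (simp add: kos_op_def Bh.hom_par vv)
  have bc_N: "base_change \<phi> (X.N \<gamma> v y) = X'.N \<gamma>' v' (base_change \<phi> y)" for y
    using Bh.base_change_dd[OF Der_clinear[OF v] Der_clinear[OF v'] vv, of y]
      Bg.base_change_dd[OF clinear_kos_op[OF X.grR Der_clinear[OF v]]
        clinear_kos_op[OF X'.grR Der_clinear[OF v']] kos, of "- 1" \<gamma>]
      Bh.base_change_ext_act[OF X.cbilinear_ia X.grg, of _ y]
    by (simp add: nabla_def X.I_ext X'.I_ext X.W_dd X'.W_dd clinear_add[OF lin] \<gamma>'_def)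
  have cls: "coh_map (X'.D \<gamma>') (base_change \<phi>) (X.cls \<gamma> z) = X'.cls \<gamma>' (base_change \<phi> z)" for z
    by (rule coh_map_class[OF X.clinear_D X'.clinear_D lin]) (metis bc_D)
  obtain z where z: "c = X.cls \<gamma> z" using c by (auto simp: H_sheaf_def cohomology_def)
  show ?thesis
    by (simp add: z X.H_nabla_class[OF X.descends_MC[OF v \<gamma>]] cls bc_N
        X'.H_nabla_class[OF X'.descends_Der[OF v' \<gamma>']] flip: \<gamma>'_def)
qed

text \<open>The last conjunct makes the word natural precise. Derivations need not push forward
  along \<phi>, so the connections over the two algebras are compared along \<phi>-related
  pairs.\<close>

theorem proposition3p2:
  fixes g :: "'g::cvector dgl"
    and h :: "'h::cvector dg"
    and m :: "'g \<Rightarrow> 'h \<Rightarrow> 'h"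
    and mx :: "('g, cxi) tensor \<Rightarrow> 'h \<Rightarrow> 'h"
    and R :: "'r::cvector dga"
    and R' :: "'s::cvector dga"
  assumes "dg_lie_algebra g"
    and "dg_lie_module g h m"
    and "dg_lie_module (tensor_dgl g Cxi) h mx"
    and "\<forall>a x. mx (a \<otimes> One Cxi) x = m a x"
    and "graded_artin R"
    and "graded_artin R'"
  shows "flat_connection R (MC g R) (gauge_mor g R) (H_sheaf h m R) (H_trans h m R)
           (H_nabla g h m mx R)
    \<and> (\<forall>\<gamma>\<in>MC g R. \<forall>k. \<forall>v\<in>Der_hom R k. \<forall>z. D_op h m R \<gamma> z = 0 \<longrightarrow>
           H_nabla g h m mx R \<gamma> v (coh_class (D_op h m R \<gamma>) z) =
             coh_class (D_op h m R \<gamma>)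
               (dd h R v z + ksign k *\<^sub>C i_op g h mx R (dd g R v \<gamma>) z))
    \<and> (\<forall>\<phi> v v'. artin_hom R R' \<phi> \<and> v \<in> Der R \<and> v' \<in> Der R' \<and> (\<forall>r. \<phi> (v r) = v' (\<phi> r)) \<longrightarrow>
           (\<forall>\<gamma>\<in>MC g R. \<forall>c\<in>Car (H_sheaf h m R \<gamma>).
              coh_map (D_op h m R' (base_change \<phi> \<gamma>)) (base_change \<phi>) (H_nabla g h m mx R \<gamma> v c) =
              H_nabla g h m mx R' (base_change \<phi> \<gamma>) v'
                (coh_map (D_op h m R' (base_change \<phi> \<gamma>)) (base_change \<phi>) c)))"
proof -
  have mx_One: "mx (a \<otimes> One Cxi) x = m a x" for a x using assms(4) by simp
  interpret X: xi_module g R h m mx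
    by unfold_locales (rule assms(1) assms(5) assms(2) assms(3) mx_One)+
  interpret X': xi_module g R' h m mx
    by unfold_locales (rule assms(1) assms(6) assms(2) assms(3) mx_One)+
  show ?thesis
  proof (intro conjI allI ballI impI, goal_cases)
    case 1
    show ?case by (rule X.flat_connection_H)
  next
    case (2 \<gamma> k v z)
    then show ?case by (intro X.H_nabla_formula)
  next
    case (3 \<phi> v v' \<gamma> c)
    then show ?case
      by (intro H_nabla_base_change[OF X.xi_module_axioms X'.xi_module_axioms]) auto
  qed
qed

end
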